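(* For every $\alpha\in\mathbb C$ and $\eta\in\mathbb Z/2\mathbb Z$, the operator $T_{\alpha,\eta}$ maps the space $\mathcal S_{\rm sis}(\mathbb R)$ to itself.
   Context: Definition of $\mathcal S_{\rm sis}(\mathbb R)$. A function $f\in C^\infty(\mathbb R-\{0\})$ has a singularity of type $(\alpha,\eta)\in\mathbb C\times\mathbb Z/2\mathbb Z$ at $x=0$ if there exist $C^\infty$ functions $f_0,\dots,f_n$ defined near $x=0$ such that $f(x)=\sum_{0\le j\le n}(\operatorname{sgn}x)^\eta|x|^\alpha(\log|x|)^jf_j(x)$ for $0<|x|\ll1$. It has a simple singularity at $x=0$ if, locally near $x=0$, it can be expressed as a finite sum of functions $g_j$, $1\le j\le m$, each of which has a singularity of some type $(\alpha_j,\eta_j)\in\mathbb C\times\mathbb Z/2\mathbb Z$. $\mathcal S_{\rm sis}(\mathbb R)$ is the space of functions $f\in C^\infty(\mathbb R-\{0\})$ which have a simple singularity at $x=0$ and decay rapidly, along with all of their derivatives, as $|x|\to\infty$. Definition of $T_{\alpha,\eta}$. For $f\in\mathcal S_{\rm sis}(\mathbb R)$, $$T_{\alpha,\eta}(f)=\mathcal F\bigl(x\mapsto f(1/x)(\operatorname{sgn}x)^\eta|x|^{-\alpha-1}\bigr),$$ regarded as a function on $\mathbb R-\{0\}$, where $\mathcal F g(y)=\int_{\mathbb R}g(x)e^{-2\pi ixy}\,dx$ is the Fourier transform. The function $x\mapsto f(1/x)(\operatorname{sgn}x)^\eta|x|^{-\alpha-1}$ extends smoothly by $0$ across $x=0$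 and, together with its derivatives, grows at most polynomially as $|x|\to\infty$; the integral converges absolutely when $\operatorname{Re}\alpha$ is sufficiently large, and in general the Fourier transform is taken in the sense of tempered distributions and restricted to $\mathbb R-\{0\}$, where it is a $C^\infty$ function (equivalently, one uses holomorphic continuation in $\alpha$ of the values $T_{\alpha,\eta}(f)(y)$, $y\ne0$). *)

theory Defs
  imports "HOL-Analysis.Analysis" "HOL-Library.Z2"
begin

definition vderiv :: "(real \<Rightarrow> complex) \<Rightarrow> real \<Rightarrow> complex" where
  "vderiv f = (\<lambda>x. vector_derivative f (at x))"

text \<open>
  The derivatives below are two-sided, so this is the usual notion of a
  \<open>C\<^sup>\<infinity>\<close> function only for open \<open>S\<close>, the only case used.
\<close>

definition smooth_on :: "real set \<Rightarrow> (real \<Rightarrow> complex) \<Rightarrow> bool" where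
  "smooth_on S f \<longleftrightarrow> (\<forall>n. \<forall>x\<in>S. (vderiv ^^ n) f differentiable (at x))"

text \<open>
  A function on \<open>\<real> - {0}\<close> is encoded as a total function with the dummy value \<open>0\<close> at \<open>0\<close>.
  This makes the encoding injective, so that sets of such functions and operators on them
  are the genuine ones.
\<close>

definition smooth_punctured :: "(real \<Rightarrow> complex) set" where
  "smooth_punctured = {f. f 0 = 0 \<and> smooth_on (- {0}) f}"

text \<open>The type \<^typ>\<open>bit\<close> is the two-element field, so it serves as \<open>\<int>/2\<int>\<close>.\<close>

definition sgn_pow :: "bit \<Rightarrow> real \<Rightarrow> complex" where
  "sgn_pow \<eta> x = (if \<eta> = 0 then 1 else of_real (sgn x))"

definition has_singularity_type :: "complex \<Rightarrow> bit \<Rightarrow> (real \<Rightarrow> complex) \<Rightarrow> bool" where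
  "has_singularity_type \<alpha> \<eta> f \<longleftrightarrow>
     f \<in> smooth_punctured \<and>
     (\<exists>(n::nat) F e. e > 0 \<and> (\<forall>j\<le>n. smooth_on {-e<..<e} (F j)) \<and>
        (\<forall>x. 0 < \<bar>x\<bar> \<and> \<bar>x\<bar> < e \<longrightarrow>
           f x = (\<Sum>j\<le>n. sgn_pow \<eta> x * of_real \<bar>x\<bar> powr \<alpha> * of_real (ln \<bar>x\<bar>) ^ j * F j x)))"

definition has_simple_singularity :: "(real \<Rightarrow> complex) \<Rightarrow> bool" where
  "has_simple_singularity f \<longleftrightarrow>
     (\<exists>(m::nat) g \<alpha> \<eta> e. e > 0 \<and> (\<forall>j\<in>{1..m}. has_singularity_type (\<alpha> j) (\<eta> j) (g j)) \<and>
        (\<forall>x. 0 < \<bar>x\<bar> \<and> \<bar>x\<bar> < e \<longrightarrow> f x = (\<Sum>j=1..m. g j x)))"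

definition S_sis :: "(real \<Rightarrow> complex) set" where
  "S_sis = {f \<in> smooth_punctured. has_simple_singularity f \<and>
     (\<forall>n k. ((\<lambda>x. of_real (\<bar>x\<bar> ^ k) * (vderiv ^^ n) f x) \<longlongrightarrow> 0) at_infinity)}"

definition fourier :: "(real \<Rightarrow> complex) \<Rightarrow> real \<Rightarrow> complex" where
  "fourier g y = (LINT x|lborel. g x * exp (- (2 * of_real pi * \<i> * of_real (x * y))))"

text \<open>
  A distribution is encoded as a functional on functions \<open>\<real> \<Rightarrow> \<complex>\<close>; it is only
  meaningful on Schwartz functions.  The Fourier transform of a tempered distribution is
  defined by duality.
\<close>

type_synonym distr = "(real \<Rightarrow> complex) \<Rightarrow> complex"

definition distr_of_fun :: "(real \<Rightarrow> complex) \<Rightarrow> distr" where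
  "distr_of_fun g = (\<lambda>\<phi>. LINT x|lborel. g x * \<phi> x)"

definition fourier_distr :: "distr \<Rightarrow> distr" where
  "fourier_distr u = (\<lambda>\<phi>. u (fourier \<phi>))"

definition test_fun_punctured :: "(real \<Rightarrow> complex) set" where
  "test_fun_punctured =
     {\<phi>. smooth_on UNIV \<phi> \<and> (\<exists>K. compact K \<and> 0 \<notin> K \<and> (\<forall>x. x \<notin> K \<longrightarrow> \<phi> x = 0))}"

text \<open>
  The restriction of the distribution \<open>u\<close> to \<open>\<real> - {0}\<close> is the smooth function \<open>h\<close>.
  There is at most one such \<open>h\<close>.
\<close>

definition restricts_to :: "distr \<Rightarrow> (real \<Rightarrow> complex) \<Rightarrow> bool" where
  "restricts_to u h \<longleftrightarrow>
     h \<in> smooth_punctured \<and> (\<forall>\<phi>\<in>test_fun_punctured. u \<phi> = distr_of_fun h \<phi>)"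

definition T_arg :: "complex \<Rightarrow> bit \<Rightarrow> (real \<Rightarrow> complex) \<Rightarrow> real \<Rightarrow> complex" where
  "T_arg \<alpha> \<eta> f x =
     (if x = 0 then 0 else f (1 / x) * sgn_pow \<eta> x * of_real \<bar>x\<bar> powr (- \<alpha> - 1))"

text \<open>
  For \<open>f\<close> in \<^const>\<open>S_sis\<close> the function \<^term>\<open>T_arg \<alpha> \<eta> f\<close> is smooth and grows at most
  polynomially, so it defines a tempered distribution for every \<open>\<alpha>\<close>.
\<close>

definition T_distr :: "complex \<Rightarrow> bit \<Rightarrow> (real \<Rightarrow> complex) \<Rightarrow> distr" where
  "T_distr \<alpha> \<eta> f = fourier_distr (distr_of_fun (T_arg \<alpha> \<eta> f))"

definition T :: "complex \<Rightarrow> bit \<Rightarrow> (real \<Rightarrow> complex) \<Rightarrow> real \<Rightarrow> complex" where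
  "T \<alpha> \<eta> f = (THE h. restricts_to (T_distr \<alpha> \<eta> f) h)"

end

theory Submission imports Defs begin

text \<open>
  Write \<open>\<theta> = x d/dx\<close>. When the integral defining \<open>T\<^sub>\<alpha>\<close> converges, \<open>\<theta> T\<^sub>\<alpha> f = T\<^sub>\<alpha> (\<theta> f + \<alpha> f)\<close>
  and \<open>2\<pi>iy T\<^sub>\<alpha> f = T\<^sub>\<alpha>\<^sub>+\<^sub>1 (-\<theta> f - (\<alpha> + 1) f)\<close>. The second identity reduces the general case to the
  convergent one; together they give smoothness off the origin and rapid decay. Moreover \<open>T\<^sub>\<alpha> f\<close>
  is of class \<open>C\<^sup>n\<close> across the origin, with \<open>n\<close> as large as one likes, if \<open>f\<close> vanishes to
  sufficiently high order at \<open>0\<close>.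
  For a cutoff monomial \<open>f = \<bar>x\<bar>\<^sup>\<beta> (log \<bar>x\<bar>)\<^sup>k x\<^sup>n \<chi>(x)\<close> the function \<open>(\<theta> - \<beta> - n)\<^sup>k\<^sup>+\<^sup>1 f\<close> vanishes near \<open>0\<close>, so
  \<open>u = T\<^sub>\<alpha> f\<close> solves an Euler equation \<open>(\<theta> - \<alpha> - \<beta> - n)\<^sup>k\<^sup>+\<^sup>1 u = w\<close> with \<open>w\<close> smooth, and hence \<open>u\<close> is
  a smooth function plus a combination of \<open>\<bar>y\<bar>\<^sup>\<alpha>\<^sup>+\<^sup>\<beta>\<^sup>+\<^sup>n (log \<bar>y\<bar>)\<^sup>i\<close>; no Gamma factors are needed.
  Taylor expansion of the smooth coefficients of \<open>f\<close> and Borel's lemma then produce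
  the smooth coefficients of \<open>T\<^sub>\<alpha> f\<close>.
\<close>


section \<open>Smooth functions on the line\<close>

text \<open>Under the inversion \<open>x -> 1 / x\<close> the two ends of the line trade places:
  vanishing of \<open>f\<close> at 0 to order \<open>a\<close> becomes decay of the integrand at
  infinity, and rapid decay of \<open>f\<close> becomes flatness of the integrand at 0. All
  convergence questions thus reduce to the size of \<open>a + Re \<alpha>\<close>: at least 1 for
  the integral to converge, and one unit more for each derivative taken. The obstacle in the last
  step is that a Taylor remainder of order N only gives finite regularity of the transform, whereas
  the coefficients at the origin must be smooth. Hence the Taylor coefficients and the Borel sums
  are fixed before N. For every N the difference between the transform and the resummed expansion
  then has an extension of class C^N across the origin, and continuity at 0 forces all these
  extensions to coincide. This is why finite differentiability is the basic notion, and why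
  remainders are kept as products \<open>x ^ N * R\<close> with smooth \<open>R\<close> instead of
  being estimated: the factor \<open>x ^ N\<close> raises the exponent of a singular term by N, and
  with it the regularity.\<close>

primrec ck_on :: "nat \<Rightarrow> real set \<Rightarrow> (real \<Rightarrow> complex) \<Rightarrow> bool" where
  "ck_on 0 S f \<longleftrightarrow> continuous_on S f"
| "ck_on (Suc n) S f \<longleftrightarrow>
     (\<exists>f'. (\<forall>x\<in>S. (f has_vector_derivative f' x) (at x)) \<and> ck_on n S f')"

section \<open>Calculus of functions of class C^n\<close>

lemma ck_on_cong:
  assumes "open S" "\<And>x. x \<in> S \<Longrightarrow> f x = g x" "ck_on n S f"
  shows "ck_on n S g"
proof (cases n)
  case 0
  then show ?thesis using assms by (simp cong: continuous_on_cong)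
next
  case (Suc m)
  then obtain f' where f': "\<And>x. x \<in> S \<Longrightarrow> (f has_vector_derivative f' x) (at x)" "ck_on m S f'"
    using assms by auto
  have "(g has_vector_derivative f' x) (at x)" if "x \<in> S" for x
    using has_vector_derivative_transform_within_open[OF f'(1)[OF that] assms(1) that] assms(2) by auto
  then show ?thesis using Suc f' by auto
qed

lemma continuous_on_vector_derivative:
  fixes f :: "real \<Rightarrow> 'a::real_normed_vector"
  assumes "\<And>x. x \<in> S \<Longrightarrow> (f has_vector_derivative f' x) (at x)"
  shows "continuous_on S f"
  by (meson assms continuous_at_imp_continuous_on has_vector_derivative_continuous)

lemma ck_on_SucI:
  assumes "\<And>x. x \<in> S \<Longrightarrow> (f has_vector_derivative f' x) (at x)" "ck_on n S f'"
  shows "ck_on (Suc n) S f"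
  using assms by auto

lemma ck_on_SucE:
  assumes "ck_on (Suc n) S f"
  obtains f' where "\<And>x. x \<in> S \<Longrightarrow> (f has_vector_derivative f' x) (at x)" "ck_on n S f'"
  using assms by auto

lemma ck_on_Suc_imp: "ck_on (Suc n) S f \<Longrightarrow> ck_on n S f"
proof (induction n arbitrary: f)
  case 0
  then show ?case using continuous_on_vector_derivative by auto
next
  case (Suc n)
  then obtain f' where f': "\<And>x. x \<in> S \<Longrightarrow> (f has_vector_derivative f' x) (at x)" "ck_on (Suc n) S f'"
    by (subst (asm) ck_on.simps) blast
  show ?case using ck_on_SucI[OF f'(1) Suc.IH[OF f'(2)]] .
qed

lemma ck_on_mono: "m \<le> n \<Longrightarrow> ck_on n S f \<Longrightarrow> ck_on m S f"
proof (induction n)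
  case (Suc n)
  show ?case
  proof (cases "m = Suc n")
    case True
    then show ?thesis using Suc.prems(2) by blast
  next
    case False
    then show ?thesis using Suc.IH ck_on_Suc_imp[OF Suc.prems(2)] Suc.prems(1) by auto
  qed
qed auto

lemma ck_on_continuous: "ck_on n S f \<Longrightarrow> continuous_on S f"
  using ck_on_mono[of 0 n] by simp

lemma ck_on_subset: "V \<subseteq> S \<Longrightarrow> ck_on n S f \<Longrightarrow> ck_on n V f"
proof (induction n arbitrary: f)
  case 0
  then show ?case using continuous_on_subset by auto
next
  case (Suc n)
  then show ?case by (simp) blast
qed

lemma ck_on_const [simp]: "ck_on n S (\<lambda>x. c)"
proof (induction n arbitrary: c)
  case (Suc n)
  show ?case by (rule ck_on_SucI[OF _ Suc[of 0]]) auto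
qed simp

lemma ck_on_of_real [simp]: "ck_on n S of_real"
proof (cases n)
  case (Suc m)
  have "((of_real :: real \<Rightarrow> complex) has_vector_derivative 1) (at x)" for x
    using has_vector_derivative_of_real[of "\<lambda>x. x" 1 "at x"] by auto
  then show ?thesis unfolding Suc by (intro ck_on_SucI[OF _ ck_on_const[of _ _ 1]])
qed (simp add: continuous_on_of_real)

lemma ck_on_add: "ck_on n S f \<Longrightarrow> ck_on n S g \<Longrightarrow> ck_on n S (\<lambda>x. f x + g x)"
proof (induction n arbitrary: f g)
  case 0
  then show ?case by (auto intro: continuous_intros)
next
  case (Suc n)
  obtain f' where f': "\<And>x. x \<in> S \<Longrightarrow> (f has_vector_derivative f' x) (at x)" "ck_on n S f'"
    using Suc.prems(1) by (rule ck_on_SucE) blast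
  obtain g' where "\<And>x. x \<in> S \<Longrightarrow> (g has_vector_derivative g' x) (at x)" "ck_on n S g'"
    using Suc.prems(2) by (rule ck_on_SucE) blast
  with f' show ?case
    by (intro ck_on_SucI[where f'="\<lambda>x. f' x + g' x"] Suc.IH has_vector_derivative_add)
qed

lemma ck_on_mult: "ck_on n S f \<Longrightarrow> ck_on n S g \<Longrightarrow> ck_on n S (\<lambda>x. f x * g x)"
proof (induction n arbitrary: f g)
  case 0
  then show ?case by (auto intro: continuous_intros)
next
  case (Suc n)
  obtain f' where f': "\<And>x. x \<in> S \<Longrightarrow> (f has_vector_derivative f' x) (at x)" "ck_on n S f'"
    using Suc.prems(1) by (rule ck_on_SucE) blast
  obtain g' where g': "\<And>x. x \<in> S \<Longrightarrow> (g has_vector_derivative g' x) (at x)" "ck_on n S g'"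
    using Suc.prems(2) by (rule ck_on_SucE) blast
  show ?case
    by (intro ck_on_SucI[where f'="\<lambda>x. f x * g' x + f' x * g x"] ck_on_add Suc.IH
        has_vector_derivative_mult f' g' Suc.prems[THEN ck_on_Suc_imp])
qed

lemma ck_on_scale: "ck_on n S f \<Longrightarrow> ck_on n S (\<lambda>x. c * f x)"
  by (intro ck_on_mult ck_on_const)

lemma ck_on_diff: "ck_on n S f \<Longrightarrow> ck_on n S g \<Longrightarrow> ck_on n S (\<lambda>x. f x - g x)"
  using ck_on_add[of n S f "\<lambda>x. -1 * g x"] ck_on_scale[of n S g "-1"] by simp

lemma ck_on_sum:
  "(\<And>i. i \<in> I \<Longrightarrow> ck_on n S (f i)) \<Longrightarrow> ck_on n S (\<lambda>x. \<Sum>i\<in>I. f i x)"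
  by (induction I rule: infinite_finite_induct) (auto intro: ck_on_add)

lemma ck_on_power: "ck_on n S f \<Longrightarrow> ck_on n S (\<lambda>x. f x ^ k)"
  by (induction k) (auto intro: ck_on_mult)

text \<open>As \<open>ck_on\<close> speaks of complex-valued functions only, the regularity of the
  real inner function is expressed through its embedding in the complex numbers.\<close>

lemma ck_on_compose:
  assumes "g ` S \<subseteq> V"
  shows "ck_on n V f \<Longrightarrow> ck_on n S (\<lambda>x. of_real (g x)) \<Longrightarrow> ck_on n S (\<lambda>x. f (g x))"
proof (induction n arbitrary: f)
  case 0
  then have "continuous_on S (\<lambda>x. Re (of_real (g x)))"
    by (intro continuous_intros) auto
  then have "continuous_on S g" by simp
  then show ?case using 0 assms by (auto intro: continuous_on_compose2)
next
  case (Suc n)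
  obtain f' where f': "\<And>x. x \<in> V \<Longrightarrow> (f has_vector_derivative f' x) (at x)" "ck_on n V f'"
    using Suc.prems(1) by (rule ck_on_SucE) blast
  obtain g' where
    g': "\<And>x. x \<in> S \<Longrightarrow> ((\<lambda>x. of_real (g x)) has_vector_derivative g' x) (at x)" "ck_on n S g'"
    using Suc.prems(2) by (rule ck_on_SucE) blast
  have d: "((\<lambda>x. f (g x)) has_vector_derivative g' x * f' (g x)) (at x)" if x: "x \<in> S" for x
  proof -
    have 1: "(g has_vector_derivative Re (g' x)) (at x)"
      using bounded_linear.has_vector_derivative[OF bounded_linear_Re g'(1)[OF x]] by simp
    have "((\<lambda>x. of_real (g x)) has_vector_derivative complex_of_real (Re (g' x))) (at x)"
      using has_vector_derivative_of_real 1 has_real_derivative_iff_has_vector_derivative by blast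
    \<comment> \<open>The witness \<open>g'\<close> is complex-valued; uniqueness of the derivative
      shows that its values are real, so that the chain rule for a real inner function
      applies.\<close>
    then have 2: "g' x = of_real (Re (g' x))"
      using g'(1)[OF x] vector_derivative_unique_at by blast
    have "(f \<circ> g has_vector_derivative Re (g' x) *\<^sub>R f' (g x)) (at x)"
      using 1 f'(1) x assms by (intro vector_diff_chain_at) auto
    then show ?thesis using 2[symmetric] by (simp add: o_def scaleR_conv_of_real)
  qed
  show ?case
    by (rule ck_on_SucI[OF d ck_on_mult[OF g'(2) Suc.IH[OF f'(2) ck_on_Suc_imp[OF Suc.prems(2)]]]])
qed

lemma ck_on_compose_scale: "ck_on n UNIV f \<Longrightarrow> ck_on n UNIV (\<lambda>x. f (c * x))"
proof (rule ck_on_compose[where V=UNIV])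
  show "ck_on n UNIV (\<lambda>x. complex_of_real (c * x))"
    using ck_on_scale[OF ck_on_of_real, of n UNIV "of_real c"] by simp
qed auto

lemma ck_on_inverse:
  assumes "\<And>x. x \<in> S \<Longrightarrow> f x \<noteq> 0"
  shows "ck_on n S f \<Longrightarrow> ck_on n S (\<lambda>x. inverse (f x))"
proof (induction n)
  case 0
  then show ?case using assms by (auto intro: continuous_intros)
next
  case (Suc n)
  then obtain f' where *:
    "\<And>x. x \<in> S \<Longrightarrow> (f has_vector_derivative f' x) (at x)" "ck_on n S f'" by auto
  have d: "((\<lambda>x. inverse (f x)) has_vector_derivative - 1 * f' x * inverse (f x) * inverse (f x)) (at x)"
    if x: "x \<in> S" for x
    using field_vector_diff_chain_at[OF *(1)[OF x] DERIV_inverse[OF assms[OF x]]]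
    by (simp add: o_def power2_eq_square mult.assoc)
  show ?case
    by (intro ck_on_SucI[OF d] ck_on_mult *(2) ck_on_const Suc.IH ck_on_Suc_imp[OF Suc.prems])
qed

lemma ck_on_divide:
  assumes "\<And>x. x \<in> S \<Longrightarrow> g x \<noteq> 0"
  shows "ck_on n S f \<Longrightarrow> ck_on n S g \<Longrightarrow> ck_on n S (\<lambda>x. f x / g x)"
  unfolding divide_inverse using assms by (intro ck_on_mult ck_on_inverse)

text \<open>The derivatives supplied by different \<open>V\<close> are unrelated as functions. Each
  agrees on its own \<open>V\<close> with the canonical \<open>vderiv f\<close>, so this one
  function serves on all of \<open>S\<close>.\<close>

lemma ck_on_open_cover:
  assumes "\<And>x. x \<in> S \<Longrightarrow> \<exists>V. x \<in> V \<and> open V \<and> ck_on n V f"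
  shows "ck_on n S f"
  using assms
proof (induction n arbitrary: f)
  case 0
  have "isCont f x" if "x \<in> S" for x
    using 0[OF that] by (auto simp: continuous_on_eq_continuous_at)
  then show ?case by (simp add: continuous_at_imp_continuous_on)
next
  case (Suc n)
  define f' where "f' = vderiv f"
  have 1: "\<exists>V. x \<in> V \<and> open V \<and> (\<forall>y\<in>V. (f has_vector_derivative f' y) (at y)) \<and> ck_on n V f'"
    if x: "x \<in> S" for x
  proof -
    obtain V g where V: "x \<in> V" "open V" "\<And>y. y \<in> V \<Longrightarrow> (f has_vector_derivative g y) (at y)"
      "ck_on n V g" using Suc.prems[OF x] ck_on_SucE by metis
    have "g y = f' y" if "y \<in> V" for y
      using V(3)[OF that] by (simp add: f'_def vderiv_def vector_derivative_at)
    then show ?thesis using V ck_on_cong[OF V(2) _ V(4), of f'] by (intro exI[of _ V]) auto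
  qed
  show ?case
    by (rule ck_on_SucI[of _ _ f']) (use 1 in blast, rule Suc.IH, use 1 in blast)
qed

section \<open>Comparison with iterated derivatives\<close>

lemma smooth_on_vderiv: "smooth_on S f \<Longrightarrow> smooth_on S (vderiv f)"
  unfolding smooth_on_def by (metis funpow_Suc_right comp_apply)

lemma smooth_on_has_vderiv:
  "smooth_on S f \<Longrightarrow> x \<in> S \<Longrightarrow> (f has_vector_derivative vderiv f x) (at x)"
  unfolding smooth_on_def vderiv_def
  by (metis funpow_0 vector_derivative_works)

lemma smooth_on_imp_ck_on: "smooth_on S f \<Longrightarrow> ck_on n S f"
proof (induction n arbitrary: f)
  case 0
  then show ?case using continuous_on_vector_derivative[OF smooth_on_has_vderiv] by auto
next
  case (Suc n)
  show ?case
    by (rule ck_on_SucI[OF smooth_on_has_vderiv[OF Suc.prems] Suc.IH[OF smooth_on_vderiv[OF Suc.prems]]])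
qed

lemma ck_on_vderiv:
  assumes "open S" "ck_on (Suc n) S f"
  shows "ck_on n S (vderiv f)"
proof -
  obtain f' where f': "\<And>x. x \<in> S \<Longrightarrow> (f has_vector_derivative f' x) (at x)" "ck_on n S f'"
    using assms by auto
  then have "\<And>x. x \<in> S \<Longrightarrow> f' x = vderiv f x"
    unfolding vderiv_def by (metis vector_derivative_at)
  then show ?thesis using ck_on_cong[OF assms(1) _ f'(2)] by auto
qed

text \<open>With the derivative existentially quantified, closure properties of \<open>ck_on\<close>
  are plain inductions, while \<open>smooth_on\<close> iterates one total operator. On an open set
  the witness must agree with \<open>vderiv f\<close>, which reconciles the two.\<close>

lemma smooth_on_iff_ck_on: "open S \<Longrightarrow> smooth_on S f \<longleftrightarrow> (\<forall>n. ck_on n S f)"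
proof
  assume S: "open S" and f: "\<forall>n. ck_on n S f"
  have "ck_on m S ((vderiv ^^ n) f)" for m n
    by (induction n arbitrary: m) (use f ck_on_vderiv[OF S] in \<open>auto simp del: ck_on.simps\<close>)
  then have "ck_on (Suc 0) S ((vderiv ^^ n) f)" for n by blast
  then show "smooth_on S f"
    unfolding smooth_on_def by (meson ck_on_SucE differentiableI_vector)
qed (use smooth_on_imp_ck_on in blast)

lemma smooth_onI: "open S \<Longrightarrow> (\<And>n. ck_on n S f) \<Longrightarrow> smooth_on S f"
  using smooth_on_iff_ck_on by blast

lemma smooth_on_subset: "V \<subseteq> S \<Longrightarrow> smooth_on S f \<Longrightarrow> smooth_on V f"
  unfolding smooth_on_def by blast

text \<open>The quotient \<open>f x / x\<close> is of size \<open>|x| powr (s - 1)\<close>, which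
  tends to 0. This settles the origin for flat exponentials, singular terms and the integrand of the
  transform alike.\<close>

lemma has_vector_derivative_zero_at_zero:
  fixes f :: "real \<Rightarrow> 'a::real_normed_vector"
  assumes "f 0 = 0" "s > 1" "\<And>x. x \<noteq> 0 \<Longrightarrow> \<bar>x\<bar> \<le> 1 \<Longrightarrow> norm (f x) \<le> C * \<bar>x\<bar> powr s"
  shows "(f has_vector_derivative 0) (at 0)"
proof -
  have "((\<lambda>x::real. \<bar>x\<bar> powr (s - 1)) \<longlongrightarrow> 0) (at 0)"
    using assms(2) by (intro tendsto_zero_powrI[where b="s - 1"]) (auto intro!: tendsto_rabs_zero)
  then have 1: "((\<lambda>x::real. C * \<bar>x\<bar> powr (s - 1)) \<longlongrightarrow> 0) (at 0)"
    by (rule tendsto_mult_right_zero)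
  have "\<forall>\<^sub>F x::real in at 0. norm (f x /\<^sub>R norm x) \<le> C * \<bar>x\<bar> powr (s - 1)"
    unfolding eventually_at
  proof (intro exI[of _ 1] conjI ballI impI)
    fix x :: real assume "x \<noteq> 0 \<and> dist x 0 < 1"
    then have x: "x \<noteq> 0" "\<bar>x\<bar> \<le> 1" by auto
    have "norm (f x /\<^sub>R norm x) \<le> (C * \<bar>x\<bar> powr s) / \<bar>x\<bar>"
      using assms(3)[OF x] x by (simp add: divide_simps)
    also have "\<dots> = C * \<bar>x\<bar> powr (s - 1)" using x by (simp add: powr_diff)
    finally show "norm (f x /\<^sub>R norm x) \<le> C * \<bar>x\<bar> powr (s - 1)" .
  qed simp
  from Lim_null_comparison[OF this 1] have "((\<lambda>x. f x /\<^sub>R norm x) \<longlongrightarrow> 0) (at 0)" .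
  then show ?thesis
    unfolding has_vector_derivative_def has_derivative_at using assms(1) tendsto_norm_zero[OF \<open>((\<lambda>x. f x /\<^sub>R norm x) \<longlongrightarrow> 0) (at 0)\<close>]
    by (auto simp: divide_inverse mult.commute bounded_linear_zero)
qed

section \<open>A flat function and a smooth cutoff\<close>

definition flat_exp :: "nat \<Rightarrow> real \<Rightarrow> real" where
  "flat_exp k x = (if x > 0 then exp (- (1 / x)) / x ^ k else 0)"

text \<open>A single term of the exponential series,
  \<open>(1 / x) ^ (k + 2) / fact (k + 2)\<close>, bounds \<open>exp (1 / x)\<close> from below. The
  two extra powers leave an exponent above 1, as differentiability at 0 demands.\<close>

lemma flat_exp_bound: "\<bar>flat_exp k x\<bar> \<le> fact (k + 2) * \<bar>x\<bar> powr 2"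
proof (cases "x > 0")
  case True
  have "(1 / x) ^ (k + 2) /\<^sub>R fact (k + 2) \<le> (\<Sum>n. (1 / x) ^ n /\<^sub>R fact n)"
    using sum_le_suminf[OF summable_exp_generic[of "1/x"], of "{k + 2}"] True by simp
  then have "(1 / x) ^ (k + 2) / fact (k + 2) \<le> exp (1 / x)"
    by (simp add: exp_def divide_inverse mult.commute)
  then have "exp (- (1 / x)) \<le> fact (k + 2) * x ^ (k + 2)"
    using True by (simp add: exp_minus field_simps power_divide del: power_Suc fact_Suc)
  then have "exp (- (1 / x)) / x ^ k \<le> fact (k + 2) * x ^ (k + 2) / x ^ k"
    using True by (intro divide_right_mono) auto
  also have "\<dots> = fact (k + 2) * x ^ 2" using True by (simp add: power_add field_simps power2_eq_square)
  finally show ?thesis using True by (simp add: flat_exp_def powr_numeral)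
qed (simp add: flat_exp_def)

text \<open>The powers of \<open>x\<close> in the denominator make the family closed under
  differentiation, so that smoothness follows by one induction for all \<open>k\<close>.\<close>

lemma has_vector_derivative_flat_exp:
  "(flat_exp k has_vector_derivative (flat_exp (k + 2) x - k * flat_exp (k + 1) x)) (at x)"
proof -
  consider "x > 0" | "x < 0" | "x = 0" by linarith
  then show ?thesis
  proof cases
    case 1
    have "((\<lambda>x. exp (- (1 / x)) / x ^ k) has_real_derivative
        (exp (- (1 / x)) / x ^ (k + 2) - k * (exp (- (1 / x)) / x ^ (k + 1)))) (at x)"
      using 1
      apply (auto intro!: derivative_eq_intros)
      apply (cases k)
       apply (auto simp: field_simps power2_eq_square)
      done
    then have "((\<lambda>x. exp (- (1 / x)) / x ^ k) has_vector_derivative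
        (flat_exp (k + 2) x - k * flat_exp (k + 1) x)) (at x)"
      using 1 by (simp add: flat_exp_def has_real_derivative_iff_has_vector_derivative)
    then show ?thesis
      by (rule has_vector_derivative_transform_within_open[of _ _ _ "{0<..}"])
        (use 1 in \<open>auto simp: flat_exp_def\<close>)
  next
    case 2
    have "((\<lambda>x. 0) has_vector_derivative (flat_exp (k + 2) x - k * flat_exp (k + 1) x)) (at x)"
      using 2 by (simp add: flat_exp_def)
    then show ?thesis
      by (rule has_vector_derivative_transform_within_open[of _ _ _ "{..<0}"])
        (use 2 in \<open>auto simp: flat_exp_def\<close>)
  next
    case 3
    have "(flat_exp k has_vector_derivative 0) (at 0)"
      by (rule has_vector_derivative_zero_at_zero[of _ 2 "fact (k + 2)"])
        (use flat_exp_bound[of k] in \<open>auto simp: flat_exp_def\<close>)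
    then show ?thesis using 3 by (simp add: flat_exp_def)
  qed
qed

lemma ck_on_flat_exp: "ck_on n UNIV (\<lambda>x. of_real (flat_exp k x))"
proof (induction n arbitrary: k)
  case 0
  show ?case
    using continuous_on_vector_derivative[OF has_vector_derivative_flat_exp]
    by (simp add: continuous_on_of_real)
next
  case (Suc n)
  have "((\<lambda>x. of_real (flat_exp k x)) has_vector_derivative
      complex_of_real (flat_exp (k + 2) x) - of_nat k * of_real (flat_exp (k + 1) x)) (at x)" for x
    using bounded_linear.has_vector_derivative[OF bounded_linear_of_real has_vector_derivative_flat_exp[of k x]]
    by simp
  then show ?case
    by (intro ck_on_SucI[where f'="\<lambda>x. complex_of_real (flat_exp (k + 2) x) - of_nat k * of_real (flat_exp (k + 1) x)"]
         ck_on_diff ck_on_scale Suc)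
qed

definition cutoff :: "real \<Rightarrow> real" where
  "cutoff x = flat_exp 0 (2 - x\<^sup>2) / (flat_exp 0 (2 - x\<^sup>2) + flat_exp 0 (x\<^sup>2 - 1))"

lemma flat_exp_nonneg: "flat_exp 0 x \<ge> 0" and flat_exp_pos: "x > 0 \<Longrightarrow> flat_exp 0 x > 0"
  by (auto simp: flat_exp_def)

text \<open>The two arguments add up to 1, so at least one of them is positive.\<close>

lemma cutoff_denominator_pos: "flat_exp 0 (2 - x\<^sup>2) + flat_exp 0 (x\<^sup>2 - 1) > 0"
proof (cases "x\<^sup>2 < 2")
  case True
  then show ?thesis using flat_exp_pos[of "2 - x\<^sup>2"] flat_exp_nonneg[of "x\<^sup>2 - 1"] by linarith
next
  case False
  then show ?thesis using flat_exp_pos[of "x\<^sup>2 - 1"] flat_exp_nonneg[of "2 - x\<^sup>2"] by linarith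
qed

lemma smooth_cutoff: "smooth_on UNIV (\<lambda>x. of_real (cutoff x))"
proof (rule smooth_onI)
  fix n
  have sq: "ck_on n UNIV (\<lambda>x. complex_of_real (x\<^sup>2))"
    using ck_on_power[OF ck_on_of_real, of n UNIV 2] by simp
  have 1: "ck_on n UNIV (\<lambda>x. complex_of_real (flat_exp 0 (2 - x\<^sup>2)))"
    by (rule ck_on_compose[where V=UNIV, OF _ ck_on_flat_exp])
      (use ck_on_diff[OF ck_on_const[of _ _ 2] sq] in auto)
  have 2: "ck_on n UNIV (\<lambda>x. complex_of_real (flat_exp 0 (x\<^sup>2 - 1)))"
    by (rule ck_on_compose[where V=UNIV, OF _ ck_on_flat_exp])
      (use ck_on_diff[OF sq ck_on_const[of _ _ 1]] in auto)
  have nz: "complex_of_real (flat_exp 0 (2 - x\<^sup>2)) + of_real (flat_exp 0 (x\<^sup>2 - 1)) \<noteq> 0" for x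
    using cutoff_denominator_pos[of x] by (metis less_irrefl of_real_add of_real_eq_0_iff)
  show "ck_on n UNIV (\<lambda>x. complex_of_real (cutoff x))"
    using ck_on_divide[OF nz 1 ck_on_add[OF 1 2]] unfolding cutoff_def by simp
qed simp

lemma cutoff_nonneg: "cutoff x \<ge> 0"
  unfolding cutoff_def using flat_exp_nonneg by (simp add: add_nonneg_nonneg)

lemma cutoff_eq_1: "\<bar>x\<bar> \<le> 1 \<Longrightarrow> cutoff x = 1"
proof -
  assume "\<bar>x\<bar> \<le> 1"
  then have "x\<^sup>2 \<le> 1" by (simp add: abs_square_le_1)
  then show ?thesis using cutoff_denominator_pos[of x] by (simp add: cutoff_def flat_exp_def)
qed

lemma cutoff_eq_0: "\<bar>x\<bar> \<ge> 2 \<Longrightarrow> cutoff x = 0"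
proof -
  assume "\<bar>x\<bar> \<ge> 2"
  then have "2\<^sup>2 \<le> \<bar>x\<bar>\<^sup>2" by (intro power_mono) auto
  then have "x\<^sup>2 \<ge> 4" by simp
  then show ?thesis by (simp add: cutoff_def flat_exp_def)
qed

section \<open>The Euler operator and conormal functions\<close>

lemma vderiv_pow_cong:
  assumes "open S" "\<And>x. x \<in> S \<Longrightarrow> f x = g x" "x \<in> S"
  shows "(vderiv ^^ n) f x = (vderiv ^^ n) g x"
  using assms(3)
proof (induction n arbitrary: x)
  case (Suc n)
  have "\<forall>\<^sub>F y in nhds x. (vderiv ^^ n) f y = (vderiv ^^ n) g y"
    using Suc assms(1) eventually_nhds by blast
  then have "vderiv ((vderiv ^^ n) f) x = vderiv ((vderiv ^^ n) g) x"
    unfolding vderiv_def[of "(vderiv ^^ n) f"] vderiv_def[of "(vderiv ^^ n) g"]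
    by (intro vector_derivative_cong_eq) auto
  then show ?case by simp
qed (use assms in auto)

text \<open>At the origin the factor \<open>x\<close> gives 0 whatever \<open>vderiv\<close> is
  there, so the dummy value of functions on the punctured line is preserved.\<close>

definition theta :: "(real \<Rightarrow> complex) \<Rightarrow> real \<Rightarrow> complex" where
  "theta f x = of_real x * vderiv f x"

lemma theta_0 [simp]: "theta f 0 = 0"
  by (simp add: theta_def)

lemma thetaI:
  assumes "(f has_vector_derivative D) (at x)"
  shows "theta f x = of_real x * D"
  using assms by (simp add: theta_def vderiv_def vector_derivative_at)

lemma theta_eqI:
  assumes "\<And>x. x \<noteq> 0 \<Longrightarrow> (f has_vector_derivative g x / of_real x) (at x)" "g 0 = 0"
  shows "theta f = g"
proof
  fix x show "theta f x = g x"
    using thetaI[OF assms(1)[of x]] assms(2) by (cases "x = 0") auto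
qed

section \<open>Functions smooth off the origin\<close>

lemma smooth_puncturedI:
  assumes "f 0 = 0" "\<And>n. ck_on n (- {0}) f"
  shows "f \<in> smooth_punctured"
  using assms smooth_onI[of "- {0}"] by (auto simp: smooth_punctured_def)

lemma smooth_punctured_ck_on: "f \<in> smooth_punctured \<Longrightarrow> ck_on n (- {0}) f"
  by (auto simp: smooth_punctured_def intro: smooth_on_imp_ck_on)

lemma smooth_punctured_0: "f \<in> smooth_punctured \<Longrightarrow> f 0 = 0"
  by (auto simp: smooth_punctured_def)

lemma smooth_punctured_has_vector_derivative:
  assumes "f \<in> smooth_punctured" "x \<noteq> 0"
  shows "(f has_vector_derivative theta f x / of_real x) (at x)"
proof -
  have "smooth_on (- {0}) f" using assms(1) by (simp add: smooth_punctured_def)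
  from smooth_on_has_vderiv[OF this, of x] show ?thesis using assms(2) by (simp add: theta_def)
qed

lemma smooth_punctured_add:
  "f \<in> smooth_punctured \<Longrightarrow> g \<in> smooth_punctured \<Longrightarrow> (\<lambda>x. f x + g x) \<in> smooth_punctured"
  by (rule smooth_puncturedI[OF _ ck_on_add[OF smooth_punctured_ck_on smooth_punctured_ck_on]]) (simp_all add: smooth_punctured_0)

lemma smooth_punctured_mult:
  "f \<in> smooth_punctured \<Longrightarrow> (\<And>n. ck_on n (- {0}) g) \<Longrightarrow> (\<lambda>x. g x * f x) \<in> smooth_punctured"
  by (rule smooth_puncturedI[OF _ ck_on_mult[OF _ smooth_punctured_ck_on]]) (simp_all add: smooth_punctured_0)

lemma smooth_punctured_scale: "f \<in> smooth_punctured \<Longrightarrow> (\<lambda>x. c * f x) \<in> smooth_punctured"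
  by (rule smooth_punctured_mult[OF _ ck_on_const])

lemma smooth_punctured_theta:
  assumes "f \<in> smooth_punctured" shows "theta f \<in> smooth_punctured"
proof (rule smooth_puncturedI)
  fix n
  show "ck_on n (- {0}) (theta f)"
    unfolding theta_def[abs_def]
    by (intro ck_on_mult ck_on_of_real ck_on_vderiv smooth_punctured_ck_on assms) auto
qed simp

lemma smooth_punctured_theta_pow: "f \<in> smooth_punctured \<Longrightarrow> (theta ^^ n) f \<in> smooth_punctured"
  by (induction n) (auto intro: smooth_punctured_theta)

lemma theta_add:
  assumes "f \<in> smooth_punctured" "g \<in> smooth_punctured"
  shows "theta (\<lambda>x. f x + g x) = (\<lambda>x. theta f x + theta g x)"
  by (rule theta_eqI)
    (auto simp: add_divide_distrib intro!: has_vector_derivative_add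
      smooth_punctured_has_vector_derivative assms)

lemma theta_scale:
  assumes "f \<in> smooth_punctured"
  shows "theta (\<lambda>x. c * f x) = (\<lambda>x. c * theta f x)"
  by (rule theta_eqI)
    (auto simp: times_divide_eq_right [symmetric] simp del: times_divide_eq_right
      intro!: has_vector_derivative_mult_right smooth_punctured_has_vector_derivative assms)

lemma theta_pow_add:
  assumes "f \<in> smooth_punctured" "g \<in> smooth_punctured"
  shows "(theta ^^ n) (\<lambda>x. f x + g x) = (\<lambda>x. (theta ^^ n) f x + (theta ^^ n) g x)"
  by (induction n) (auto simp: theta_add smooth_punctured_theta_pow assms)

lemma theta_pow_scale:
  assumes "f \<in> smooth_punctured"
  shows "(theta ^^ n) (\<lambda>x. c * f x) = (\<lambda>x. c * (theta ^^ n) f x)"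
  by (induction n) (auto simp: theta_scale smooth_punctured_theta_pow assms)

text \<open>One condition controls both ends: \<open>b = a\<close> measures the vanishing at 0,
  while \<open>b\<close> tending to minus infinity encodes rapid decay at infinity. Powers of
  \<open>theta\<close> instead of derivatives keep the exponent the same for all
  \<open>n\<close>.\<close>

definition conormal :: "real \<Rightarrow> (real \<Rightarrow> complex) \<Rightarrow> bool" where
  "conormal a f \<longleftrightarrow> f \<in> smooth_punctured \<and>
     (\<forall>n. \<forall>b\<le>a. \<exists>C. \<forall>x. x \<noteq> 0 \<longrightarrow> norm ((theta ^^ n) f x) \<le> C * \<bar>x\<bar> powr b)"

lemma conormal_smooth_punctured: "conormal a f \<Longrightarrow> f \<in> smooth_punctured"
  by (simp add: conormal_def)

lemma conormal_bound:
  assumes "conormal a f" "b \<le> a"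
  obtains C where "\<And>x. x \<noteq> 0 \<Longrightarrow> norm (f x) \<le> C * \<bar>x\<bar> powr b"
  using assms unfolding conormal_def by (metis funpow_0)

lemma conormal_theta:
  assumes "conormal a f" shows "conormal a (theta f)"
proof -
  have "\<exists>C. \<forall>x. x \<noteq> 0 \<longrightarrow> norm ((theta ^^ n) (theta f) x) \<le> C * \<bar>x\<bar> powr b" if "b \<le> a" for n b
    using assms that unfolding conormal_def by (metis funpow_Suc_right comp_apply)
  then show ?thesis using assms by (simp add: conormal_def smooth_punctured_theta)
qed

lemma conormal_mono: "b \<le> a \<Longrightarrow> conormal a f \<Longrightarrow> conormal b f"
  unfolding conormal_def by fastforce

lemma conormal_add:
  assumes "conormal a f" "conormal a g" shows "conormal a (\<lambda>x. f x + g x)"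
  unfolding conormal_def
proof (intro conjI allI impI)
  show "(\<lambda>x. f x + g x) \<in> smooth_punctured"
    using assms by (simp add: conormal_def smooth_punctured_add)
  fix n b assume "b \<le> a"
  then obtain C D where "\<And>x. x \<noteq> 0 \<Longrightarrow> norm ((theta ^^ n) f x) \<le> C * \<bar>x\<bar> powr b"
    "\<And>x. x \<noteq> 0 \<Longrightarrow> norm ((theta ^^ n) g x) \<le> D * \<bar>x\<bar> powr b"
    using assms unfolding conormal_def by metis
  then have "norm ((theta ^^ n) f x + (theta ^^ n) g x) \<le> (C + D) * \<bar>x\<bar> powr b" if "x \<noteq> 0" for x
    using that by (simp add: distrib_right norm_triangle_mono)
  then show "\<exists>C. \<forall>x. x \<noteq> 0 \<longrightarrow> norm ((theta ^^ n) (\<lambda>x. f x + g x) x) \<le> C * \<bar>x\<bar> powr b"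
    using assms by (auto simp: theta_pow_add conormal_def)
qed

lemma conormal_scale:
  assumes "conormal a f" shows "conormal a (\<lambda>x. c * f x)"
  unfolding conormal_def
proof (intro conjI allI impI)
  show "(\<lambda>x. c * f x) \<in> smooth_punctured"
    using assms by (simp add: conormal_def smooth_punctured_scale)
  fix n b assume "b \<le> a"
  then obtain C where C: "\<And>x. x \<noteq> 0 \<Longrightarrow> norm ((theta ^^ n) f x) \<le> C * \<bar>x\<bar> powr b"
    using assms unfolding conormal_def by metis
  have "norm (c * (theta ^^ n) f x) \<le> (norm c * C) * \<bar>x\<bar> powr b" if "x \<noteq> 0" for x
    using mult_left_mono[OF C[OF that], of "norm c"] by (simp add: norm_mult mult.assoc)
  then show "\<exists>C. \<forall>x. x \<noteq> 0 \<longrightarrow> norm ((theta ^^ n) (\<lambda>x. c * f x) x) \<le> C * \<bar>x\<bar> powr b"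
    using assms by (auto simp: theta_pow_scale conormal_def)
qed

section \<open>Singular terms: a parity, a power, a logarithm and a coefficient\<close>

definition sing_term :: "bit \<Rightarrow> complex \<Rightarrow> nat \<Rightarrow> (real \<Rightarrow> complex) \<Rightarrow> real \<Rightarrow> complex" where
  "sing_term \<eta> \<beta> k F x = sgn_pow \<eta> x * of_real \<bar>x\<bar> powr \<beta> * of_real (ln \<bar>x\<bar>) ^ k * F x"

text \<open>The convention \<open>0 powr \<beta> = 0\<close> provides the dummy value.\<close>

lemma sing_term_0 [simp]: "sing_term \<eta> \<beta> k F 0 = 0"
  by (simp add: sing_term_def)

lemma bit_add_1: "(\<eta> :: bit) + 1 = (if \<eta> = 0 then 1 else 0)"
  by (cases \<eta> rule: bit.exhaust) auto

lemma bit_add_1_1: "(\<eta> :: bit) + 1 + 1 = \<eta>"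
  by (cases \<eta> rule: bit.exhaust) auto

lemma sgn_pow_Suc: "sgn_pow (\<eta> + 1) x = (if x = 0 then sgn_pow (\<eta> + 1) x else of_real (sgn x) * sgn_pow \<eta> x)"
  by (auto simp: sgn_pow_def bit_add_1 sgn_real_def)

lemma of_real_powr_diff_1:
  "x \<noteq> 0 \<Longrightarrow> complex_of_real \<bar>x\<bar> powr (\<beta> - 1) = complex_of_real \<bar>x\<bar> powr \<beta> / of_real \<bar>x\<bar>"
  by (simp add: powr_diff)

text \<open>Because of \<open>1 / x = sgn x / |x|\<close>, a change of the exponent by one is always
  accompanied by a change of parity.\<close>

lemma sing_term_divide: "sing_term \<eta> \<beta> k F x / of_real x = sing_term (\<eta> + 1) (\<beta> - 1) k F x"
proof (cases "x = 0")
  case False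
  have "sgn x / \<bar>x\<bar> = 1 / x" using False by (auto simp: sgn_real_def)
  then have "complex_of_real (sgn x / \<bar>x\<bar>) = of_real (1 / x)" by (rule arg_cong)
  then have q: "inverse (complex_of_real x) = of_real (sgn x) * inverse (of_real \<bar>x\<bar>)"
    by (simp add: divide_inverse)
  moreover have "sgn_pow (\<eta> + 1) x = of_real (sgn x) * sgn_pow \<eta> x"
    using False sgn_pow_Suc[of \<eta> x] by (simp only: if_False)
  ultimately show ?thesis
    unfolding sing_term_def q of_real_powr_diff_1[OF False] by (simp only: divide_inverse q mult_ac)
qed simp

lemma sing_term_mult_ident: "sing_term \<eta> \<beta> k (\<lambda>x. of_real x * F x) x = sing_term (\<eta> + 1) (\<beta> + 1) k F x"
proof (cases "x = 0")
  case False
  have "sing_term (\<eta> + 1) (\<beta> + 1) k F x / of_real x = sing_term \<eta> \<beta> k F x"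
    using sing_term_divide[of "\<eta> + 1" "\<beta> + 1" k F x] by (simp only: bit_add_1_1 add_diff_cancel_right')
  then have "sing_term (\<eta> + 1) (\<beta> + 1) k F x = of_real x * sing_term \<eta> \<beta> k F x"
    using False by (metis mult.commute nonzero_divide_eq_eq of_real_eq_0_iff)
  also have "\<dots> = sing_term \<eta> \<beta> k (\<lambda>x. of_real x * F x) x" by (simp add: sing_term_def)
  finally show ?thesis by (rule sym)
qed simp

lemma sing_term_mult_power:
  "sing_term \<eta> \<beta> k (\<lambda>x. of_real x ^ n * F x) x = sing_term (\<eta> + of_nat n) (\<beta> + of_nat n) k F x"
proof (induction n arbitrary: \<eta> \<beta>)
  case (Suc n)
  have "sing_term \<eta> \<beta> k (\<lambda>x. of_real x ^ Suc n * F x) x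
      = sing_term \<eta> \<beta> k (\<lambda>x. of_real x * (of_real x ^ n * F x)) x"
    by (simp add: mult.assoc)
  also have "\<dots> = sing_term (\<eta> + 1 + of_nat n) (\<beta> + 1 + of_nat n) k F x"
    by (simp only: sing_term_mult_ident Suc)
  finally show ?case by (simp only: of_nat_Suc add_ac)
qed simp

lemma has_vector_derivative_sgn_pow:
  assumes "x \<noteq> 0" shows "(sgn_pow \<eta> has_vector_derivative 0) (at x)"
proof (rule has_vector_derivative_transform_within_open[OF has_vector_derivative_const[of "sgn_pow \<eta> x"]])
  \<comment> \<open>This is the open half line that contains \<open>x\<close>; the sign is constant
    on it.\<close>
  show "open {y. sgn x * y > 0}" by (intro open_Collect_less continuous_intros)
qed (use assms in \<open>auto simp: sgn_pow_def sgn_if zero_less_mult_iff split: if_splits\<close>)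

lemma has_real_derivative_abs:
  assumes "x \<noteq> 0" shows "(abs has_real_derivative (sgn x)) (at (x::real))"
proof (rule has_field_derivative_transform_within_open[where f="\<lambda>y. sgn x * y"])
  show "open {y. sgn x * y > 0}" by (intro open_Collect_less continuous_intros)
  show "((*) (sgn x) has_real_derivative sgn x) (at x)" by (auto intro!: derivative_eq_intros)
qed (use assms in \<open>auto simp: sgn_if zero_less_mult_iff split: if_splits\<close>)

lemma has_vector_derivative_abs_powr:
  assumes "x \<noteq> 0"
  shows "((\<lambda>x. complex_of_real \<bar>x\<bar> powr \<beta>) has_vector_derivative
    \<beta> * of_real \<bar>x\<bar> powr \<beta> / of_real x) (at x)"
proof -
  have 1: "((\<lambda>x. complex_of_real \<bar>x\<bar>) has_vector_derivative of_real (sgn x)) (at x)"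
    by (rule has_vector_derivative_of_real[OF has_real_derivative_abs[OF assms]])
  have "complex_of_real \<bar>x\<bar> \<notin> \<real>\<^sub>\<le>\<^sub>0" using assms by simp
  from has_field_derivative_powr[OF this, of \<beta>]
  have 2: "((\<lambda>z. z powr \<beta>) has_field_derivative \<beta> * of_real \<bar>x\<bar> powr (\<beta> - 1)) (at (of_real \<bar>x\<bar>))" .
  have "sgn x / \<bar>x\<bar> = 1 / x" using assms by (auto simp: sgn_real_def)
  then have "complex_of_real (sgn x) / of_real \<bar>x\<bar> = 1 / of_real x"
    by (metis of_real_1 of_real_divide)
  then have "of_real (sgn x) * (\<beta> * of_real \<bar>x\<bar> powr (\<beta> - 1)) = \<beta> * of_real \<bar>x\<bar> powr \<beta> / of_real x"
    using assms by (simp add: of_real_powr_diff_1 field_simps)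
  then show ?thesis using field_vector_diff_chain_at[OF 1 2] by (simp add: o_def)
qed

lemma has_vector_derivative_ln_abs:
  assumes "x \<noteq> 0"
  shows "((\<lambda>x. complex_of_real (ln \<bar>x\<bar>)) has_vector_derivative 1 / of_real x) (at x)"
proof -
  have "((\<lambda>x. ln \<bar>x\<bar>) has_real_derivative inverse \<bar>x\<bar> * sgn x) (at x)"
    using DERIV_chain2[OF DERIV_ln has_real_derivative_abs[OF assms]] assms by simp
  moreover have "inverse \<bar>x\<bar> * sgn x = 1 / x" using assms by (auto simp: sgn_real_def divide_simps)
  ultimately have "((\<lambda>x. ln \<bar>x\<bar>) has_real_derivative 1 / x) (at x)" by simp
  then have "((\<lambda>x. complex_of_real (ln \<bar>x\<bar>)) has_vector_derivative of_real (1 / x)) (at x)"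
    by (rule has_vector_derivative_of_real)
  then show ?thesis by (simp only: of_real_divide of_real_1)
qed

text \<open>The product rule. For \<open>k = 0\<close> the truncated \<open>k - 1\<close> does no
  harm, because its coefficient \<open>of_nat k\<close> vanishes.\<close>

lemma has_vector_derivative_sing_term:
  assumes "x \<noteq> 0" "(F has_vector_derivative F') (at x)"
  shows "(sing_term \<eta> \<beta> k F has_vector_derivative
    (\<beta> * sing_term \<eta> \<beta> k F x + of_nat k * sing_term \<eta> \<beta> (k - 1) F x
      + sing_term \<eta> \<beta> k (\<lambda>_. of_real x * F') x) / of_real x) (at x)"
proof -
  have pow: "((\<lambda>x. complex_of_real (ln \<bar>x\<bar>) ^ k) has_vector_derivative
      1 / of_real x * (of_nat k * of_real (ln \<bar>x\<bar>) ^ (k - 1))) (at x)"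
  proof -
    have "((\<lambda>z. z ^ k) has_field_derivative of_nat k * w ^ (k - 1)) (at w)" for w :: complex
      by (auto intro!: derivative_eq_intros)
    from field_vector_diff_chain_at[OF has_vector_derivative_ln_abs[OF assms(1)] this]
    show ?thesis by (simp only: o_def)
  qed
  show ?thesis
    unfolding sing_term_def[abs_def]
    by (rule has_vector_derivative_eq_rhs,
        (rule has_vector_derivative_mult has_vector_derivative_sgn_pow pow assms
          has_vector_derivative_abs_powr)+)
      (use assms(1) in \<open>simp add: field_simps\<close>)
qed

text \<open>The division by \<open>x\<close> is absorbed into the exponents of the first two terms
  and cancels in the third, so \<open>F'\<close> keeps the exponent \<beta>. Singular terms are
  thereby closed under differentiation, which drives the inductions on their regularity.\<close>

lemma has_vector_derivative_sing_term':
  assumes "x \<noteq> 0" "(F has_vector_derivative F' x) (at x)"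
  shows "(sing_term \<eta> \<beta> k F has_vector_derivative
    (\<beta> * sing_term (\<eta> + 1) (\<beta> - 1) k F x + of_nat k * sing_term (\<eta> + 1) (\<beta> - 1) (k - 1) F x
      + sing_term \<eta> \<beta> k F' x)) (at x)"
proof -
  have "sing_term (\<eta> + 1) (\<beta> - 1) k (\<lambda>_. of_real x * F' x) x = sing_term \<eta> \<beta> k F' x"
    unfolding sing_term_divide [symmetric] using assms by (simp add: sing_term_def)
  then show ?thesis
    using has_vector_derivative_sing_term[OF assms, of \<eta> \<beta> k]
    by (simp only: add_divide_distrib times_divide_eq_right [symmetric] sing_term_divide)
qed

lemma ck_on_sing_term: "smooth_on UNIV F \<Longrightarrow> ck_on n (- {0}) (sing_term \<eta> \<beta> k F)"
proof (induction n arbitrary: \<eta> \<beta> k F)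
  case 0
  have "continuous_on (- {0}) (sing_term \<eta> \<beta> k F)"
    by (rule continuous_on_vector_derivative[OF has_vector_derivative_sing_term'[where F'="vderiv F"]])
      (use 0 smooth_on_has_vderiv in auto)
  then show ?case by simp
next
  case (Suc n)
  have "ck_on n (- {0}) (\<lambda>x. \<beta> * sing_term (\<eta> + 1) (\<beta> - 1) k F x
    + of_nat k * sing_term (\<eta> + 1) (\<beta> - 1) (k - 1) F x + sing_term \<eta> \<beta> k (vderiv F) x)"
    by (intro ck_on_add ck_on_scale Suc.IH smooth_on_vderiv Suc.prems)
  then show ?case
    using has_vector_derivative_sing_term'[where F'="vderiv F", OF _ smooth_on_has_vderiv[OF Suc.prems UNIV_I]]
    by (intro ck_on_SucI) auto
qed

lemma smooth_punctured_sing_term: "smooth_on UNIV F \<Longrightarrow> sing_term \<eta> \<beta> k F \<in> smooth_punctured"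
  by (rule smooth_puncturedI) (auto intro: ck_on_sing_term)

lemma theta_sing_term:
  assumes "smooth_on UNIV F"
  shows "theta (sing_term \<eta> \<beta> k F) = (\<lambda>x. \<beta> * sing_term \<eta> \<beta> k F x
    + of_nat k * sing_term \<eta> \<beta> (k - 1) F x + sing_term \<eta> \<beta> k (theta F) x)"
proof (rule theta_eqI)
  fix x :: real assume "x \<noteq> 0"
  from has_vector_derivative_sing_term[OF this smooth_on_has_vderiv[OF assms UNIV_I], of \<eta> \<beta> k]
  show "(sing_term \<eta> \<beta> k F has_vector_derivative (\<beta> * sing_term \<eta> \<beta> k F x
    + of_nat k * sing_term \<eta> \<beta> (k - 1) F x + sing_term \<eta> \<beta> k (theta F) x) / of_real x) (at x)"
    by (simp add: theta_def sing_term_def)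
qed simp

section \<open>Size and regularity of singular terms\<close>

lemma norm_sgn_pow_le: "norm (sgn_pow \<eta> x) \<le> 1"
  by (auto simp: sgn_pow_def sgn_real_def)

lemma norm_of_real_abs_powr: "x \<noteq> 0 \<Longrightarrow> norm (complex_of_real \<bar>x\<bar> powr \<beta>) = \<bar>x\<bar> powr Re \<beta>"
  by (subst norm_powr_real_powr) auto

lemma norm_sing_term_le:
  assumes "x \<noteq> 0"
  shows "norm (sing_term \<eta> \<beta> k F x) \<le> \<bar>x\<bar> powr Re \<beta> * \<bar>ln \<bar>x\<bar>\<bar> ^ k * norm (F x)"
proof -
  have "norm (sing_term \<eta> \<beta> k F x) = norm (sgn_pow \<eta> x) * (\<bar>x\<bar> powr Re \<beta> * \<bar>ln \<bar>x\<bar>\<bar> ^ k * norm (F x))"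
    using assms by (simp add: sing_term_def norm_mult norm_power norm_of_real_abs_powr)
  also have "\<dots> \<le> 1 * (\<bar>x\<bar> powr Re \<beta> * \<bar>ln \<bar>x\<bar>\<bar> ^ k * norm (F x))"
    by (intro mult_right_mono norm_sgn_pow_le) auto
  finally show ?thesis by simp
qed

lemma abs_ln_power_bound:
  fixes \<rho> \<epsilon> :: real
  assumes "\<rho> > 0" "\<epsilon> > 0"
  obtains C where "C \<ge> 0" "\<And>t. 0 < t \<Longrightarrow> t \<le> \<rho> \<Longrightarrow> \<bar>ln t\<bar> ^ k \<le> C * t powr (- \<epsilon>)"
proof -
  \<comment> \<open>The exponent \<epsilon> is split into \<open>k + 1\<close> equal parts: one for
    each logarithm and a spare one, which also avoids a division by zero for
    \<open>k = 0\<close>.\<close>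
  define \<delta> where "\<delta> = \<epsilon> / (real k + 1)"
  have "\<delta> * (real k + 1) = \<epsilon>" by (simp add: \<delta>_def add_eq_0_iff_both_eq_0)
  then have \<delta>: "\<delta> > 0" "\<delta> * real k + \<delta> = \<epsilon>" using assms by (auto simp: \<delta>_def distrib_left)
  \<comment> \<open>The summand \<open>1 / \<delta>\<close> handles \<open>- ln t\<close>, which is
    large for small \<open>t\<close>. The other one handles \<open>ln t\<close>, which is at most
    \<rho>, using that \<open>\<rho> powr \<delta> * t powr (- \<delta>)\<close> is at least
    1.\<close>
  define B where "B = 1 / \<delta> + \<rho> * \<rho> powr \<delta>"
  have B: "B \<ge> 0" using assms \<delta> by (simp add: B_def)
  have ln: "\<bar>ln t\<bar> \<le> B * t powr (- \<delta>)" if t: "0 < t" "t \<le> \<rho>" for t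
  proof -
    have "ln (t powr (- \<delta>)) \<le> t powr (- \<delta>)" using t ln_bound[of "t powr (- \<delta>)"] by simp
    then have "- ln t \<le> 1 / \<delta> * t powr (- \<delta>)" using t \<delta> by (simp add: ln_powr field_simps)
    moreover have "0 \<le> \<rho> * \<rho> powr \<delta> * t powr (- \<delta>)" using assms by simp
    moreover have "ln t \<le> \<rho> * \<rho> powr \<delta> * t powr (- \<delta>)"
    proof -
      have "ln t \<le> \<rho> * 1" using ln_bound[of t] t by simp
      also have "\<dots> \<le> \<rho> * (\<rho> powr \<delta> * t powr (- \<delta>))"
        using powr_mono2[of \<delta> t \<rho>] t \<delta> by (intro mult_left_mono) (auto simp: powr_minus field_simps)
      finally show ?thesis by (simp add: mult.assoc)
    qed
    moreover have "0 \<le> 1 / \<delta> * t powr (- \<delta>)" using \<delta> by simp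
    ultimately show ?thesis unfolding B_def distrib_right abs_le_iff by linarith
  qed
  have "\<bar>ln t\<bar> ^ k \<le> B ^ k * \<rho> powr \<delta> * t powr (- \<epsilon>)" if t: "0 < t" "t \<le> \<rho>" for t
  proof -
    have "\<bar>ln t\<bar> ^ k \<le> (B * t powr (- \<delta>)) ^ k" using ln[OF t] by (rule power_mono) auto
    also have "\<dots> = B ^ k * t powr (- (\<delta> * k))"
    proof -
      have "(t powr (- \<delta>)) ^ k = (t powr (- \<delta>)) powr real k" using t by (simp add: powr_realpow)
      also have "\<dots> = t powr (- (\<delta> * k))" by (simp add: powr_powr)
      finally show ?thesis by (simp only: power_mult_distrib)
    qed
    also have "t powr (- (\<delta> * k)) = t powr \<delta> * t powr (- \<epsilon>)"
    proof -
      have "- (\<delta> * real k) = \<delta> + - \<epsilon>" using \<delta>(2) by simp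
      then show ?thesis by (simp only: powr_add)
    qed
    also have "B ^ k * (t powr \<delta> * t powr (- \<epsilon>)) \<le> B ^ k * (\<rho> powr \<delta> * t powr (- \<epsilon>))"
      using t \<delta> B by (intro mult_left_mono mult_right_mono powr_mono2) auto
    finally show ?thesis by (simp add: mult.assoc)
  qed
  then show ?thesis using that[of "B ^ k * \<rho> powr \<delta>"] B by simp
qed

text \<open>The gap between \<open>b\<close> and \<open>Re \<beta>\<close> absorbs the logarithms,
  and the coefficient is bounded on a compact interval.\<close>

lemma sing_term_bound:
  assumes "continuous_on UNIV F" "b < Re \<beta>" "\<rho> > 0"
  obtains C where "\<And>x. x \<noteq> 0 \<Longrightarrow> \<bar>x\<bar> \<le> \<rho> \<Longrightarrow> norm (sing_term \<eta> \<beta> k F x) \<le> C * \<bar>x\<bar> powr b"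
proof -
  have "compact (F ` {-\<rho>..\<rho>})"
    using assms(1) by (intro compact_continuous_image) (auto intro: continuous_on_subset)
  from compact_imp_bounded[OF this] obtain D where "\<And>y. y \<in> F ` {-\<rho>..\<rho>} \<Longrightarrow> norm y \<le> D"
    unfolding bounded_iff by auto
  then have D: "norm (F x) \<le> D" if "\<bar>x\<bar> \<le> \<rho>" for x
  proof -
    have "x \<in> {-\<rho>..\<rho>}" using that by auto
    then show ?thesis using \<open>\<And>y. y \<in> F ` {-\<rho>..\<rho>} \<Longrightarrow> norm y \<le> D\<close> by blast
  qed
  obtain C where C: "C \<ge> 0" "\<And>t. 0 < t \<Longrightarrow> t \<le> \<rho> \<Longrightarrow> \<bar>ln t\<bar> ^ k \<le> C * t powr (- (Re \<beta> - b))"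
    using abs_ln_power_bound[OF assms(3), of "Re \<beta> - b"] assms(2) by auto
  have "norm (sing_term \<eta> \<beta> k F x) \<le> (C * D) * \<bar>x\<bar> powr b" if x: "x \<noteq> 0" "\<bar>x\<bar> \<le> \<rho>" for x
  proof -
    have "norm (sing_term \<eta> \<beta> k F x) \<le> \<bar>x\<bar> powr Re \<beta> * \<bar>ln \<bar>x\<bar>\<bar> ^ k * norm (F x)"
      by (rule norm_sing_term_le[OF x(1)])
    also have "\<dots> \<le> \<bar>x\<bar> powr Re \<beta> * (C * \<bar>x\<bar> powr (- (Re \<beta> - b))) * D"
      using C(1) C(2)[of "\<bar>x\<bar>"] D[of x] x by (intro mult_mono mult_left_mono) auto
    also have "\<dots> = C * D * (\<bar>x\<bar> powr Re \<beta> * \<bar>x\<bar> powr (- (Re \<beta> - b)))" by simp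
    also have "\<bar>x\<bar> powr Re \<beta> * \<bar>x\<bar> powr (- (Re \<beta> - b)) = \<bar>x\<bar> powr b"
      using x by (simp add: powr_add [symmetric])
    finally show ?thesis .
  qed
  then show ?thesis using that by blast
qed

definition compactly_supported_smooth :: "(real \<Rightarrow> complex) \<Rightarrow> bool" where
  "compactly_supported_smooth F \<longleftrightarrow> smooth_on UNIV F \<and> (\<exists>\<rho>>0. \<forall>x. \<bar>x\<bar> > \<rho> \<longrightarrow> F x = 0)"

lemma smooth_on_theta: "smooth_on UNIV F \<Longrightarrow> smooth_on UNIV (theta F)"
  unfolding theta_def[abs_def]
  by (rule smooth_onI, simp)
    (intro ck_on_mult ck_on_of_real smooth_on_imp_ck_on smooth_on_vderiv; assumption)

lemma theta_eq_0:
  assumes "\<And>x. \<bar>x\<bar> > \<rho> \<Longrightarrow> F x = 0" "\<bar>x\<bar> > \<rho>"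
  shows "theta F x = 0"
proof -
  have "((\<lambda>x. 0) has_vector_derivative 0) (at x)" by simp
  then have "(F has_vector_derivative 0) (at x)"
    by (rule has_vector_derivative_transform_within_open[where S="{x. \<bar>x\<bar> > \<rho>}"])
      (use assms in \<open>auto intro!: open_Collect_less continuous_intros\<close>)
  from thetaI[OF this] show ?thesis by simp
qed

lemma compactly_supported_smooth_theta:
  "compactly_supported_smooth F \<Longrightarrow> compactly_supported_smooth (theta F)"
  unfolding compactly_supported_smooth_def using smooth_on_theta theta_eq_0 by meson

text \<open>By \<open>theta_sing_term\<close>, an application of \<open>theta\<close> leaves the
  exponent \<beta> unchanged and the coefficients compactly supported. Hence the bound for the term
  itself reproduces under all powers of \<open>theta\<close>, provided that the induction ranges
  over all \<open>k\<close> and \<open>F\<close>.\<close>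

lemma conormal_sing_term:
  assumes F: "compactly_supported_smooth F" and a: "a < Re \<beta>"
  shows "conormal a (sing_term \<eta> \<beta> k F)"
proof -
  have "\<exists>C. \<forall>x. x \<noteq> 0 \<longrightarrow> norm ((theta ^^ n) (sing_term \<eta> \<beta> k F) x) \<le> C * \<bar>x\<bar> powr b"
    if b: "b \<le> a" and F: "compactly_supported_smooth F" for n k b F
    using F
  proof (induction n arbitrary: k F)
    case 0
    then obtain \<rho> where \<rho>: "\<rho> > 0" "\<And>x. \<bar>x\<bar> > \<rho> \<Longrightarrow> F x = 0" and F: "smooth_on UNIV F"
      unfolding compactly_supported_smooth_def by blast
    obtain C where C: "\<And>x. x \<noteq> 0 \<Longrightarrow> \<bar>x\<bar> \<le> \<rho> \<Longrightarrow> norm (sing_term \<eta> \<beta> k F x) \<le> C * \<bar>x\<bar> powr b"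
      using sing_term_bound[of F b \<beta> \<rho> \<eta> k] \<rho>(1) b a ck_on_continuous[OF smooth_on_imp_ck_on[OF F]] by auto
    have "norm (sing_term \<eta> \<beta> k F x) \<le> \<bar>C\<bar> * \<bar>x\<bar> powr b" if "x \<noteq> 0" for x
    proof (cases "\<bar>x\<bar> \<le> \<rho>")
      case True
      show ?thesis by (rule order.trans[OF C[OF that True] mult_right_mono[OF abs_ge_self]]) simp
    qed (use \<rho> in \<open>simp add: sing_term_def\<close>)
    then show ?case by auto
  next
    case (Suc n)
    have s: "smooth_on UNIV F" "smooth_on UNIV (theta F)"
      using Suc.prems compactly_supported_smooth_theta[OF Suc.prems]
      by (auto simp: compactly_supported_smooth_def)
    note sp = smooth_punctured_sing_term[OF s(1)] smooth_punctured_sing_term[OF s(2)]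
    obtain C where C: "\<And>x. x \<noteq> 0 \<Longrightarrow> norm ((theta ^^ n) (sing_term \<eta> \<beta> k F) x) \<le> C * \<bar>x\<bar> powr b"
      using Suc.IH[OF Suc.prems] by blast
    obtain D where D: "\<And>x. x \<noteq> 0 \<Longrightarrow> norm ((theta ^^ n) (sing_term \<eta> \<beta> (k - 1) F) x) \<le> D * \<bar>x\<bar> powr b"
      using Suc.IH[OF Suc.prems] by blast
    obtain E where E: "\<And>x. x \<noteq> 0 \<Longrightarrow> norm ((theta ^^ n) (sing_term \<eta> \<beta> k (theta F)) x) \<le> E * \<bar>x\<bar> powr b"
      using Suc.IH[OF compactly_supported_smooth_theta[OF Suc.prems]] by blast
    have eq: "(theta ^^ Suc n) (sing_term \<eta> \<beta> k F) x = \<beta> * (theta ^^ n) (sing_term \<eta> \<beta> k F) x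
      + of_nat k * (theta ^^ n) (sing_term \<eta> \<beta> (k - 1) F) x + (theta ^^ n) (sing_term \<eta> \<beta> k (theta F)) x" for x
      unfolding funpow_Suc_right comp_apply theta_sing_term[OF s(1)]
      by (simp add: theta_pow_add theta_pow_scale smooth_punctured_add smooth_punctured_scale sp)
    have "norm ((theta ^^ Suc n) (sing_term \<eta> \<beta> k F) x) \<le> (norm \<beta> * C + k * D + E) * \<bar>x\<bar> powr b"
      if "x \<noteq> 0" for x
      unfolding eq distrib_right mult.assoc
      using C[OF that] D[OF that] E[OF that]
      by (intro norm_triangle_mono) (auto simp: norm_mult intro!: mult_left_mono)
    then show ?case by blast
  qed
  then show ?thesis
    using F smooth_punctured_sing_term unfolding conormal_def compactly_supported_smooth_def by blast
qed

text \<open>Each derivative lowers the exponent by at most one. As long as the exponent exceeds 1,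
  the derivative at the origin exists and is 0, which is also the value there of the terms that make
  up the derivative elsewhere.\<close>

lemma ck_on_sing_term_UNIV:
  "smooth_on UNIV F \<Longrightarrow> real n < Re \<beta> \<Longrightarrow> ck_on n UNIV (sing_term \<eta> \<beta> k F)"
proof (induction n arbitrary: \<eta> \<beta> k F)
  case 0
  have c: "continuous_on UNIV F" by (rule ck_on_continuous[OF smooth_on_imp_ck_on[OF 0(1)]])
  define b where "b = Re \<beta> / 2"
  obtain C where C: "\<And>x. x \<noteq> 0 \<Longrightarrow> \<bar>x\<bar> \<le> 1 \<Longrightarrow> norm (sing_term \<eta> \<beta> k F x) \<le> C * \<bar>x\<bar> powr b"
    using sing_term_bound[OF c, of b \<beta> 1] 0 by (auto simp: b_def)
  have "((\<lambda>x::real. \<bar>x\<bar> powr b) \<longlongrightarrow> 0) (at 0)"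
    using 0 by (intro tendsto_zero_powrI[where b=b]) (auto intro!: tendsto_rabs_zero simp: b_def)
  then have lim: "((\<lambda>x::real. C * \<bar>x\<bar> powr b) \<longlongrightarrow> 0) (at 0)"
    by (rule tendsto_mult_right_zero)
  have "(sing_term \<eta> \<beta> k F \<longlongrightarrow> 0) (at 0)"
    by (rule Lim_null_comparison[OF _ lim]) (use C in \<open>auto simp: eventually_at intro!: exI[of _ 1]\<close>)
  then have "isCont (sing_term \<eta> \<beta> k F) 0" by (simp add: isCont_def)
  moreover have "isCont (sing_term \<eta> \<beta> k F) x" if "x \<noteq> 0" for x
    using has_vector_derivative_continuous[OF has_vector_derivative_sing_term'[where F'="vderiv F", OF that smooth_on_has_vderiv[OF 0(1) UNIV_I]]]
    by simp
  ultimately have "isCont (sing_term \<eta> \<beta> k F) x" for x by (cases "x = 0") simp_all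
  then show ?case by (simp add: continuous_on_eq_continuous_at)
next
  case (Suc n)
  have c: "continuous_on UNIV F" by (rule ck_on_continuous[OF smooth_on_imp_ck_on[OF Suc.prems(1)]])
  \<comment> \<open>The midpoint is above 1, for differentiability at 0, and below
    \<open>Re \<beta>\<close>, for absorbing the logarithms.\<close>
  define b where "b = (1 + Re \<beta>) / 2"
  have b: "b > 1" "b < Re \<beta>" using Suc.prems by (auto simp: b_def)
  obtain C where C: "\<And>x. x \<noteq> 0 \<Longrightarrow> \<bar>x\<bar> \<le> 1 \<Longrightarrow> norm (sing_term \<eta> \<beta> k F x) \<le> C * \<bar>x\<bar> powr b"
    using sing_term_bound[OF c, of b \<beta> 1] b by auto
  define D where "D = (\<lambda>x. \<beta> * sing_term (\<eta> + 1) (\<beta> - 1) k F x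
    + of_nat k * sing_term (\<eta> + 1) (\<beta> - 1) (k - 1) F x + sing_term \<eta> \<beta> k (vderiv F) x)"
  have d: "(sing_term \<eta> \<beta> k F has_vector_derivative D x) (at x)" for x
  proof (cases "x = 0")
    case True
    have "(sing_term \<eta> \<beta> k F has_vector_derivative 0) (at 0)"
      by (rule has_vector_derivative_zero_at_zero[OF _ b(1) C]) auto
    then show ?thesis using True by (simp add: D_def)
  next
    case False
    then show ?thesis unfolding D_def
      by (rule has_vector_derivative_sing_term') (use Suc.prems smooth_on_has_vderiv in auto)
  qed
  have "ck_on n UNIV D"
    unfolding D_def using Suc.prems
    by (intro ck_on_add ck_on_scale Suc.IH smooth_on_vderiv) auto
  then show ?case using d by (intro ck_on_SucI) auto
qed

section \<open>The Fourier integral\<close>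

text \<open>The coefficient \<open>f (1 / x)\<close> need not be smooth at 0, but the pointwise
  rules for singular terms still apply off the origin.\<close>

lemma T_arg_eq_sing_term: "T_arg \<alpha> \<eta> f = sing_term \<eta> (- \<alpha> - 1) 0 (\<lambda>x. f (1 / x))"
  by (auto simp: T_arg_def sing_term_def fun_eq_iff)

lemma T_arg_0 [simp]: "T_arg \<alpha> \<eta> f 0 = 0"
  by (simp add: T_arg_def)

lemma T_arg_mult_ident: "of_real x * T_arg \<alpha> \<eta> f x = T_arg (\<alpha> - 1) (\<eta> + 1) f x"
proof -
  have "of_real x * T_arg \<alpha> \<eta> f x = sing_term \<eta> (- \<alpha> - 1) 0 (\<lambda>x. of_real x * f (1 / x)) x"
    by (simp add: T_arg_eq_sing_term sing_term_def)
  also have "\<dots> = sing_term (\<eta> + 1) (- (\<alpha> - 1) - 1) 0 (\<lambda>x. f (1 / x)) x"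
    unfolding sing_term_mult_ident by (simp only: minus_diff_eq diff_add_cancel) simp
  finally show ?thesis by (simp only: T_arg_eq_sing_term)
qed

lemma T_arg_add: "T_arg \<alpha> \<eta> (\<lambda>x. f x + g x) x = T_arg \<alpha> \<eta> f x + T_arg \<alpha> \<eta> g x"
  by (simp add: T_arg_def algebra_simps)

lemma T_arg_scale: "T_arg \<alpha> \<eta> (\<lambda>x. c * f x) = (\<lambda>x. c * T_arg \<alpha> \<eta> f x)"
  by (auto simp: T_arg_def fun_eq_iff)

lemma T_arg_bound:
  assumes "conormal a f" "- a - Re \<alpha> - 1 \<le> s"
  obtains C where "C \<ge> 0" "\<And>x. x \<noteq> 0 \<Longrightarrow> norm (T_arg \<alpha> \<eta> f x) \<le> C * \<bar>x\<bar> powr s"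
proof -
  define b where "b = - s - Re \<alpha> - 1"
  have "b \<le> a" using assms(2) by (simp add: b_def)
  then obtain C where C: "\<And>x. x \<noteq> 0 \<Longrightarrow> norm (f x) \<le> C * \<bar>x\<bar> powr b"
    using conormal_bound[OF assms(1)] by metis
  have "C \<ge> 0" using order.trans[OF norm_ge_zero C[of 1]] by simp
  moreover have "norm (T_arg \<alpha> \<eta> f x) \<le> C * \<bar>x\<bar> powr s" if x: "x \<noteq> 0" for x
  proof -
    have "norm (T_arg \<alpha> \<eta> f x) \<le> \<bar>x\<bar> powr Re (- \<alpha> - 1) * norm (f (1 / x))"
      using norm_sing_term_le[OF x, of \<eta> "- \<alpha> - 1" 0] by (simp add: T_arg_eq_sing_term)
    also have "\<dots> \<le> \<bar>x\<bar> powr Re (- \<alpha> - 1) * (C * \<bar>1 / x\<bar> powr b)"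
      using C[of "1 / x"] x by (intro mult_left_mono) auto
    also have "\<dots> = C * (\<bar>x\<bar> powr Re (- \<alpha> - 1) * \<bar>x\<bar> powr (- b))"
      using x by (simp add: powr_divide powr_minus_divide)
    also have "\<bar>x\<bar> powr Re (- \<alpha> - 1) * \<bar>x\<bar> powr (- b) = \<bar>x\<bar> powr s"
      by (simp add: powr_add [symmetric] b_def)
    finally show ?thesis .
  qed
  ultimately show ?thesis using that by blast
qed

text \<open>The operator on \<open>f\<close> induced by \<open>d/dx\<close> on the integrand:
  \<open>- theta\<close> stems from \<open>f (1 / x)\<close> and \<open>- (\<alpha> + 1)\<close>
  from the power. The factor \<open>1 / x\<close> that remains raises \<alpha> by one and flips the
  parity.\<close>

definition T_shift :: "complex \<Rightarrow> (real \<Rightarrow> complex) \<Rightarrow> real \<Rightarrow> complex" where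
  "T_shift \<alpha> f x = - theta f x - (\<alpha> + 1) * f x"

lemma T_shift_eq: "T_shift \<alpha> f = (\<lambda>x. (-1) * theta f x + (- (\<alpha> + 1)) * f x)"
  by (simp add: T_shift_def fun_eq_iff algebra_simps)

lemma conormal_T_shift:
  assumes "conormal a f" shows "conormal a (T_shift \<alpha> f)"
  unfolding T_shift_eq using assms by (intro conormal_add conormal_scale conormal_theta)

lemma has_vector_derivative_T_arg:
  assumes "conormal a f"
  shows "(T_arg \<alpha> \<eta> f has_vector_derivative T_arg (\<alpha> + 1) (\<eta> + 1) (T_shift \<alpha> f) x) (at x)"
proof (cases "x = 0")
  case True
  \<comment> \<open>The exponent must exceed 1 for a derivative at 0 and must be admissible in
    \<open>T_arg_bound\<close>.\<close>
  define s where "s = max 2 (- a - Re \<alpha> - 1)"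
  obtain C where "\<And>x. x \<noteq> 0 \<Longrightarrow> norm (T_arg \<alpha> \<eta> f x) \<le> C * \<bar>x\<bar> powr s"
    using T_arg_bound[OF assms, of \<alpha> s \<eta>] by (auto simp: s_def)
  then have "(T_arg \<alpha> \<eta> f has_vector_derivative 0) (at 0)"
    by (intro has_vector_derivative_zero_at_zero[of _ s C]) (auto simp: s_def)
  then show ?thesis using True by simp
next
  case False
  have 1: "((\<lambda>x. 1 / x) has_vector_derivative - (1 / x\<^sup>2)) (at x)"
    using False unfolding has_real_derivative_iff_has_vector_derivative [symmetric]
    by (auto intro!: derivative_eq_intros simp: power2_eq_square divide_simps)
  have 2: "(f has_vector_derivative theta f (1 / x) / of_real (1 / x)) (at (1 / x))"
    using False by (intro smooth_punctured_has_vector_derivative conormal_smooth_punctured[OF assms]) auto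
  have "((\<lambda>x. f (1 / x)) has_vector_derivative - theta f (1 / x) / of_real x) (at x)"
    using vector_diff_chain_at[OF 1 2] False
    by (simp add: o_def scaleR_conv_of_real power2_eq_square divide_simps)
  from has_vector_derivative_sing_term[OF False this, of \<eta> "- \<alpha> - 1" 0]
  have "(T_arg \<alpha> \<eta> f has_vector_derivative
    ((- \<alpha> - 1) * sing_term \<eta> (- \<alpha> - 1) 0 (\<lambda>x. f (1 / x)) x
      + sing_term \<eta> (- \<alpha> - 1) 0 (\<lambda>_. of_real x * (- theta f (1 / x) / of_real x)) x) / of_real x) (at x)"
    by (simp add: T_arg_eq_sing_term)
  also have "((- \<alpha> - 1) * sing_term \<eta> (- \<alpha> - 1) 0 (\<lambda>x. f (1 / x)) x
      + sing_term \<eta> (- \<alpha> - 1) 0 (\<lambda>_. of_real x * (- theta f (1 / x) / of_real x)) x)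
      = sing_term \<eta> (- \<alpha> - 1) 0 (\<lambda>x. T_shift \<alpha> f (1 / x)) x"
    using False by (simp add: sing_term_def T_shift_def algebra_simps)
  also have "sing_term \<eta> (- \<alpha> - 1) 0 (\<lambda>x. T_shift \<alpha> f (1 / x)) x / of_real x
      = T_arg (\<alpha> + 1) (\<eta> + 1) (T_shift \<alpha> f) x"
    unfolding sing_term_divide T_arg_eq_sing_term by (simp only: minus_add_distrib) simp
  finally show ?thesis .
qed

lemma continuous_T_arg: "conormal a f \<Longrightarrow> continuous_on UNIV (T_arg \<alpha> \<eta> f)"
  by (rule continuous_on_vector_derivative[OF has_vector_derivative_T_arg])

lemma measurable_T_arg: "conormal a f \<Longrightarrow> T_arg \<alpha> \<eta> f \<in> borel_measurable borel"
  by (intro borel_measurable_continuous_onI continuous_T_arg)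

section \<open>Absolute convergence of the integral\<close>

lemma integrable_inverse_1_plus_square: "integrable lborel (\<lambda>x::real. 1 / (1 + x\<^sup>2))"
proof -
  have "set_integrable lborel (einterval (-\<infinity>) \<infinity>) (\<lambda>x. inverse (1 + x\<^sup>2))"
  proof (rule interval_integral_FTC_nonneg)
    show "((arctan \<circ> real_of_ereal) \<longlongrightarrow> - (pi / 2)) (at_right (- \<infinity>))"
      unfolding ereal_tendsto_simps1 by (rule tendsto_arctan_at_bot)
    show "((arctan \<circ> real_of_ereal) \<longlongrightarrow> pi / 2) (at_left \<infinity>)"
      unfolding ereal_tendsto_simps1 by (rule tendsto_arctan_at_top)
    show "isCont (\<lambda>x. inverse (1 + x\<^sup>2)) x" for x :: real
      by (intro continuous_intros) (simp add: add_nonneg_eq_0_iff)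
  qed (auto intro: DERIV_arctan)
  then show ?thesis by (simp add: set_integrable_def divide_inverse)
qed

lemma integrable_of_decay:
  fixes u :: "real \<Rightarrow> complex"
  assumes "u \<in> borel_measurable borel" "\<And>x. norm (u x) \<le> C" "\<And>x. x\<^sup>2 * norm (u x) \<le> D"
  shows "integrable lborel u"
proof (rule Bochner_Integration.integrable_bound)
  show "integrable lborel (\<lambda>x. (C + D) * (1 / (1 + x\<^sup>2)))"
    by (intro integrable_mult_right integrable_inverse_1_plus_square)
  have "norm (u x) \<le> (C + D) * (1 / (1 + x\<^sup>2))" for x
  proof -
    have "(1 + x\<^sup>2) * norm (u x) \<le> C + D"
      using assms(2)[of x] assms(3)[of x] by (simp add: distrib_right)
    moreover have "1 + x\<^sup>2 > 0" by (simp add: add_pos_nonneg)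
    ultimately show ?thesis by (simp add: field_simps)
  qed
  then show "AE x in lborel. norm (u x) \<le> norm ((C + D) * (1 / (1 + x\<^sup>2)))"
    by (intro always_eventually allI) (metis abs_ge_self order_trans real_norm_def)
qed (use assms in simp)

text \<open>The threshold 1 is what makes the exponent -2 admissible at infinity; the exponent 0
  takes care of bounded \<open>x\<close>.\<close>

lemma integrable_T_arg:
  assumes "conormal a f" "a + Re \<alpha> \<ge> 1"
  shows "integrable lborel (T_arg \<alpha> \<eta> f)"
proof -
  obtain C where C: "C \<ge> 0" "\<And>x. x \<noteq> 0 \<Longrightarrow> norm (T_arg \<alpha> \<eta> f x) \<le> C * \<bar>x\<bar> powr 0"
    using T_arg_bound[OF assms(1), of \<alpha> 0 \<eta>] assms(2) by auto
  obtain D where D: "D \<ge> 0" "\<And>x. x \<noteq> 0 \<Longrightarrow> norm (T_arg \<alpha> \<eta> f x) \<le> D * \<bar>x\<bar> powr (-2)"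
    using T_arg_bound[OF assms(1), of \<alpha> "-2" \<eta>] assms(2) by auto
  show ?thesis
  proof (rule integrable_of_decay[OF measurable_T_arg[OF assms(1)]])
    show "norm (T_arg \<alpha> \<eta> f x) \<le> C" for x
      using C(1) C(2)[of x] by (cases "x = 0") auto
    show "x\<^sup>2 * norm (T_arg \<alpha> \<eta> f x) \<le> D" for x
    proof (cases "x = 0")
      case False
      then have "x\<^sup>2 * norm (T_arg \<alpha> \<eta> f x) \<le> x\<^sup>2 * (D * \<bar>x\<bar> powr (-2))"
        using D(2)[of x] by (intro mult_left_mono) auto
      also have "\<dots> = D" using False by (simp add: powr_minus powr_numeral)
      finally show ?thesis .
    qed (use D in simp)
  qed
qed

section \<open>Differentiation under the integral sign and integration by parts\<close>

definition fourier_kernel :: "real \<Rightarrow> real \<Rightarrow> complex" where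
  "fourier_kernel x y = exp (- (2 * of_real pi * \<i> * of_real (x * y)))"

lemma fourier_eq: "fourier g y = (LINT x|lborel. g x * fourier_kernel x y)"
  by (simp add: fourier_def fourier_kernel_def)

lemma norm_fourier_kernel [simp]: "norm (fourier_kernel x y) = 1"
  by (simp add: fourier_kernel_def norm_exp_eq_Re)

lemma fourier_kernel_commute: "fourier_kernel x y = fourier_kernel y x"
  by (simp add: fourier_kernel_def mult.commute)

lemma fourier_kernel_add: "fourier_kernel x (y + h) = fourier_kernel x y * fourier_kernel x h"
  by (simp add: fourier_kernel_def exp_add [symmetric] algebra_simps)

lemma has_vector_derivative_fourier_kernel:
  "(fourier_kernel x has_vector_derivative - (2 * of_real pi * \<i> * of_real x) * fourier_kernel x y) (at y)"
proof -
  have 1: "((\<lambda>y. - (2 * of_real pi * \<i> * of_real (x * y))) has_vector_derivative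
      - (2 * of_real pi * \<i> * of_real x)) (at y)"
  proof -
    have "((\<lambda>y. - (2 * of_real pi * \<i> * of_real x) * complex_of_real y) has_vector_derivative
      - (2 * of_real pi * \<i> * of_real x) * of_real 1) (at y)"
      by (intro has_vector_derivative_mult_right has_vector_derivative_of_real DERIV_ident)
    then show ?thesis by (simp add: mult.assoc)
  qed
  show ?thesis
    using field_vector_diff_chain_at[OF 1 DERIV_exp] by (simp only: o_def fourier_kernel_def[abs_def])
qed

lemma continuous_fourier_kernel: "continuous_on S (\<lambda>x. fourier_kernel x y)"
  unfolding fourier_kernel_def by (intro continuous_intros)

lemma measurable_fourier_kernel: "(\<lambda>x. fourier_kernel x y) \<in> borel_measurable borel"
  by (intro borel_measurable_continuous_onI continuous_fourier_kernel)

text \<open>Provides the dominating function for difference quotients: after division by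
  \<open>|h|\<close> the bound no longer depends on the increment.\<close>

lemma norm_fourier_kernel_minus_1_le: "norm (fourier_kernel x h - 1) \<le> 2 * pi * \<bar>x\<bar> * \<bar>h\<bar>"
proof -
  have "fourier_kernel x h = exp (\<i> * of_real (- (2 * pi * x * h)))"
    by (simp add: fourier_kernel_def algebra_simps)
  then have "norm (fourier_kernel x h - 1) = 2 * \<bar>sin (- (2 * pi * x * h) / 2)\<bar>"
    by (simp only: dist_exp_i_1)
  also have "\<dots> \<le> 2 * \<bar>- (2 * pi * x * h) / 2\<bar>" by (intro mult_left_mono abs_sin_x_le_abs_x) auto
  also have "\<dots> = 2 * pi * \<bar>x\<bar> * \<bar>h\<bar>" by (simp add: abs_mult)
  finally show ?thesis .
qed

lemma has_vector_derivative_iff_quotient: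
  fixes f :: "real \<Rightarrow> 'a::real_normed_vector"
  shows "(f has_vector_derivative D) (at y) \<longleftrightarrow> ((\<lambda>h. (f (y + h) - f y) /\<^sub>R h) \<longlongrightarrow> D) (at 0)"
proof -
  have "norm (f (y + h) - f y - h *\<^sub>R D) / norm h = norm ((f (y + h) - f y) /\<^sub>R h - D)" if "h \<noteq> 0" for h
  proof -
    have "(f (y + h) - f y) /\<^sub>R h - D = (f (y + h) - f y - h *\<^sub>R D) /\<^sub>R h"
      using that by (simp add: scaleR_diff_right)
    then show ?thesis by (simp add: divide_inverse mult.commute)
  qed
  then have "((\<lambda>h. norm (f (y + h) - f y - h *\<^sub>R D) / norm h) \<longlongrightarrow> 0) (at 0)
      \<longleftrightarrow> ((\<lambda>h. norm ((f (y + h) - f y) /\<^sub>R h - D)) \<longlongrightarrow> 0) (at 0)"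
    by (intro filterlim_cong) (auto simp: eventually_at_filter)
  also have "\<dots> \<longleftrightarrow> ((\<lambda>h. (f (y + h) - f y) /\<^sub>R h) \<longlongrightarrow> D) (at 0)"
    by (simp add: tendsto_norm_zero_iff Lim_null [symmetric])
  finally show ?thesis
    by (simp add: has_vector_derivative_def has_derivative_at bounded_linear_scaleR_left)
qed

lemma integrable_mult_fourier_kernel:
  assumes "integrable lborel u" shows "integrable lborel (\<lambda>x. u x * fourier_kernel x y)"
proof (rule Bochner_Integration.integrable_bound[OF assms])
  show "(\<lambda>x. u x * fourier_kernel x y) \<in> borel_measurable lborel"
    using borel_measurable_integrable[OF assms] measurable_fourier_kernel by simp
qed (simp add: norm_mult)

text \<open>Dominated convergence concerns sequences, so the limit of the difference quotients is
  tested along sequences of increments.\<close>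

lemma has_vector_derivative_fourier:
  assumes u: "integrable lborel u" and xu: "integrable lborel (\<lambda>x. of_real x * u x)"
  shows "(fourier u has_vector_derivative fourier (\<lambda>x. - (2 * of_real pi * \<i>) * (of_real x * u x)) y) (at y)"
  unfolding has_vector_derivative_iff_quotient tendsto_at_iff_sequentially
proof (intro allI impI)
  fix X :: "nat \<Rightarrow> real" assume X: "\<forall>i. X i \<in> UNIV - {0}" "X \<longlonglongrightarrow> 0"
  let ?s = "\<lambda>i x. (u x * fourier_kernel x (y + X i) - u x * fourier_kernel x y) /\<^sub>R X i"
  have "(\<lambda>i. LINT x|lborel. ?s i x) \<longlonglongrightarrow> fourier (\<lambda>x. - (2 * of_real pi * \<i>) * (of_real x * u x)) y"
    unfolding fourier_eq
  proof (rule integral_dominated_convergence)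
    show "integrable lborel (\<lambda>x. 2 * pi * norm (of_real x * u x))"
      by (intro integrable_mult_right integrable_norm xu)
    show "(\<lambda>x. - (2 * of_real pi * \<i>) * (of_real x * u x) * fourier_kernel x y) \<in> borel_measurable lborel"
      by (intro borel_measurable_integrable integrable_mult_fourier_kernel integrable_mult_right xu)
    show "?s i \<in> borel_measurable lborel" for i
      by (intro borel_measurable_integrable integrable_scaleR_right Bochner_Integration.integrable_diff
          integrable_mult_fourier_kernel u)
    show "AE x in lborel. (\<lambda>i. ?s i x) \<longlonglongrightarrow> - (2 * of_real pi * \<i>) * (of_real x * u x) * fourier_kernel x y"
    proof (intro always_eventually allI)
      fix x
      have "(\<lambda>i. (fourier_kernel x (y + X i) - fourier_kernel x y) /\<^sub>R X i)
        \<longlonglongrightarrow> - (2 * of_real pi * \<i> * of_real x) * fourier_kernel x y"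
        using has_vector_derivative_fourier_kernel[of x y] X
        unfolding has_vector_derivative_iff_quotient tendsto_at_iff_sequentially by (auto simp: o_def)
      from tendsto_mult_left[OF this, of "u x"]
      show "(\<lambda>i. ?s i x) \<longlonglongrightarrow> - (2 * of_real pi * \<i>) * (of_real x * u x) * fourier_kernel x y"
        by (simp add: algebra_simps)
    qed
    show "AE x in lborel. norm (?s i x) \<le> 2 * pi * norm (of_real x * u x)" for i
    proof (intro always_eventually allI)
      fix x
      have "?s i x = u x * fourier_kernel x y * (fourier_kernel x (X i) - 1) /\<^sub>R X i"
        by (simp add: fourier_kernel_add algebra_simps)
      then have "norm (?s i x) = norm (u x * fourier_kernel x y * (fourier_kernel x (X i) - 1) /\<^sub>R X i)"
        by (rule arg_cong)
      then have "norm (?s i x) = norm (u x) * norm (fourier_kernel x (X i) - 1) / \<bar>X i\<bar>"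
        by (simp only: norm_scaleR norm_mult norm_fourier_kernel abs_inverse divide_inverse) simp
      also have "\<dots> \<le> norm (u x) * (2 * pi * \<bar>x\<bar> * \<bar>X i\<bar>) / \<bar>X i\<bar>"
        by (intro divide_right_mono mult_left_mono norm_fourier_kernel_minus_1_le) auto
      also have "\<dots> = 2 * pi * norm (of_real x * u x)"
        using X(1) by (simp add: norm_mult)
      finally show "norm (?s i x) \<le> 2 * pi * norm (of_real x * u x)" .
    qed
  qed
  moreover have "(LINT x|lborel. ?s i x) = (fourier u (y + X i) - fourier u y) /\<^sub>R X i" for i
    using integrable_mult_fourier_kernel[OF u]
    by (simp add: fourier_eq)
  ultimately show "((\<lambda>h. (fourier u (y + h) - fourier u y) /\<^sub>R h) \<circ> X)
      \<longlonglongrightarrow> fourier (\<lambda>x. - (2 * of_real pi * \<i>) * (of_real x * u x)) y"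
    by (simp only: o_def)
qed

text \<open>Serves as integration by parts: applied to a product, it says that the two halves of the
  product rule have opposite integrals.\<close>

lemma integral_derivative_eq_0:
  fixes G :: "real \<Rightarrow> complex"
  assumes "\<And>x. (G has_vector_derivative G' x) (at x)" "continuous_on UNIV G'" "integrable lborel G'"
    and "(G \<longlongrightarrow> 0) at_top" "(G \<longlongrightarrow> 0) at_bot"
  shows "(LINT x|lborel. G' x) = 0"
proof -
  have "(LBINT x=-\<infinity>..\<infinity>. G' x) = 0 - 0"
  proof (rule interval_integral_FTC_integrable)
    show "isCont G' x" for x using assms(2) by (simp add: continuous_on_eq_continuous_at)
    show "set_integrable lborel (einterval (- \<infinity>) \<infinity>) G'" using assms(3) by (simp add: set_integrable_def)
    show "((G \<circ> real_of_ereal) \<longlongrightarrow> 0) (at_right (- \<infinity>))" "((G \<circ> real_of_ereal) \<longlongrightarrow> 0) (at_left \<infinity>)"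
      unfolding ereal_tendsto_simps1 using assms by auto
  qed (use assms in auto)
  then show ?thesis
    by (simp add: interval_lebesgue_integral_def set_lebesgue_integral_def)
qed

lemma tendsto_0_of_decay:
  fixes u :: "real \<Rightarrow> complex"
  assumes "\<And>x. \<bar>x\<bar> * norm (u x) \<le> C"
  shows "(u \<longlongrightarrow> 0) at_infinity"
proof (rule Lim_null_comparison)
  show "\<forall>\<^sub>F x in at_infinity. norm (u x) \<le> C * inverse (norm x)"
    unfolding eventually_at_infinity
    using assms by (intro exI[of _ 1]) (auto simp: field_simps)
  show "((\<lambda>x::real. C * inverse (norm x)) \<longlongrightarrow> 0) at_infinity"
    by (intro tendsto_mult_right_zero tendsto_inverse_0_at_top filterlim_norm_at_top) 
qed

lemma tendsto_0_at_top_bot_of_decay: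
  fixes u :: "real \<Rightarrow> complex"
  assumes "\<And>x. \<bar>x\<bar> * norm (u x) \<le> C"
  shows "(u \<longlongrightarrow> 0) at_top" "(u \<longlongrightarrow> 0) at_bot"
  using tendsto_0_of_decay[OF assms] at_top_le_at_infinity at_bot_le_at_infinity
  by (auto intro: tendsto_mono)

section \<open>The transform where its integral converges\<close>

definition T_int :: "complex \<Rightarrow> bit \<Rightarrow> (real \<Rightarrow> complex) \<Rightarrow> real \<Rightarrow> complex" where
  "T_int \<alpha> \<eta> f = fourier (T_arg \<alpha> \<eta> f)"

lemma T_int_add:
  assumes "conormal a f" "conormal a g" "a + Re \<alpha> \<ge> 1"
  shows "T_int \<alpha> \<eta> (\<lambda>x. f x + g x) y = T_int \<alpha> \<eta> f y + T_int \<alpha> \<eta> g y"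
  using integrable_mult_fourier_kernel[OF integrable_T_arg[OF assms(1,3)]]
    integrable_mult_fourier_kernel[OF integrable_T_arg[OF assms(2,3)]]
  by (simp add: T_int_def fourier_eq T_arg_add distrib_right)

lemma fourier_scale: "fourier (\<lambda>x. c * u x) y = c * fourier u y"
  by (simp add: fourier_eq mult.assoc)

lemma T_int_scale: "T_int \<alpha> \<eta> (\<lambda>x. c * f x) y = c * T_int \<alpha> \<eta> f y"
  by (simp add: T_int_def T_arg_scale fourier_scale)

lemma T_int_bounded:
  assumes "conormal a f" "a + Re \<alpha> \<ge> 1"
  obtains C where "\<And>y. norm (T_int \<alpha> \<eta> f y) \<le> C"
proof -
  have "norm (T_int \<alpha> \<eta> f y) \<le> (LINT x|lborel. norm (T_arg \<alpha> \<eta> f x * fourier_kernel x y))" for y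
    unfolding T_int_def fourier_eq by (rule integral_norm_bound)
  then have "norm (T_int \<alpha> \<eta> f y) \<le> (LINT x|lborel. norm (T_arg \<alpha> \<eta> f x))" for y
    by (simp add: norm_mult)
  then show ?thesis by (rule that)
qed

text \<open>The derivative multiplies the integrand by \<open>x\<close>, which lowers \<alpha> by
  one; the threshold of \<open>integrable_T_arg\<close> has to hold after this loss.\<close>

lemma has_vector_derivative_T_int:
  assumes "conormal a f" "a + Re \<alpha> \<ge> 2"
  shows "(T_int \<alpha> \<eta> f has_vector_derivative - (2 * of_real pi * \<i>) * T_int (\<alpha> - 1) (\<eta> + 1) f y) (at y)"
proof -
  have "integrable lborel (\<lambda>x. of_real x * T_arg \<alpha> \<eta> f x)"
    unfolding T_arg_mult_ident using assms by (intro integrable_T_arg) auto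
  moreover have "integrable lborel (T_arg \<alpha> \<eta> f)"
    using assms by (intro integrable_T_arg) auto
  ultimately show ?thesis
    using has_vector_derivative_fourier[of "T_arg \<alpha> \<eta> f" y]
    by (simp only: fourier_scale T_int_def T_arg_mult_ident)
qed

text \<open>Integration by parts: the factor with \<open>y\<close> is the derivative falling on the
  kernel, and \<open>T_shift\<close> comes from the derivative falling on the integrand.\<close>

lemma T_int_mult_ident:
  assumes "conormal a f" "a + Re \<alpha> \<ge> 1"
  shows "2 * of_real pi * \<i> * of_real y * T_int \<alpha> \<eta> f y = T_int (\<alpha> + 1) (\<eta> + 1) (T_shift \<alpha> f) y"
proof -
  define G where "G = (\<lambda>x. T_arg \<alpha> \<eta> f x * fourier_kernel x y)"
  define A where "A = (\<lambda>x. T_arg (\<alpha> + 1) (\<eta> + 1) (T_shift \<alpha> f) x * fourier_kernel x y)"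
  have f': "conormal a (T_shift \<alpha> f)" by (rule conormal_T_shift[OF assms(1)])
  have iG: "integrable lborel G" unfolding G_def
    using assms by (intro integrable_mult_fourier_kernel integrable_T_arg)
  have iA: "integrable lborel A" unfolding A_def
    by (rule integrable_mult_fourier_kernel[OF integrable_T_arg[OF f']]) (use assms in auto)
  have cont: "continuous_on UNIV G" "continuous_on UNIV A" unfolding G_def A_def
    by (intro continuous_on_mult continuous_T_arg[OF assms(1)] continuous_T_arg[OF f'] continuous_fourier_kernel)+
  \<comment> \<open>Decay of order -1 is all that the boundary terms at infinity need.\<close>
  obtain C where C: "C \<ge> 0" "\<And>x. x \<noteq> 0 \<Longrightarrow> norm (T_arg \<alpha> \<eta> f x) \<le> C * \<bar>x\<bar> powr (-1)"
    using T_arg_bound[OF assms(1), of \<alpha> "-1" \<eta>] assms(2) by auto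
  have bd: "\<bar>x\<bar> * norm (G x) \<le> C" for x
  proof (cases "x = 0")
    case False
    then show ?thesis using C(2)[OF False] by (simp add: G_def norm_mult powr_minus field_simps)
  qed (use C in simp)
  have "(LINT x|lborel. A x + (- (2 * of_real pi * \<i> * of_real y)) * G x) = 0"
  proof (rule integral_derivative_eq_0)
    show "(G has_vector_derivative A x + (- (2 * of_real pi * \<i> * of_real y)) * G x) (at x)" for x
    proof -
      have "((\<lambda>x. fourier_kernel x y) has_vector_derivative
          - (2 * of_real pi * \<i> * of_real y) * fourier_kernel x y) (at x)"
        using has_vector_derivative_fourier_kernel[of y x] by (simp only: fourier_kernel_commute[of _ y])
      from has_vector_derivative_mult[OF has_vector_derivative_T_arg[OF assms(1), of \<alpha> \<eta>] this]
      moreover have "T_arg \<alpha> \<eta> f x * (- (2 * of_real pi * \<i> * of_real y) * fourier_kernel x y)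
          + T_arg (\<alpha> + 1) (\<eta> + 1) (T_shift \<alpha> f) x * fourier_kernel x y
        = A x + (- (2 * of_real pi * \<i> * of_real y)) * G x"
        unfolding G_def A_def by (simp only: mult_ac add_ac)
      ultimately show ?thesis unfolding G_def by (simp only:)
    qed
    show "continuous_on UNIV (\<lambda>x. A x + (- (2 * of_real pi * \<i> * of_real y)) * G x)"
      by (intro continuous_intros cont)
    show "integrable lborel (\<lambda>x. A x + (- (2 * of_real pi * \<i> * of_real y)) * G x)"
      by (intro Bochner_Integration.integrable_add integrable_mult_right iA iG)
  qed (use tendsto_0_at_top_bot_of_decay[OF bd] in auto)
  also have "(LINT x|lborel. A x + (- (2 * of_real pi * \<i> * of_real y)) * G x)
      = T_int (\<alpha> + 1) (\<eta> + 1) (T_shift \<alpha> f) y - 2 * of_real pi * \<i> * of_real y * T_int \<alpha> \<eta> f y"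
    using iA iG by (simp add: T_int_def fourier_eq A_def G_def)
  finally show ?thesis by simp
qed

lemma ck_on_T_int:
  assumes "conormal a f" "a + Re \<alpha> \<ge> 2 + real n"
  shows "ck_on n UNIV (T_int \<alpha> \<eta> f)"
  using assms(2)
proof (induction n arbitrary: \<alpha> \<eta>)
  case 0
  then show ?case
    using continuous_on_vector_derivative[OF has_vector_derivative_T_int[OF assms(1)]] by simp
next
  case (Suc n)
  have "ck_on n UNIV (\<lambda>y. - (2 * of_real pi * \<i>) * T_int (\<alpha> - 1) (\<eta> + 1) f y)"
    using Suc.prems by (intro ck_on_scale Suc.IH) auto
  then show ?case
    using has_vector_derivative_T_int[OF assms(1), of \<alpha> \<eta>] Suc.prems by (intro ck_on_SucI) auto
qed

text \<open>The two preceding identities composed: \<open>d/dy\<close> lowers \<alpha> by one,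
  multiplication by \<open>y\<close> raises it again, and \<open>- T_shift (\<alpha> - 1) f\<close>
  is \<open>theta f + \<alpha> f\<close>. The parity flips twice.\<close>

lemma has_vector_derivative_U':
  assumes "conormal a f" "a + Re \<alpha> \<ge> 2" "y \<noteq> 0"
  shows "(T_int \<alpha> \<eta> f has_vector_derivative T_int \<alpha> \<eta> (\<lambda>x. theta f x + \<alpha> * f x) y / of_real y) (at y)"
proof -
  have "T_int \<alpha> \<eta> (\<lambda>x. theta f x + \<alpha> * f x) y = T_int (\<alpha> - 1 + 1) (\<eta> + 1 + 1) (\<lambda>x. (-1) * T_shift (\<alpha> - 1) f x) y"
    unfolding bit_add_1_1 by (simp add: T_shift_def add.commute)
  also have "\<dots> = - (2 * of_real pi * \<i> * of_real y * T_int (\<alpha> - 1) (\<eta> + 1) f y)"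
    unfolding T_int_scale using T_int_mult_ident[OF assms(1), of "\<alpha> - 1" y "\<eta> + 1"] assms(2) by simp
  finally have "T_int \<alpha> \<eta> (\<lambda>x. theta f x + \<alpha> * f x) y / of_real y = - (2 * of_real pi * \<i>) * T_int (\<alpha> - 1) (\<eta> + 1) f y"
    using assms(3) by simp
  then show ?thesis using has_vector_derivative_T_int[OF assms(1,2)] by (simp only:)
qed

text \<open>Each factor \<open>y\<close> is traded for one \<open>T_shift\<close>, which keeps the
  order \<open>a\<close>, and one unit of \<alpha>, which only helps convergence. In the end the
  boundedness of a transform suffices.\<close>

lemma T_int_rapid_bound:
  assumes "conormal a f" "a + Re \<alpha> \<ge> 1"
  shows "\<exists>C. \<forall>y. \<bar>y\<bar> ^ k * norm (T_int \<alpha> \<eta> f y) \<le> C"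
  using assms
proof (induction k arbitrary: \<alpha> \<eta> f)
  case 0
  then show ?case using T_int_bounded[of a f \<alpha> \<eta>] by auto
next
  case (Suc k)
  obtain C where C: "\<And>y. \<bar>y\<bar> ^ k * norm (T_int (\<alpha> + 1) (\<eta> + 1) (T_shift \<alpha> f) y) \<le> C"
    using Suc.IH[OF conormal_T_shift[OF Suc.prems(1)], of "\<alpha> + 1"] Suc.prems by fastforce
  have "\<bar>y\<bar> ^ Suc k * norm (T_int \<alpha> \<eta> f y) \<le> C / (2 * pi)" for y
  proof -
    have "norm (2 * of_real pi * \<i> * of_real y * T_int \<alpha> \<eta> f y) = 2 * pi * \<bar>y\<bar> * norm (T_int \<alpha> \<eta> f y)"
      by (simp add: norm_mult)
    then have "\<bar>y\<bar> ^ k * (2 * pi * \<bar>y\<bar> * norm (T_int \<alpha> \<eta> f y)) \<le> C"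
      using C[of y] by (simp only: T_int_mult_ident[OF Suc.prems])
    then show ?thesis by (simp add: field_simps)
  qed
  then show ?case by blast
qed

section \<open>Rapid decay and simple singularities\<close>

lemma has_vector_derivative_complex_of_real:
  "(complex_of_real has_vector_derivative 1) (at x)"
  using has_vector_derivative_of_real[of "\<lambda>x. x" 1 "at x"] by simp

text \<open>Closure under \<open>\<theta> - j\<close> reflects the identity \<open>(h / x\<^sup>j)' = (\<theta>h - j h) / x\<^sup>j\<^sup>+\<^sup>1\<close>, which turns
  statements about \<open>\<theta> = x d/dx\<close> into statements about \<open>d/dx\<close>.\<close>

locale euler_family =
  fixes \<F> :: "(real \<Rightarrow> complex) set"
  assumes differentiable: "h \<in> \<F> \<Longrightarrow> x \<noteq> 0 \<Longrightarrow> (h has_vector_derivative theta h x / of_real x) (at x)"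
    and closed: "h \<in> \<F> \<Longrightarrow> (\<lambda>x. theta h x - of_nat j * h x) \<in> \<F>"
begin

lemma has_vector_derivative_divide_power:
  assumes "h \<in> \<F>" "x \<noteq> 0"
  shows "((\<lambda>x. h x / of_real x ^ j) has_vector_derivative
    (theta h x - of_nat j * h x) / of_real x ^ Suc j) (at x)"
proof -
  have "((\<lambda>z::complex. 1 / z ^ j) has_field_derivative - (of_nat j / z ^ Suc j)) (at z)" if "z \<noteq> 0" for z
    using that
    apply (auto intro!: derivative_eq_intros)
    apply (cases j)
     apply (auto simp: field_simps)
    done
  then have d: "((\<lambda>z. 1 / z ^ j) has_field_derivative - (of_nat j / of_real x ^ Suc j)) (at (complex_of_real x))"
    using assms(2) by simp
  have "((\<lambda>x. 1 / complex_of_real x ^ j) has_vector_derivative - (of_nat j / of_real x ^ Suc j)) (at x)"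
    using field_vector_diff_chain_at[OF has_vector_derivative_complex_of_real d] by (simp add: o_def)
  from has_vector_derivative_mult[OF differentiable[OF assms] this]
  have "((\<lambda>x. h x / of_real x ^ j) has_vector_derivative
      h x * - (of_nat j / of_real x ^ Suc j) + theta h x / of_real x * (1 / of_real x ^ j)) (at x)"
    by simp
  moreover have "h x * - (of_nat j / of_real x ^ Suc j) + theta h x / of_real x * (1 / of_real x ^ j)
      = (theta h x - of_nat j * h x) / of_real x ^ Suc j"
    using assms(2) by (simp add: field_simps)
  ultimately show ?thesis by (simp only:)
qed

lemma ck_on_divide_power: "h \<in> \<F> \<Longrightarrow> ck_on n (- {0}) (\<lambda>x. h x / of_real x ^ j)"
proof (induction n arbitrary: h j)
  case 0
  have "continuous_on (- {0}) (\<lambda>x. h x / of_real x ^ j)"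
    by (rule continuous_on_vector_derivative[OF has_vector_derivative_divide_power[OF 0]]) auto
  then show ?case by simp
next
  case (Suc n)
  show ?case
    by (rule ck_on_SucI[OF has_vector_derivative_divide_power[OF Suc.prems] Suc.IH[OF closed[OF Suc.prems]]]) auto
qed

lemma smooth: "h \<in> \<F> \<Longrightarrow> h 0 = 0 \<Longrightarrow> h \<in> smooth_punctured"
  using ck_on_divide_power[of h _ 0] by (intro smooth_puncturedI) auto

text \<open>A derivative passes to another member of the family and raises \<open>j\<close>; for
  \<open>|x| \<ge> 1\<close> the division by \<open>x ^ j\<close> can only help, so the decay of the
  members is enough.\<close>

lemma rapid_divide_power:
  assumes decay: "\<And>h k. h \<in> \<F> \<Longrightarrow> ((\<lambda>x. of_real (\<bar>x\<bar> ^ k) * h x) \<longlongrightarrow> 0) at_infinity"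
  assumes "h \<in> \<F>"
  shows "((\<lambda>x. of_real (\<bar>x\<bar> ^ k) * (vderiv ^^ n) (\<lambda>x. h x / of_real x ^ j) x) \<longlongrightarrow> 0) at_infinity"
  using assms(2)
proof (induction n arbitrary: h j)
  case 0
  show ?case
  proof (rule Lim_null_comparison[OF _ tendsto_norm_zero[OF decay[OF 0, of k]]])
    show "\<forall>\<^sub>F x in at_infinity. norm (of_real (\<bar>x\<bar> ^ k) * (vderiv ^^ 0) (\<lambda>x. h x / of_real x ^ j) x)
        \<le> norm (of_real (\<bar>x\<bar> ^ k) * h x)"
      unfolding eventually_at_infinity
    proof (intro exI[of _ 1] allI impI)
      fix x :: real assume "1 \<le> norm x"
      then have "norm (h x) / \<bar>x\<bar> ^ j \<le> norm (h x) / 1"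
        by (intro divide_left_mono) (auto intro!: one_le_power)
      then show "norm (of_real (\<bar>x\<bar> ^ k) * (vderiv ^^ 0) (\<lambda>x. h x / of_real x ^ j) x)
          \<le> norm (of_real (\<bar>x\<bar> ^ k) * h x)"
        using mult_left_mono[of _ _ "\<bar>x\<bar> ^ k"] by (fastforce simp: norm_mult norm_divide norm_power)
    qed
  qed
next
  case (Suc n)
  have eq: "(vderiv ^^ Suc n) (\<lambda>x. h x / of_real x ^ j) x
      = (vderiv ^^ n) (\<lambda>x. (theta h x - of_nat j * h x) / of_real x ^ Suc j) x" if "x \<noteq> 0" for x
  proof -
    have "(vderiv ^^ n) (vderiv (\<lambda>x. h x / of_real x ^ j)) x
      = (vderiv ^^ n) (\<lambda>x. (theta h x - of_nat j * h x) / of_real x ^ Suc j) x"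
    proof (rule vderiv_pow_cong[of "- {0}"])
      show "vderiv (\<lambda>x. h x / of_real x ^ j) y = (theta h y - of_nat j * h y) / of_real y ^ Suc j"
        if "y \<in> - {0}" for y
        using has_vector_derivative_divide_power[OF Suc.prems, of y j] that
        unfolding vderiv_def by (intro vector_derivative_at) auto
    qed (use that in auto)
    then show ?thesis by (simp only: funpow_Suc_right comp_apply)
  qed
  have "\<forall>\<^sub>F x in at_infinity. x \<noteq> (0::real)"
    unfolding eventually_at_infinity by (intro exI[of _ 1]) auto
  then have "\<forall>\<^sub>F x in at_infinity. of_real (\<bar>x\<bar> ^ k) * (vderiv ^^ Suc n) (\<lambda>x. h x / of_real x ^ j) x
      = of_real (\<bar>x\<bar> ^ k) * (vderiv ^^ n) (\<lambda>x. (theta h x - of_nat j * h x) / of_real x ^ Suc j) x"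
    by (rule eventually_mono) (subst eq, assumption, rule refl)
  from tendsto_cong[OF this] show ?case
    using Suc.IH[OF closed[OF Suc.prems, of j], of "Suc j"] by (simp only:)
qed

lemma rapid:
  assumes "\<And>h k. h \<in> \<F> \<Longrightarrow> ((\<lambda>x. of_real (\<bar>x\<bar> ^ k) * h x) \<longlongrightarrow> 0) at_infinity" "h \<in> \<F>"
  shows "((\<lambda>x. of_real (\<bar>x\<bar> ^ k) * (vderiv ^^ n) h x) \<longlongrightarrow> 0) at_infinity"
  using rapid_divide_power[OF assms, of _ _ 0] by simp

end

section \<open>Rapid decay expressed through the Euler operator\<close>

definition decaying :: "(real \<Rightarrow> complex) \<Rightarrow> bool" where
  "decaying f \<longleftrightarrow> f \<in> smooth_punctured \<and>
     (\<forall>n k. ((\<lambda>x. of_real (\<bar>x\<bar> ^ k) * (theta ^^ n) f x) \<longlongrightarrow> 0) at_infinity)"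

lemma decaying_smooth_punctured: "decaying f \<Longrightarrow> f \<in> smooth_punctured"
  by (simp add: decaying_def)

lemma decaying_tendsto: "decaying f \<Longrightarrow> ((\<lambda>x. of_real (\<bar>x\<bar> ^ k) * f x) \<longlongrightarrow> 0) at_infinity"
  unfolding decaying_def by (metis funpow_0)

lemma decaying_theta:
  assumes "decaying f" shows "decaying (theta f)"
proof -
  have "((\<lambda>x. of_real (\<bar>x\<bar> ^ k) * (theta ^^ Suc n) f x) \<longlongrightarrow> 0) at_infinity" for n k
    using assms unfolding decaying_def by blast
  then show ?thesis
    using assms by (simp add: decaying_def smooth_punctured_theta funpow_Suc_right del: funpow.simps)
qed

lemma decaying_add:
  assumes "decaying f" "decaying g" shows "decaying (\<lambda>x. f x + g x)"
proof -
  have fg: "f \<in> smooth_punctured" "g \<in> smooth_punctured" using assms by (auto simp: decaying_def)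
  have "((\<lambda>x. of_real (\<bar>x\<bar> ^ k) * (theta ^^ n) f x + of_real (\<bar>x\<bar> ^ k) * (theta ^^ n) g x) \<longlongrightarrow> 0 + 0) at_infinity"
    for n k using assms unfolding decaying_def by (intro tendsto_add) blast+
  then show ?thesis
    by (simp add: decaying_def smooth_punctured_add fg theta_pow_add distrib_left)
qed

lemma decaying_scale:
  assumes "decaying f" shows "decaying (\<lambda>x. c * f x)"
proof -
  have f: "f \<in> smooth_punctured" using assms by (auto simp: decaying_def)
  have "((\<lambda>x. c * (of_real (\<bar>x\<bar> ^ k) * (theta ^^ n) f x)) \<longlongrightarrow> 0) at_infinity"
    for n k using assms unfolding decaying_def by (intro tendsto_mult_right_zero) blast
  then show ?thesis
    by (simp add: decaying_def smooth_punctured_scale f theta_pow_scale mult.left_commute)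
qed

lemma smooth_punctured_divide:
  assumes "f \<in> smooth_punctured" shows "(\<lambda>x. f x / of_real x) \<in> smooth_punctured"
  by (rule smooth_puncturedI)
    (auto intro!: ck_on_divide[OF _ smooth_punctured_ck_on[OF assms] ck_on_of_real])

lemma theta_divide:
  assumes "f \<in> smooth_punctured"
  shows "theta (\<lambda>x. f x / of_real x) = (\<lambda>x. (theta f x + (-1) * f x) / of_real x)"
proof (rule theta_eqI)
  fix x :: real assume x: "x \<noteq> 0"
  have inv: "((\<lambda>x. inverse (complex_of_real x)) has_vector_derivative 1 * - inverse ((of_real x)\<^sup>2)) (at x)"
    using field_vector_diff_chain_at[OF has_vector_derivative_complex_of_real DERIV_inverse] x
    by (simp add: o_def numeral_2_eq_2)
  have "f x * (1 * - inverse ((of_real x)\<^sup>2)) + theta f x / of_real x * inverse (of_real x)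
      = (theta f x + (-1) * f x) / of_real x / of_real x"
    using x by (simp add: divide_inverse power2_eq_square algebra_simps)
  with has_vector_derivative_mult[OF smooth_punctured_has_vector_derivative[OF assms x] inv]
  show "((\<lambda>x. f x / of_real x) has_vector_derivative
      (theta f x + (-1) * f x) / of_real x / of_real x) (at x)"
    by (simp only: divide_inverse)
qed simp

lemma decaying_divide: "decaying f \<Longrightarrow> decaying (\<lambda>x. f x / of_real x)"
proof -
  assume "decaying f"
  then have "((\<lambda>x. of_real (\<bar>x\<bar> ^ k) * (theta ^^ n) (\<lambda>x. f x / of_real x) x) \<longlongrightarrow> 0) at_infinity" for n k
  proof (induction n arbitrary: f)
    case 0
    show ?case
    proof (rule Lim_null_comparison[OF _ tendsto_norm_zero[OF decaying_tendsto[OF 0, of k]]])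
      show "\<forall>\<^sub>F x in at_infinity. norm (of_real (\<bar>x\<bar> ^ k) * (theta ^^ 0) (\<lambda>x. f x / of_real x) x)
          \<le> norm (of_real (\<bar>x\<bar> ^ k) * f x)"
        unfolding eventually_at_infinity
      proof (intro exI[of _ 1] allI impI)
        fix x :: real assume "1 \<le> norm x"
        then have "norm (f x) / \<bar>x\<bar> \<le> norm (f x) / 1"
          by (intro divide_left_mono) auto
        then show "norm (of_real (\<bar>x\<bar> ^ k) * (theta ^^ 0) (\<lambda>x. f x / of_real x) x)
            \<le> norm (of_real (\<bar>x\<bar> ^ k) * f x)"
          using mult_left_mono[of _ _ "\<bar>x\<bar> ^ k"] by (fastforce simp: norm_mult norm_divide norm_power)
      qed
    qed
  next
    case (Suc n)
    show ?case
      unfolding funpow_Suc_right comp_apply theta_divide[OF decaying_smooth_punctured[OF Suc.prems]]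
      by (intro Suc.IH decaying_add decaying_scale decaying_theta Suc.prems)
  qed
  then show ?thesis
    using \<open>decaying f\<close> by (simp add: decaying_def smooth_punctured_divide)
qed

text \<open>The Leibniz rule for \<open>x\<close> times the derivative of \<open>f\<close>: only the
  first derivative of the factor \<open>x\<close> contributes.\<close>

lemma vderiv_pow_theta:
  assumes "smooth_on (- {0}) f" "x \<noteq> 0"
  shows "(vderiv ^^ n) (theta f) x = of_real x * (vderiv ^^ Suc n) f x + of_nat n * (vderiv ^^ n) f x"
  using assms(2)
proof (induction n arbitrary: x)
  case 0
  then show ?case by (simp add: theta_def)
next
  case (Suc n)
  have s: "smooth_on (- {0}) ((vderiv ^^ n) f)" for n
    by (induction n) (auto intro: smooth_on_vderiv assms(1))
  have d: "((vderiv ^^ n) f has_vector_derivative (vderiv ^^ Suc n) f x) (at x)" for n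
    using smooth_on_has_vderiv[OF s, of x n] Suc.prems by simp
  have "((\<lambda>x. of_real x * (vderiv ^^ Suc n) f x + of_nat n * (vderiv ^^ n) f x) has_vector_derivative
      of_real x * (vderiv ^^ Suc (Suc n)) f x + 1 * (vderiv ^^ Suc n) f x
      + of_nat n * (vderiv ^^ Suc n) f x) (at x)"
    by (intro has_vector_derivative_add has_vector_derivative_mult has_vector_derivative_mult_right d has_vector_derivative_complex_of_real)
  then have "((vderiv ^^ n) (theta f) has_vector_derivative
      of_real x * (vderiv ^^ Suc (Suc n)) f x + 1 * (vderiv ^^ Suc n) f x
      + of_nat n * (vderiv ^^ Suc n) f x) (at x)"
    by (rule has_vector_derivative_transform_within_open[of _ _ _ "- {0}"]) (use Suc in auto)
  from vector_derivative_at[OF this] show ?case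
    by (simp add: vderiv_def[of "(vderiv ^^ n) (theta f)"] algebra_simps)
qed

text \<open>The decay condition of \<open>S_sis\<close> is replaced by one adapted to the transform.
  From \<open>theta\<close> to \<open>d/dx\<close> the passage is \<open>euler_family\<close>;
  conversely, each \<open>theta\<close> costs one derivative and one power of \<open>|x|\<close>,
  and both are available since \<open>n\<close> and \<open>k\<close> are arbitrary.\<close>

lemma decaying_iff:
  "decaying f \<longleftrightarrow> f \<in> smooth_punctured \<and>
     (\<forall>n k. ((\<lambda>x. of_real (\<bar>x\<bar> ^ k) * (vderiv ^^ n) f x) \<longlongrightarrow> 0) at_infinity)"
proof (intro iffI conjI allI)
  assume f: "decaying f"
  interpret euler_family "Collect decaying"
  proof
    fix h :: "real \<Rightarrow> complex" and j assume h: "h \<in> Collect decaying"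
    have "(\<lambda>x. theta h x - of_nat j * h x) = (\<lambda>x. theta h x + (- of_nat j) * h x)" by simp
    with h show "(\<lambda>x. theta h x - of_nat j * h x) \<in> Collect decaying"
      by (simp only: mem_Collect_eq) (intro decaying_add decaying_scale decaying_theta)
  qed (auto intro: smooth_punctured_has_vector_derivative decaying_smooth_punctured)
  show "((\<lambda>x. of_real (\<bar>x\<bar> ^ k) * (vderiv ^^ n) f x) \<longlongrightarrow> 0) at_infinity" for n k
    using f by (intro rapid) (auto intro: decaying_tendsto simp del: of_real_power)
next
  assume f: "f \<in> smooth_punctured \<and>
     (\<forall>n k. ((\<lambda>x. of_real (\<bar>x\<bar> ^ k) * (vderiv ^^ n) f x) \<longlongrightarrow> 0) at_infinity)"
  have "(theta ^^ m) f \<in> smooth_punctured \<and>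
     (\<forall>n k. ((\<lambda>x. of_real (\<bar>x\<bar> ^ k) * (vderiv ^^ n) ((theta ^^ m) f) x) \<longlongrightarrow> 0) at_infinity)" for m
  proof (induction m)
    case (Suc m)
    define g where "g = (theta ^^ m) f"
    have g: "smooth_on (- {0}) g" "g \<in> smooth_punctured"
      "((\<lambda>x. of_real (\<bar>x\<bar> ^ k) * (vderiv ^^ n) g x) \<longlongrightarrow> 0) at_infinity" for n k
      using Suc by (auto simp: g_def smooth_punctured_def)
    have "((\<lambda>x. of_real (\<bar>x\<bar> ^ k) * (vderiv ^^ n) (theta g) x) \<longlongrightarrow> 0) at_infinity" for n k
    proof (rule Lim_null_comparison)
      show "\<forall>\<^sub>F x in at_infinity. norm (of_real (\<bar>x\<bar> ^ k) * (vderiv ^^ n) (theta g) x)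
          \<le> norm (of_real (\<bar>x\<bar> ^ Suc k) * (vderiv ^^ Suc n) g x)
            + of_nat n * norm (of_real (\<bar>x\<bar> ^ k) * (vderiv ^^ n) g x)"
        unfolding eventually_at_infinity
      proof (intro exI[of _ 1] allI impI)
        fix x :: real assume "1 \<le> norm x"
        then have "x \<noteq> 0" by auto
        have "norm (of_real (\<bar>x\<bar> ^ k) * (vderiv ^^ n) (theta g) x)
          = \<bar>x\<bar> ^ k * norm (of_real x * (vderiv ^^ Suc n) g x + of_nat n * (vderiv ^^ n) g x)"
          unfolding vderiv_pow_theta[OF g(1) \<open>x \<noteq> 0\<close>] by (simp add: norm_mult norm_power)
        also have "\<dots> \<le> \<bar>x\<bar> ^ k * (\<bar>x\<bar> * norm ((vderiv ^^ Suc n) g x) + of_nat n * norm ((vderiv ^^ n) g x))"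
          by (intro mult_left_mono norm_triangle_le) (auto simp: norm_mult)
        finally show "norm (of_real (\<bar>x\<bar> ^ k) * (vderiv ^^ n) (theta g) x)
          \<le> norm (of_real (\<bar>x\<bar> ^ Suc k) * (vderiv ^^ Suc n) g x)
            + of_nat n * norm (of_real (\<bar>x\<bar> ^ k) * (vderiv ^^ n) g x)"
          by (simp add: norm_mult norm_power algebra_simps)
      qed
      have "((\<lambda>x. norm (of_real (\<bar>x\<bar> ^ Suc k) * (vderiv ^^ Suc n) g x)
            + of_nat n * norm (of_real (\<bar>x\<bar> ^ k) * (vderiv ^^ n) g x)) \<longlongrightarrow> 0 + of_nat n * 0) at_infinity"
        by (intro tendsto_add tendsto_mult tendsto_const tendsto_norm_zero g)
      then show "((\<lambda>x. norm (of_real (\<bar>x\<bar> ^ Suc k) * (vderiv ^^ Suc n) g x)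
            + of_nat n * norm (of_real (\<bar>x\<bar> ^ k) * (vderiv ^^ n) g x)) \<longlongrightarrow> 0) at_infinity"
        by (simp only: mult_zero_right add_0_right)
    qed
    then show ?case using smooth_punctured_theta[OF g(2)] by (simp add: g_def)
  qed (use f in auto)
  from this show "decaying f"
    unfolding decaying_def using f by (metis funpow_0)
qed (simp add: decaying_def)

text \<open>These model sums are defined on the whole line and have compactly supported
  coefficients, so the transform can be applied to them directly. The parameter \<open>a\<close> is
  a strict lower bound for the real parts of all exponents, which makes every such sum conormal of
  order \<open>a\<close>.\<close>

inductive sing_sum :: "real \<Rightarrow> (real \<Rightarrow> complex) \<Rightarrow> bool" for a where
  sing_sum_term: "compactly_supported_smooth F \<Longrightarrow> a < Re \<beta> \<Longrightarrow> sing_sum a (sing_term \<eta> \<beta> k F)"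
| sing_sum_add: "sing_sum a p \<Longrightarrow> sing_sum a q \<Longrightarrow> sing_sum a (\<lambda>x. p x + q x)"

lemma conormal_sing_sum: "sing_sum a p \<Longrightarrow> conormal a p"
  by (induction rule: sing_sum.induct) (auto intro: conormal_sing_term conormal_add)

lemma compactly_supported_smooth_mult:
  assumes "compactly_supported_smooth F" "smooth_on UNIV G"
  shows "compactly_supported_smooth (\<lambda>x. G x * F x)"
proof -
  have "smooth_on UNIV F" using assms(1) by (simp add: compactly_supported_smooth_def)
  then have "smooth_on UNIV (\<lambda>x. G x * F x)"
    using assms(2) by (simp add: smooth_on_iff_ck_on ck_on_mult)
  then show ?thesis using assms(1) by (auto simp: compactly_supported_smooth_def)
qed

lemma compactly_supported_smooth_scale:
  "compactly_supported_smooth F \<Longrightarrow> compactly_supported_smooth (\<lambda>x. c * F x)"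
  by (rule compactly_supported_smooth_mult) (simp_all add: smooth_on_iff_ck_on)

lemma compactly_supported_smooth_cutoff: "compactly_supported_smooth (\<lambda>x. of_real (cutoff x))"
  unfolding compactly_supported_smooth_def
  using smooth_cutoff cutoff_eq_0 by (auto intro!: exI[of _ 2])

text \<open>There is no clause for the empty sum; it is obtained as a term with coefficient 0 and
  the admissible exponent \<open>a + 1\<close>.\<close>

lemma sing_sum_0: "sing_sum a (\<lambda>x. 0)"
proof -
  have "compactly_supported_smooth (\<lambda>x. 0 * of_real (cutoff x))"
    by (rule compactly_supported_smooth_scale[OF compactly_supported_smooth_cutoff])
  from sing_sum_term[OF this, of a "of_real (a + 1)" 0 0] show ?thesis
    by (simp add: sing_term_def[abs_def])
qed

lemma sing_sum_scale: "sing_sum a p \<Longrightarrow> sing_sum a (\<lambda>x. c * p x)"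
proof (induction rule: sing_sum.induct)
  case (sing_sum_term F \<beta> \<eta> k)
  have "(\<lambda>x. c * sing_term \<eta> \<beta> k F x) = sing_term \<eta> \<beta> k (\<lambda>x. c * F x)"
    by (simp add: sing_term_def fun_eq_iff)
  then show ?case
    using sing_sum.sing_sum_term[OF compactly_supported_smooth_scale[OF sing_sum_term(1)]] sing_sum_term
    by simp
next
  case (sing_sum_add p q)
  then show ?case using sing_sum.sing_sum_add by (simp add: distrib_left)
qed

lemma sing_sum_smooth_punctured: "sing_sum a p \<Longrightarrow> p \<in> smooth_punctured"
  by (rule conormal_smooth_punctured[OF conormal_sing_sum])

lemma sing_sum_theta: "sing_sum a p \<Longrightarrow> sing_sum a (theta p)"
proof (induction rule: sing_sum.induct)
  case (sing_sum_term F \<beta> \<eta> k)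
  then have "smooth_on UNIV F" by (simp add: compactly_supported_smooth_def)
  from theta_sing_term[OF this] sing_sum_term show ?case
    by (simp only:) (intro sing_sum_scale sing_sum.intros compactly_supported_smooth_theta)
next
  case (sing_sum_add p q)
  then show ?case
    by (simp only: theta_add[OF sing_sum_smooth_punctured sing_sum_smooth_punctured])
      (intro sing_sum.sing_sum_add)
qed

lemma sing_sum_divide: "sing_sum a p \<Longrightarrow> sing_sum (a - 1) (\<lambda>x. p x / of_real x)"
proof (induction rule: sing_sum.induct)
  case (sing_sum_term F \<beta> \<eta> k)
  then show ?case unfolding sing_term_divide by (intro sing_sum.sing_sum_term) auto
next
  case (sing_sum_add p q)
  then show ?case unfolding add_divide_distrib by (intro sing_sum.sing_sum_add)
qed

text \<open>A simple singularity with a record of how singular it may be. With \<open>a\<close> left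
  free the two notions agree, see \<open>has_simple_singularity_iff\<close>; the record decides how
  large \<alpha> must be for convergence.\<close>

definition singular_at_0 :: "real \<Rightarrow> (real \<Rightarrow> complex) \<Rightarrow> bool" where
  "singular_at_0 a f \<longleftrightarrow> (\<exists>p e. sing_sum a p \<and> e > 0 \<and> (\<forall>x. 0 < \<bar>x\<bar> \<and> \<bar>x\<bar> < e \<longrightarrow> f x = p x))"

lemma singular_at_0I:
  assumes "sing_sum a p" "e > 0" "\<And>x. 0 < \<bar>x\<bar> \<Longrightarrow> \<bar>x\<bar> < e \<Longrightarrow> f x = p x"
  shows "singular_at_0 a f"
  using assms unfolding singular_at_0_def by blast

lemma singular_at_0_add:
  assumes "singular_at_0 a f" "singular_at_0 a g" shows "singular_at_0 a (\<lambda>x. f x + g x)"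
proof -
  obtain p e where p: "sing_sum a p" "e > 0" "\<forall>x. 0 < \<bar>x\<bar> \<and> \<bar>x\<bar> < e \<longrightarrow> f x = p x"
    using assms(1) unfolding singular_at_0_def by blast
  obtain q d where q: "sing_sum a q" "d > 0" "\<forall>x. 0 < \<bar>x\<bar> \<and> \<bar>x\<bar> < d \<longrightarrow> g x = q x"
    using assms(2) unfolding singular_at_0_def by blast
  show ?thesis
    by (rule singular_at_0I[OF sing_sum_add[OF p(1) q(1)], of "min e d"]) (use p q in auto)
qed

lemma singular_at_0_sum:
  "(\<And>i. i \<in> I \<Longrightarrow> singular_at_0 a (f i)) \<Longrightarrow> singular_at_0 a (\<lambda>x. \<Sum>i\<in>I. f i x)"
proof (induction I rule: infinite_finite_induct)
  case (insert i I)
  then show ?case using singular_at_0_add by simp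
qed (auto intro: singular_at_0I[OF sing_sum_0, of 1])

lemma singular_at_0_scale:
  assumes "singular_at_0 a f" shows "singular_at_0 a (\<lambda>x. c * f x)"
proof -
  obtain p e where p: "sing_sum a p" "e > 0" "\<forall>x. 0 < \<bar>x\<bar> \<and> \<bar>x\<bar> < e \<longrightarrow> f x = p x"
    using assms(1) unfolding singular_at_0_def by blast
  show ?thesis by (rule singular_at_0I[OF sing_sum_scale[OF p(1)] p(2)]) (use p in auto)
qed

lemma singular_at_0_divide:
  assumes "singular_at_0 a f" shows "singular_at_0 (a - 1) (\<lambda>x. f x / of_real x)"
proof -
  obtain p e where p: "sing_sum a p" "e > 0" "\<forall>x. 0 < \<bar>x\<bar> \<and> \<bar>x\<bar> < e \<longrightarrow> f x = p x"
    using assms(1) unfolding singular_at_0_def by blast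
  show ?thesis by (rule singular_at_0I[OF sing_sum_divide[OF p(1)] p(2)]) (use p in auto)
qed

lemma theta_pow_cong:
  assumes "open S" "\<And>x. x \<in> S \<Longrightarrow> f x = g x" "x \<in> S"
  shows "(theta ^^ n) f x = (theta ^^ n) g x"
  using assms(3)
proof (induction n arbitrary: x)
  case (Suc n)
  have "vderiv ((theta ^^ n) f) x = vderiv ((theta ^^ n) g) x"
    using vderiv_pow_cong[OF assms(1) Suc.IH Suc.prems, of _ 1] by simp
  then show ?case by (simp add: theta_def[of "(theta ^^ n) f"] theta_def[of "(theta ^^ n) g"])
qed (use assms in auto)

lemma open_punctured_interval: "open {x::real. 0 < \<bar>x\<bar> \<and> \<bar>x\<bar> < e}"
  by (intro open_Collect_conj open_Collect_less continuous_intros)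

lemma singular_at_0_theta:
  assumes "singular_at_0 a f" shows "singular_at_0 a (theta f)"
proof -
  obtain p e where p: "sing_sum a p" "e > 0" "\<forall>x. 0 < \<bar>x\<bar> \<and> \<bar>x\<bar> < e \<longrightarrow> f x = p x"
    using assms(1) unfolding singular_at_0_def by blast
  have "theta f x = theta p x" if "0 < \<bar>x\<bar>" "\<bar>x\<bar> < e" for x
    using theta_pow_cong[OF open_punctured_interval, of e f p x 1] p that by auto
  then show ?thesis by (rule singular_at_0I[OF sing_sum_theta[OF p(1)] p(2)])
qed

lemma localize_smooth:
  assumes "e > 0" "smooth_on {-e<..<e} F"
  obtains G where "compactly_supported_smooth G" "\<And>x. \<bar>x\<bar> \<le> e / 4 \<Longrightarrow> G x = F x"
proof -
  \<comment> \<open>The scaled cutoff is 1 for \<open>|x| \<le> e / 4\<close> and 0 for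
    \<open>|x| \<ge> e / 2\<close>, well inside the interval on which \<open>F\<close> is
    smooth.\<close>
  define G where "G = (\<lambda>x. of_real (cutoff (4 / e * x)) * F x)"
  have zero: "G x = 0" if "\<bar>x\<bar> > e / 2" for x
    using that assms(1) by (auto simp: G_def abs_mult field_simps intro!: cutoff_eq_0)
  have "smooth_on UNIV G"
  proof (rule smooth_onI)
    fix n
    show "ck_on n UNIV G"
    proof (rule ck_on_open_cover)
      fix x :: real
      show "\<exists>V. x \<in> V \<and> open V \<and> ck_on n V G"
      proof (cases "\<bar>x\<bar> < e")
        case True
        have "ck_on n UNIV (\<lambda>x. complex_of_real (cutoff (4 / e * x)))"
          using ck_on_compose_scale[OF smooth_on_imp_ck_on[OF smooth_cutoff]] .
        then have "ck_on n {-e<..<e} G"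
          unfolding G_def
          by (rule ck_on_mult[OF ck_on_subset[OF subset_UNIV] smooth_on_imp_ck_on[OF assms(2)]])
        then show ?thesis using True by (intro exI[of _ "{-e<..<e}"]) auto
      next
        case False
        have o: "open {x::real. \<bar>x\<bar> > e / 2}" by (intro open_Collect_less continuous_intros)
        have "ck_on n {x::real. \<bar>x\<bar> > e / 2} G"
          by (rule ck_on_cong[OF o _ ck_on_const[of _ _ 0]]) (use zero in auto)
        then show ?thesis using False o assms(1) by (intro exI[of _ "{x::real. \<bar>x\<bar> > e / 2}"]) auto
      qed
    qed
  qed simp
  then have "compactly_supported_smooth G"
    unfolding compactly_supported_smooth_def using zero assms(1) by (intro conjI exI[of _ "e / 2"]) auto
  moreover have "G x = F x" if "\<bar>x\<bar> \<le> e / 4" for x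
    using that assms(1) by (simp add: G_def cutoff_eq_1 abs_mult field_simps)
  ultimately show ?thesis using that by blast
qed

lemma singular_at_0_sing_term:
  assumes "e > 0" "smooth_on {-e<..<e} F" "a < Re \<beta>"
  shows "singular_at_0 a (sing_term \<eta> \<beta> k F)"
proof -
  obtain G where G: "compactly_supported_smooth G" "\<And>x. \<bar>x\<bar> \<le> e / 4 \<Longrightarrow> G x = F x"
    using localize_smooth[OF assms(1,2)] by blast
  show ?thesis
    by (rule singular_at_0I[OF sing_sum_term[OF G(1) assms(3), of \<eta> k], of "e / 4"])
      (use assms G(2) in \<open>auto simp: sing_term_def\<close>)
qed

lemma singular_at_0_cong:
  assumes "e > 0" "\<And>x. 0 < \<bar>x\<bar> \<Longrightarrow> \<bar>x\<bar> < e \<Longrightarrow> f x = g x" "singular_at_0 a f"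
  shows "singular_at_0 a g"
proof -
  obtain p d where p: "sing_sum a p" "d > 0" "\<forall>x. 0 < \<bar>x\<bar> \<and> \<bar>x\<bar> < d \<longrightarrow> f x = p x"
    using assms(3) unfolding singular_at_0_def by blast
  show ?thesis by (rule singular_at_0I[OF p(1), of "min e d"]) (use p assms in auto)
qed

lemma has_simple_singularity_imp:
  assumes "has_simple_singularity f"
  shows "\<exists>a. singular_at_0 a f"
proof -
  obtain m g \<alpha> \<eta> e where e: "e > 0"
    and g: "\<forall>j\<in>{1..m::nat}. has_singularity_type (\<alpha> j) (\<eta> j) (g j)"
    and f: "\<forall>x. 0 < \<bar>x\<bar> \<and> \<bar>x\<bar> < e \<longrightarrow> f x = (\<Sum>j=1..m. g j x)"
    using assms unfolding has_simple_singularity_def by blast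
  \<comment> \<open>One less than a minimum gives a strict bound; the inserted 0 covers the empty
    sum \<open>m = 0\<close>.\<close>
  define a where "a = Min (insert 0 ((\<lambda>j. Re (\<alpha> j)) ` {1..m})) - 1"
  have a: "a < Re (\<alpha> j)" if "j \<in> {1..m}" for j
  proof -
    have "Min (insert 0 ((\<lambda>j. Re (\<alpha> j)) ` {1..m})) \<le> Re (\<alpha> j)"
      by (rule Min_le) (use that in auto)
    then show ?thesis by (simp add: a_def)
  qed
  have "singular_at_0 a (g j)" if j: "j \<in> {1..m}" for j
  proof -
    have "has_singularity_type (\<alpha> j) (\<eta> j) (g j)" using g j by blast
    then obtain n F d where d: "d > 0" "\<forall>i\<le>n. smooth_on {-d<..<d} (F i)"
      "\<forall>x. 0 < \<bar>x\<bar> \<and> \<bar>x\<bar> < d \<longrightarrow> g j x = (\<Sum>i\<le>n::nat. sgn_pow (\<eta> j) x * of_real \<bar>x\<bar> powr \<alpha> j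
         * of_real (ln \<bar>x\<bar>) ^ i * F i x)"
      unfolding has_singularity_type_def by blast
    have "singular_at_0 a (\<lambda>x. \<Sum>i\<in>{..n}. sing_term (\<eta> j) (\<alpha> j) i (F i) x)"
      using d a[OF j] by (intro singular_at_0_sum singular_at_0_sing_term) auto
    then show ?thesis
      by (rule singular_at_0_cong[OF d(1), rotated]) (use d in \<open>auto simp: sing_term_def\<close>)
  qed
  then have "singular_at_0 a (\<lambda>x. \<Sum>j=1..m. g j x)" by (intro singular_at_0_sum)
  then show ?thesis using singular_at_0_cong[OF e, of "\<lambda>x. \<Sum>j=1..m. g j x" f a] f by auto
qed

lemma has_simple_singularity_add:
  assumes "has_simple_singularity f" "has_simple_singularity h"
  shows "has_simple_singularity (\<lambda>x. f x + h x)"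
proof -
  obtain m g \<alpha> \<eta> e where 1: "e > 0"
    "\<forall>j\<in>{1..m::nat}. has_singularity_type (\<alpha> j) (\<eta> j) (g j)"
    "\<forall>x. 0 < \<bar>x\<bar> \<and> \<bar>x\<bar> < e \<longrightarrow> f x = (\<Sum>j=1..m. g j x)"
    using assms(1) unfolding has_simple_singularity_def by blast
  obtain m' g' \<alpha>' \<eta>' e' where 2: "e' > 0"
    "\<forall>j\<in>{1..m'::nat}. has_singularity_type (\<alpha>' j) (\<eta>' j) (g' j)"
    "\<forall>x. 0 < \<bar>x\<bar> \<and> \<bar>x\<bar> < e' \<longrightarrow> h x = (\<Sum>j=1..m'. g' j x)"
    using assms(2) unfolding has_simple_singularity_def by blast
  define G where "G = (\<lambda>j. if j \<le> m then g j else g' (j - m))"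
  have "(\<Sum>j=1..m + m'. G j x) = (\<Sum>j=1..m. g j x) + (\<Sum>j=1..m'. g' j x)" for x
  proof -
    have "(\<Sum>j=1..m + m'. G j x) = (\<Sum>j=1..m. G j x) + (\<Sum>j=m+1..m + m'. G j x)"
      by (rule sum.ub_add_nat) simp
    also have "(\<Sum>j=m+1..m + m'. G j x) = (\<Sum>j=1..m'. G (j + m) x)"
      using sum.shift_bounds_cl_nat_ivl[of "\<lambda>j. G j x" 1 m m'] by (simp add: add.commute)
    finally show ?thesis by (simp add: G_def)
  qed
  moreover have "has_singularity_type (if j \<le> m then \<alpha> j else \<alpha>' (j - m))
      (if j \<le> m then \<eta> j else \<eta>' (j - m)) (G j)" if "j \<in> {1..m + m'}" for j
  proof (cases "j \<le> m")
    case False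
    then have "j - m \<in> {1..m'}" using that by auto
    then show ?thesis using False 2(2) by (simp add: G_def)
  qed (use that 1(2) in \<open>auto simp: G_def\<close>)
  ultimately show ?thesis
    unfolding has_simple_singularity_def using 1 2
    by (intro exI[of _ "m + m'"] exI[of _ G] exI[of _ "\<lambda>j. if j \<le> m then \<alpha> j else \<alpha>' (j - m)"]
        exI[of _ "\<lambda>j. if j \<le> m then \<eta> j else \<eta>' (j - m)"] exI[of _ "min e e'"]) auto
qed

lemma has_simple_singularity_sing_sum: "sing_sum a p \<Longrightarrow> has_simple_singularity p"
proof (induction rule: sing_sum.induct)
  case (sing_sum_term F \<beta> \<eta> k)
  then have F: "smooth_on UNIV F" by (simp add: compactly_supported_smooth_def)
  \<comment> \<open>A singularity type carries all powers of the logarithm up to \<open>k\<close>;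
    the coefficients of the lower ones are set to 0.\<close>
  define F' where "F' = (\<lambda>j. if j = k then F else (\<lambda>x. 0))"
  have "smooth_on {-1<..<1} (F' j)" for j
    using smooth_on_subset[OF subset_UNIV F] smooth_on_iff_ck_on[of "{-1<..<1}" "\<lambda>x. 0"]
    by (simp add: F'_def)
  moreover have "sing_term \<eta> \<beta> k F x
      = (\<Sum>j\<le>k. sgn_pow \<eta> x * of_real \<bar>x\<bar> powr \<beta> * of_real (ln \<bar>x\<bar>) ^ j * F' j x)" for x
  proof -
    have "(\<Sum>j\<le>k. sgn_pow \<eta> x * of_real \<bar>x\<bar> powr \<beta> * of_real (ln \<bar>x\<bar>) ^ j * F' j x)
      = (\<Sum>j\<le>k. if j = k then sing_term \<eta> \<beta> k F x else 0)"
      by (intro sum.cong) (auto simp: F'_def sing_term_def)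
    then show ?thesis by simp
  qed
  ultimately have "has_singularity_type \<beta> \<eta> (sing_term \<eta> \<beta> k F)"
    unfolding has_singularity_type_def using smooth_punctured_sing_term[OF F]
    by (intro conjI exI[of _ k] exI[of _ F'] exI[of _ 1]) auto
  then show ?case
    unfolding has_simple_singularity_def
    by (intro exI[of _ 1] exI[of _ "\<lambda>_. sing_term \<eta> \<beta> k F"] exI[of _ "\<lambda>_. \<beta>"] exI[of _ "\<lambda>_. \<eta>"]) auto
qed (rule has_simple_singularity_add)

lemma has_simple_singularity_iff: "has_simple_singularity f \<longleftrightarrow> (\<exists>a. singular_at_0 a f)"
proof
  assume "\<exists>a. singular_at_0 a f"
  then obtain a p e where p: "sing_sum a p" "e > 0" "\<forall>x. 0 < \<bar>x\<bar> \<and> \<bar>x\<bar> < e \<longrightarrow> f x = p x"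
    unfolding singular_at_0_def by blast
  obtain m g \<alpha> \<eta> d where d: "d > 0"
    "\<forall>j\<in>{1..m::nat}. has_singularity_type (\<alpha> j) (\<eta> j) (g j)"
    "\<forall>x. 0 < \<bar>x\<bar> \<and> \<bar>x\<bar> < d \<longrightarrow> p x = (\<Sum>j=1..m. g j x)"
    using has_simple_singularity_sing_sum[OF p(1)] unfolding has_simple_singularity_def by blast
  show "has_simple_singularity f"
    unfolding has_simple_singularity_def using p d
    by (intro exI[of _ m] exI[of _ g] exI[of _ \<alpha>] exI[of _ \<eta>] exI[of _ "min e d"]) auto
qed (rule has_simple_singularity_imp)

lemma S_sis_iff: "f \<in> S_sis \<longleftrightarrow> decaying f \<and> (\<exists>a. singular_at_0 a f)"
  by (auto simp: S_sis_def decaying_iff has_simple_singularity_iff)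

lemma conormal_imp_decaying:
  assumes "conormal a f" shows "decaying f"
  unfolding decaying_def
proof (intro conjI allI)
  fix n k
  \<comment> \<open>The minimum is admissible because it is at most \<open>a\<close>, and it beats
    the weight \<open>|x| ^ k\<close> with one power to spare.\<close>
  obtain C where C: "\<And>x. x \<noteq> 0 \<Longrightarrow> norm ((theta ^^ n) f x) \<le> C * \<bar>x\<bar> powr (min a (- real k - 1))"
    using assms unfolding conormal_def by (metis min.cobounded1)
  have C0: "C \<ge> 0" using order.trans[OF norm_ge_zero C[of 1]] by simp
  have z: "(theta ^^ n) f 0 = 0"
    using assms smooth_punctured_0 smooth_punctured_theta_pow unfolding conormal_def by blast
  have "\<forall>\<^sub>F x in at_infinity. norm (of_real (\<bar>x\<bar> ^ k) * (theta ^^ n) f x) \<le> C * inverse (norm x)"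
    unfolding eventually_at_infinity
  proof (intro exI[of _ 1] allI impI)
    fix x :: real assume "1 \<le> norm x"
    then have x: "\<bar>x\<bar> \<ge> 1" "x \<noteq> 0" by auto
    have "norm (of_real (\<bar>x\<bar> ^ k) * (theta ^^ n) f x) = \<bar>x\<bar> ^ k * norm ((theta ^^ n) f x)"
      by (simp add: norm_mult norm_power)
    also have "\<dots> \<le> \<bar>x\<bar> ^ k * (C * \<bar>x\<bar> powr (- real k - 1))"
      using x C0 by (intro mult_left_mono order.trans[OF C[OF x(2)]] powr_mono) auto
    also have "\<dots> = C * (\<bar>x\<bar> powr real k * \<bar>x\<bar> powr (- real k - 1))"
      using x by (simp add: powr_realpow)
    also have "\<dots> = C * inverse (norm x)"
      using x unfolding powr_add [symmetric] by (simp add: powr_minus)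
    finally show "norm (of_real (\<bar>x\<bar> ^ k) * (theta ^^ n) f x) \<le> C * inverse (norm x)" .
  qed
  moreover have "((\<lambda>x::real. C * inverse (norm x)) \<longlongrightarrow> 0) at_infinity"
    by (intro tendsto_mult_right_zero tendsto_inverse_0_at_top filterlim_norm_at_top)
  ultimately show "((\<lambda>x. of_real (\<bar>x\<bar> ^ k) * (theta ^^ n) f x) \<longlongrightarrow> 0) at_infinity"
    by (rule Lim_null_comparison)
qed (rule conormal_smooth_punctured[OF assms])

section \<open>From local behaviour at the origin to conormal functions\<close>

lemma decaying_bound:
  assumes "decaying f" "e > 0"
  shows "\<exists>C. \<forall>x. \<bar>x\<bar> \<ge> e \<longrightarrow> norm ((theta ^^ n) f x) \<le> C * \<bar>x\<bar> powr b"
proof -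
  define k where "k = nat \<lceil>- b\<rceil>"
  have k: "- b \<le> real k" by (simp add: k_def) linarith
  have "((\<lambda>x. of_real (\<bar>x\<bar> ^ k) * (theta ^^ n) f x) \<longlongrightarrow> 0) at_infinity"
    using assms(1) unfolding decaying_def by blast
  then have "\<forall>\<^sub>F x in at_infinity. dist (of_real (\<bar>x\<bar> ^ k) * (theta ^^ n) f x) 0 < 1"
    by (rule tendstoD) simp
  then obtain R0 where R0: "\<And>x::real. norm x \<ge> R0 \<Longrightarrow> dist (of_real (\<bar>x\<bar> ^ k) * (theta ^^ n) f x) 0 < 1"
    unfolding eventually_at_infinity by blast
  define R where "R = max 1 R0"
  have far: "norm ((theta ^^ n) f x) \<le> 1 * \<bar>x\<bar> powr b" if x: "\<bar>x\<bar> \<ge> R" for x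
  proof -
    have x1: "\<bar>x\<bar> \<ge> 1" using x by (simp add: R_def)
    then have x0: "x \<noteq> 0" by auto
    have "\<bar>x\<bar> ^ k * norm ((theta ^^ n) f x) \<le> 1"
      using R0[of x] x by (simp add: R_def norm_mult norm_power)
    then have "norm ((theta ^^ n) f x) \<le> 1 / \<bar>x\<bar> ^ k"
      using x0 by (simp add: field_simps)
    also have "\<dots> = \<bar>x\<bar> powr (- real k)"
      using x0 by (simp add: powr_minus powr_realpow divide_inverse)
    also have "\<dots> \<le> \<bar>x\<bar> powr b" using x1 k by (intro powr_mono) auto
    finally show ?thesis by simp
  qed
  let ?K = "{-R..-e} \<union> {e..R}"
  have "continuous_on (- {0}) ((theta ^^ n) f)"
    using assms(1) by (intro ck_on_continuous[of 0] smooth_punctured_ck_on smooth_punctured_theta_pow)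
      (simp add: decaying_def)
  then have "continuous_on ?K ((theta ^^ n) f)"
    by (rule continuous_on_subset) (use assms(2) in auto)
  then have "continuous_on ?K (\<lambda>x. norm ((theta ^^ n) f x) * \<bar>x\<bar> powr (- b))"
    by (intro continuous_intros) (use assms(2) in auto)
  moreover have "compact ?K" by (intro compact_Un) auto
  ultimately have "compact ((\<lambda>x. norm ((theta ^^ n) f x) * \<bar>x\<bar> powr (- b)) ` ?K)"
    by (rule compact_continuous_image)
  from compact_imp_bounded[OF this] obtain D where
    D: "\<forall>y \<in> (\<lambda>x. norm ((theta ^^ n) f x) * \<bar>x\<bar> powr (- b)) ` ?K. norm y \<le> D"
    unfolding bounded_iff by blast
  have near: "norm ((theta ^^ n) f x) \<le> D * \<bar>x\<bar> powr b" if x: "\<bar>x\<bar> \<ge> e" "\<bar>x\<bar> < R" for x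
  proof -
    have "x \<in> ?K" using x by auto
    then have "norm (norm ((theta ^^ n) f x) * \<bar>x\<bar> powr (- b)) \<le> D" using D by blast
    then have "norm ((theta ^^ n) f x) * \<bar>x\<bar> powr (- b) \<le> D" by simp
    then show ?thesis using x assms(2) by (simp add: powr_minus field_simps)
  qed
  have "norm ((theta ^^ n) f x) \<le> max 1 D * \<bar>x\<bar> powr b" if "\<bar>x\<bar> \<ge> e" for x
  proof (cases "\<bar>x\<bar> \<ge> R")
    case True
    show ?thesis by (rule order.trans[OF far[OF True] mult_right_mono]) auto
  next
    case False
    then show ?thesis by (intro order.trans[OF near[OF that] mult_right_mono]) auto
  qed
  then show ?thesis by blast
qed

text \<open>Near 0 all powers of \<open>theta\<close> vanish as well, and away from 0 decay bounds
  them by any power of \<open>|x|\<close>. Since \<open>a\<close> is arbitrary, such functions have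
  transforms that are smooth across the origin; they are the negligible part of
  \<open>f\<close>.\<close>

lemma conormal_of_vanishing:
  assumes "decaying f" "e > 0" "\<And>x. 0 < \<bar>x\<bar> \<Longrightarrow> \<bar>x\<bar> < e \<Longrightarrow> f x = 0"
  shows "conormal a f"
  unfolding conormal_def
proof (intro conjI allI impI)
  fix n b
  obtain C where C: "\<And>x. \<bar>x\<bar> \<ge> e \<Longrightarrow> norm ((theta ^^ n) f x) \<le> C * \<bar>x\<bar> powr b"
    using decaying_bound[OF assms(1,2)] by blast
  have "(theta ^^ n) f x = 0" if "0 < \<bar>x\<bar>" "\<bar>x\<bar> < e" for x
  proof -
    have "(theta ^^ n) (\<lambda>x. 0) = (\<lambda>x. 0)"
    proof (induction n)
      case (Suc n)
      have "theta (\<lambda>x. 0) = (\<lambda>x. 0)" by (rule theta_eqI) auto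
      then show ?case using Suc by simp
    qed simp
    moreover have "(theta ^^ n) f x = (theta ^^ n) (\<lambda>x. 0) x"
      by (rule theta_pow_cong[OF open_punctured_interval[of e]]) (use assms that in auto)
    ultimately show ?thesis by simp
  qed
  then have "norm ((theta ^^ n) f x) \<le> \<bar>C\<bar> * \<bar>x\<bar> powr b" if "x \<noteq> 0" for x
    using order.trans[OF C[of x] mult_right_mono[OF abs_ge_self]] that by (cases "\<bar>x\<bar> < e") auto
  then show "\<exists>C. \<forall>x. x \<noteq> 0 \<longrightarrow> norm ((theta ^^ n) f x) \<le> C * \<bar>x\<bar> powr b" by blast
qed (use assms in \<open>simp add: decaying_def\<close>)

text \<open>The model sum \<open>p\<close> that describes \<open>f\<close> near 0 is itself
  decaying, so it can be subtracted globally; what remains vanishes near 0.\<close>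

lemma decaying_decompose:
  assumes "decaying f" "singular_at_0 a f"
  obtains p f0 where "sing_sum a p" "\<And>b. conormal b f0" "f = (\<lambda>x. p x + f0 x)"
proof -
  obtain p e where p: "sing_sum a p" "e > 0" "\<forall>x. 0 < \<bar>x\<bar> \<and> \<bar>x\<bar> < e \<longrightarrow> f x = p x"
    using assms(2) unfolding singular_at_0_def by blast
  have "decaying (\<lambda>x. f x + (-1) * p x)"
    by (intro decaying_add decaying_scale assms conormal_imp_decaying[OF conormal_sing_sum[OF p(1)]])
  then have "conormal b (\<lambda>x. f x + (-1) * p x)" for b
    by (rule conormal_of_vanishing[OF _ p(2)]) (use p(3) in auto)
  then show ?thesis using p(1) that[of p "\<lambda>x. f x + (-1) * p x"] by auto
qed

lemma conormal_of_singular_at_0: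
  assumes "decaying f" "singular_at_0 a f" shows "conormal a f"
  using decaying_decompose[OF assms] conormal_sing_sum conormal_add by metis

lemma tendsto_T_int:
  assumes "conormal a f" "a + Re \<alpha> \<ge> 1"
  shows "((\<lambda>x. of_real (\<bar>x\<bar> ^ k) * T_int \<alpha> \<eta> f x) \<longlongrightarrow> 0) at_infinity"
proof -
  obtain C where "\<And>y. \<bar>y\<bar> ^ Suc k * norm (T_int \<alpha> \<eta> f y) \<le> C"
    using T_int_rapid_bound[OF assms] by blast
  then show ?thesis
    by (intro tendsto_0_of_decay[of _ C]) (simp add: norm_mult norm_power mult.assoc)
qed

lemma decaying_T_int:
  assumes "conormal a f" "a + Re \<alpha> \<ge> 2"
  shows "decaying (\<lambda>y. if y = 0 then 0 else T_int \<alpha> \<eta> f y)"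
proof -
  \<comment> \<open>Members have to agree with a transform only off the origin, since
    \<open>T_int\<close> may be nonzero at 0 while \<open>theta h\<close> always vanishes there. By
    \<open>has_vector_derivative_U'\<close> the parameters \<alpha> and \<eta> stay fixed and only
    \<open>f\<close> varies.\<close>
  let ?F = "{h. \<exists>f. conormal a f \<and> (\<forall>y. y \<noteq> 0 \<longrightarrow> h y = T_int \<alpha> \<eta> f y)}"
  have d: "(h has_vector_derivative T_int \<alpha> \<eta> (\<lambda>x. theta f x + \<alpha> * f x) x / of_real x) (at x)"
    if "conormal a f" "\<And>y. y \<noteq> 0 \<Longrightarrow> h y = T_int \<alpha> \<eta> f y" "x \<noteq> 0" for h f x
    by (rule has_vector_derivative_transform_within_open[OF has_vector_derivative_U'[OF that(1) assms(2) that(3)], of "- {0}"])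
      (use that in auto)
  have th: "theta h x = T_int \<alpha> \<eta> (\<lambda>x. theta f x + \<alpha> * f x) x"
    if "conormal a f" "\<And>y. y \<noteq> 0 \<Longrightarrow> h y = T_int \<alpha> \<eta> f y" "x \<noteq> 0" for h f x
    using thetaI[OF d[OF that]] that(3) by simp
  interpret euler_family ?F
  proof
    fix h :: "real \<Rightarrow> complex" and x :: real assume "h \<in> ?F" "x \<noteq> 0"
    then obtain f where "conormal a f" "\<And>y. y \<noteq> 0 \<Longrightarrow> h y = T_int \<alpha> \<eta> f y" by blast
    with d[OF this \<open>x \<noteq> 0\<close>] th[OF this \<open>x \<noteq> 0\<close>]
    show "(h has_vector_derivative theta h x / of_real x) (at x)" by simp
  next
    fix h :: "real \<Rightarrow> complex" and j assume "h \<in> ?F"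
    then obtain f where f: "conormal a f" "\<And>y. y \<noteq> 0 \<Longrightarrow> h y = T_int \<alpha> \<eta> f y" by blast
    have c: "conormal a (\<lambda>x. theta f x + \<alpha> * f x)"
      by (intro conormal_add conormal_scale conormal_theta f)
    have c2: "conormal a (\<lambda>x. - of_nat j * f x)" by (intro conormal_scale f)
    have "theta h y - of_nat j * h y = T_int \<alpha> \<eta> (\<lambda>x. (theta f x + \<alpha> * f x) + - of_nat j * f x) y"
      if "y \<noteq> 0" for y
      using T_int_add[OF c c2, of \<alpha> \<eta> y] assms(2) th[OF f that] f(2)[OF that] T_int_scale[of \<alpha> \<eta> "- of_nat j" f y]
      by simp
    with conormal_add[OF c c2] show "(\<lambda>x. theta h x - of_nat j * h x) \<in> ?F" by blast
  qed
  let ?h = "\<lambda>y. if y = 0 then 0 else T_int \<alpha> \<eta> f y"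
  have h: "?h \<in> ?F" using assms(1) by auto
  have decay: "((\<lambda>x. of_real (\<bar>x\<bar> ^ k) * h x) \<longlongrightarrow> 0) at_infinity" if h: "h \<in> ?F" for h k
  proof -
    obtain f where f: "conormal a f" "\<And>y. y \<noteq> 0 \<Longrightarrow> h y = T_int \<alpha> \<eta> f y" using h by blast
    have "\<forall>\<^sub>F x in at_infinity. of_real (\<bar>x\<bar> ^ k) * h x = of_real (\<bar>x\<bar> ^ k) * T_int \<alpha> \<eta> f x"
      unfolding eventually_at_infinity using f(2) by (intro exI[of _ 1]) auto
    from tendsto_cong[OF this] show ?thesis using tendsto_T_int[OF f(1), of \<alpha> k \<eta>] assms(2) by simp
  qed
  show ?thesis
    unfolding decaying_iff using smooth[OF h] rapid[OF decay h] by auto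
qed

section \<open>Logarithmic expansions and the Euler equation\<close>

lemma smooth_const: "smooth_on UNIV (\<lambda>x. c)"
  by (simp add: smooth_on_iff_ck_on)

lemma smooth_of_real: "smooth_on UNIV of_real"
  by (simp add: smooth_on_iff_ck_on)

lemma smooth_mult: "smooth_on UNIV F \<Longrightarrow> smooth_on UNIV G \<Longrightarrow> smooth_on UNIV (\<lambda>x. F x * G x)"
  by (simp add: smooth_on_iff_ck_on ck_on_mult)

lemma smooth_add: "smooth_on UNIV F \<Longrightarrow> smooth_on UNIV G \<Longrightarrow> smooth_on UNIV (\<lambda>x. F x + G x)"
  by (simp add: smooth_on_iff_ck_on ck_on_add)

lemma smooth_diff: "smooth_on UNIV F \<Longrightarrow> smooth_on UNIV G \<Longrightarrow> smooth_on UNIV (\<lambda>x. F x - G x)"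
  by (simp add: smooth_on_iff_ck_on ck_on_diff)

lemma smooth_power: "smooth_on UNIV F \<Longrightarrow> smooth_on UNIV (\<lambda>x. F x ^ n)"
  by (simp add: smooth_on_iff_ck_on ck_on_power)

lemma smooth_sum:
  "(\<And>i. i \<in> I \<Longrightarrow> smooth_on UNIV (F i)) \<Longrightarrow> smooth_on UNIV (\<lambda>x. \<Sum>i\<in>I. F i x)"
  by (simp add: smooth_on_iff_ck_on ck_on_sum)

lemma smooth_compose_scale: "smooth_on UNIV F \<Longrightarrow> smooth_on UNIV (\<lambda>x. F (c * x))"
  by (simp add: smooth_on_iff_ck_on ck_on_compose_scale)

lemma smooth_continuous: "smooth_on UNIV F \<Longrightarrow> continuous_on S F"
  by (rule continuous_on_subset[OF ck_on_continuous[OF smooth_on_imp_ck_on] subset_UNIV])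

lemma has_vector_derivative_compose_scale:
  assumes "smooth_on UNIV R"
  shows "((\<lambda>x. R (s * x)) has_vector_derivative of_real s * vderiv R (s * x)) (at x)"
proof -
  have "((\<lambda>x. s * x) has_vector_derivative s) (at x)"
    using DERIV_cmult_Id[of s x] by (simp add: has_real_derivative_iff_has_vector_derivative)
  from vector_diff_chain_at[OF this smooth_on_has_vderiv[OF assms UNIV_I]]
  show ?thesis by (simp add: o_def scaleR_conv_of_real)
qed

text \<open>One formula for two purposes: weight 1 applied to a derivative gives the Hadamard
  quotient, and weight \<open>s powr (- \<mu> - 1)\<close> gives a smooth solution of an Euler
  equation.\<close>

definition dilation_average :: "(real \<Rightarrow> complex) \<Rightarrow> (real \<Rightarrow> complex) \<Rightarrow> real \<Rightarrow> complex" where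
  "dilation_average \<kappa> R x = integral {0..1} (\<lambda>s. \<kappa> s * R (s * x))"

lemma integrable_dilation:
  assumes "continuous_on {0..1} \<kappa>" "smooth_on UNIV R"
  shows "(\<lambda>s. \<kappa> s * R (s * x)) integrable_on {0..1}"
  by (intro integrable_continuous_interval continuous_on_mult assms(1)
      continuous_on_compose2[OF smooth_continuous[OF assms(2), of UNIV]]) (auto intro!: continuous_intros)

lemma has_vector_derivative_dilation_average:
  assumes "continuous_on {0..1} \<kappa>" "smooth_on UNIV R"
  shows "(dilation_average \<kappa> R has_vector_derivative
    dilation_average (\<lambda>s. of_real s * \<kappa> s) (vderiv R) x) (at x)"
proof -
  have "((\<lambda>x. integral (cbox 0 1) (\<lambda>s. \<kappa> s * R (s * x))) has_vector_derivative
      integral (cbox 0 1) (\<lambda>s. \<kappa> s * (of_real s * vderiv R (s * x)))) (at x within UNIV)"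
  proof (rule leibniz_rule_vector_derivative)
    show "((\<lambda>x. \<kappa> s * R (s * x)) has_vector_derivative \<kappa> s * (of_real s * vderiv R (s * x))) (at x within UNIV)"
      for x s by (intro has_vector_derivative_mult_right has_vector_derivative_compose_scale assms)
    show "(\<lambda>s. \<kappa> s * R (s * x)) integrable_on cbox 0 1" for x
      using integrable_dilation[OF assms] by simp
    have c: "continuous_on (UNIV \<times> {0..1::real}) (\<lambda>p. \<kappa> (snd p))"
      by (rule continuous_on_compose2[OF assms(1)]) (auto intro!: continuous_intros)
    have d: "continuous_on (UNIV \<times> {0..1::real}) (\<lambda>p. vderiv R (snd p * fst p))"
      by (rule continuous_on_compose2[OF smooth_continuous[OF smooth_on_vderiv[OF assms(2)], of UNIV]])
        (auto intro!: continuous_intros)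
    show "continuous_on (UNIV \<times> cbox 0 1) (\<lambda>(x, s). \<kappa> s * (complex_of_real s * vderiv R (s * x)))"
      unfolding split_beta using c d by (auto intro!: continuous_intros)
  qed auto
  then show ?thesis by (simp add: dilation_average_def[abs_def] mult_ac)
qed

text \<open>The derivative is again such an average, of \<open>vderiv R\<close> with the weight
  multiplied by \<open>s\<close>, so continuity of the weight persists.\<close>

lemma smooth_dilation_average:
  assumes "continuous_on {0..1} \<kappa>" "smooth_on UNIV R"
  shows "smooth_on UNIV (dilation_average \<kappa> R)"
proof (rule smooth_onI)
  show "ck_on n UNIV (dilation_average \<kappa> R)" for n
    using assms
  proof (induction n arbitrary: \<kappa> R)
    case 0
    then show ?case
      using continuous_on_vector_derivative[OF has_vector_derivative_dilation_average] by simp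
  next
    case (Suc n)
    have "continuous_on {0..1} (\<lambda>s. of_real s * \<kappa> s)" by (intro continuous_intros Suc.prems)
    from Suc.IH[OF this smooth_on_vderiv[OF Suc.prems(2)]] show ?case
      by (intro ck_on_SucI[OF has_vector_derivative_dilation_average[OF Suc.prems]])
  qed
qed simp

text \<open>Integrate the derivative of \<open>F (s * x)\<close> with respect to \<open>s\<close>
  over the unit interval.\<close>

lemma hadamard:
  assumes "smooth_on UNIV F"
  obtains G where "smooth_on UNIV G" "\<And>x. F x = F 0 + of_real x * G x"
proof
  show "smooth_on UNIV (dilation_average (\<lambda>s. 1) (vderiv F))"
    by (intro smooth_dilation_average smooth_on_vderiv assms) auto
  fix x
  have d: "((\<lambda>s. F (s * x)) has_vector_derivative of_real x * vderiv F (s * x)) (at s within {0..1})" for s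
    using has_vector_derivative_compose_scale[OF assms, of x s]
    by (simp add: mult.commute has_vector_derivative_at_within)
  have "((\<lambda>s. of_real x * vderiv F (s * x)) has_integral F (1 * x) - F (0 * x)) {0..1}"
    by (rule fundamental_theorem_of_calculus) (auto intro: d)
  from integral_unique[OF this] show "F x = F 0 + of_real x * dilation_average (\<lambda>s. 1) (vderiv F) x"
    by (simp add: dilation_average_def algebra_simps)
qed

lemma taylor_expansion:
  assumes "smooth_on UNIV F"
  obtains a where "\<And>N. \<exists>R. smooth_on UNIV R \<and> (\<forall>x. F x = (\<Sum>n<N. a n * of_real x ^ n) + of_real x ^ N * R x)"
proof -
  \<comment> \<open>A fixed choice of the quotient: the coefficients are the values at 0 of its
    iterates and hence do not depend on the order of the expansion.\<close>
  define Q where "Q F = (SOME G. smooth_on UNIV G \<and> (\<forall>x. F x = F 0 + of_real x * G x))"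
    for F :: "real \<Rightarrow> complex"
  have Q: "smooth_on UNIV (Q F)" "F x = F 0 + of_real x * Q F x" if "smooth_on UNIV F" for F x
  proof -
    have "\<exists>G. smooth_on UNIV G \<and> (\<forall>x. F x = F 0 + of_real x * G x)"
      by (rule hadamard[OF that]) blast
    from someI_ex[OF this] have "smooth_on UNIV (Q F) \<and> (\<forall>x. F x = F 0 + of_real x * Q F x)"
      unfolding Q_def .
    then show "smooth_on UNIV (Q F)" "F x = F 0 + of_real x * Q F x" by blast+
  qed
  have s: "smooth_on UNIV ((Q ^^ N) F)" for N by (induction N) (auto intro: assms Q)
  have "F x = (\<Sum>n<N. (Q ^^ n) F 0 * of_real x ^ n) + of_real x ^ N * (Q ^^ N) F x" for N x
  proof (induction N)
    case (Suc N)
    have "(Q ^^ N) F x = (Q ^^ N) F 0 + of_real x * (Q ^^ Suc N) F x"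
      using Q(2)[OF s[of N], of x] by simp
    then show ?case unfolding Suc by (simp add: algebra_simps)
  qed simp
  then have "\<exists>R. smooth_on UNIV R \<and> (\<forall>x. F x = (\<Sum>n<N. (Q ^^ n) F 0 * of_real x ^ n) + of_real x ^ N * R x)" for N
    by (intro exI[of _ "(Q ^^ N) F"] conjI s) blast
  then show ?thesis by (rule that)
qed

text \<open>Both parities occur because an Euler equation is solved independently on the two half
  lines. The remainder \<open>w\<close> is smooth across the origin, and equality is required off 0
  only.\<close>

definition log_expansion :: "complex \<Rightarrow> nat \<Rightarrow> (real \<Rightarrow> complex) \<Rightarrow> bool" where
  "log_expansion \<mu> K u \<longleftrightarrow> (\<exists>c w. smooth_on UNIV w \<and>
     (\<forall>x. x \<noteq> 0 \<longrightarrow> u x = (\<Sum>\<eta>\<in>UNIV. \<Sum>i\<le>K. c \<eta> i * sing_term \<eta> \<mu> i (\<lambda>x. 1) x) + w x))"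

lemma UNIV_bit: "(UNIV :: bit set) = {0, 1}"
  using bit.exhaust by auto

lemma finite_UNIV_bit [simp]: "finite (UNIV :: bit set)"
  by (simp add: UNIV_bit)

lemma log_expansion_cong:
  assumes "\<And>x. x \<noteq> 0 \<Longrightarrow> u x = v x" "log_expansion \<mu> K u"
  shows "log_expansion \<mu> K v"
proof -
  obtain c w where "smooth_on UNIV w"
    "\<forall>x. x \<noteq> 0 \<longrightarrow> u x = (\<Sum>\<eta>\<in>UNIV. \<Sum>i\<le>K. c \<eta> i * sing_term \<eta> \<mu> i (\<lambda>x. 1) x) + w x"
    using assms(2) unfolding log_expansion_def by blast
  then show ?thesis
    unfolding log_expansion_def using assms(1) by (intro exI[of _ c] exI[of _ w]) simp
qed

lemma log_expansion_smooth: "smooth_on UNIV w \<Longrightarrow> log_expansion \<mu> K w"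
  unfolding log_expansion_def by (intro exI[of _ "\<lambda>_ _. 0"] exI[of _ w]) simp

lemma log_expansion_term:
  assumes "i \<le> K" shows "log_expansion \<mu> K (\<lambda>x. c * sing_term \<eta> \<mu> i (\<lambda>x. 1) x)"
proof -
  define d where "d = (\<lambda>\<eta>' i'. if \<eta>' = \<eta> then if i' = i then c else 0 else 0)"
  have "(\<Sum>\<eta>'\<in>UNIV. \<Sum>i'\<le>K. d \<eta>' i' * sing_term \<eta>' \<mu> i' (\<lambda>x. 1) x) = c * sing_term \<eta> \<mu> i (\<lambda>x. 1) x" for x
  proof -
    have "(\<Sum>i'\<le>K. d \<eta>' i' * sing_term \<eta>' \<mu> i' (\<lambda>x. 1) x)
      = (if \<eta>' = \<eta> then c * sing_term \<eta> \<mu> i (\<lambda>x. 1) x else 0)" for \<eta>'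
    proof (cases "\<eta>' = \<eta>")
      case True
      then have "(\<Sum>i'\<le>K. d \<eta>' i' * sing_term \<eta>' \<mu> i' (\<lambda>x. 1) x)
        = (\<Sum>i'\<le>K. if i' = i then c * sing_term \<eta> \<mu> i (\<lambda>x. 1) x else 0)"
        by (intro sum.cong) (auto simp: d_def)
      then show ?thesis using True assms by simp
    qed (simp add: d_def)
    then have "(\<Sum>\<eta>'\<in>UNIV. \<Sum>i'\<le>K. d \<eta>' i' * sing_term \<eta>' \<mu> i' (\<lambda>x. 1) x)
      = (\<Sum>\<eta>'\<in>UNIV. if \<eta>' = \<eta> then c * sing_term \<eta> \<mu> i (\<lambda>x. 1) x else 0)" by (rule sum.cong[OF refl])
    also have "\<dots> = c * sing_term \<eta> \<mu> i (\<lambda>x. 1) x"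
      unfolding sum.delta[OF finite_UNIV_bit] by simp
    finally show ?thesis .
  qed
  then show ?thesis
    unfolding log_expansion_def using smooth_const[of 0] by (intro exI[of _ d] exI[of _ "\<lambda>x. 0"]) simp
qed

lemma log_expansion_add:
  assumes "log_expansion \<mu> K u" "log_expansion \<mu> K v"
  shows "log_expansion \<mu> K (\<lambda>x. u x + v x)"
proof -
  obtain c w where 1: "smooth_on UNIV w"
    "\<forall>x. x \<noteq> 0 \<longrightarrow> u x = (\<Sum>\<eta>\<in>UNIV. \<Sum>i\<le>K. c \<eta> i * sing_term \<eta> \<mu> i (\<lambda>x. 1) x) + w x"
    using assms(1) unfolding log_expansion_def by blast
  obtain c' w' where 2: "smooth_on UNIV w'"
    "\<forall>x. x \<noteq> 0 \<longrightarrow> v x = (\<Sum>\<eta>\<in>UNIV. \<Sum>i\<le>K. c' \<eta> i * sing_term \<eta> \<mu> i (\<lambda>x. 1) x) + w' x"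
    using assms(2) unfolding log_expansion_def by blast
  show ?thesis
    unfolding log_expansion_def using 1 2 smooth_add[OF 1(1) 2(1)]
    by (intro exI[of _ "\<lambda>\<eta> i. c \<eta> i + c' \<eta> i"] exI[of _ "\<lambda>x. w x + w' x"])
      (simp add: sum.distrib distrib_right)
qed

lemma log_expansion_sum:
  "(\<And>i. i \<in> I \<Longrightarrow> log_expansion \<mu> K (u i)) \<Longrightarrow> log_expansion \<mu> K (\<lambda>x. \<Sum>i\<in>I. u i x)"
  by (induction I rule: infinite_finite_induct)
    (auto intro: log_expansion_add log_expansion_smooth smooth_const)

lemma log_expansion_scale:
  assumes "log_expansion \<mu> K u" shows "log_expansion \<mu> K (\<lambda>x. a * u x)"
proof -
  obtain c w where 1: "smooth_on UNIV w"
    "\<forall>x. x \<noteq> 0 \<longrightarrow> u x = (\<Sum>\<eta>\<in>UNIV. \<Sum>i\<le>K. c \<eta> i * sing_term \<eta> \<mu> i (\<lambda>x. 1) x) + w x"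
    using assms(1) unfolding log_expansion_def by blast
  show ?thesis
    unfolding log_expansion_def using 1 smooth_mult[OF smooth_const[of a] 1(1)]
    by (intro exI[of _ "\<lambda>\<eta> i. a * c \<eta> i"] exI[of _ "\<lambda>x. a * w x"])
      (simp add: sum_distrib_left distrib_left mult.assoc)
qed

lemma log_expansion_mult_ident:
  assumes "log_expansion (\<mu> - 1) K u" shows "log_expansion \<mu> K (\<lambda>x. of_real x * u x)"
proof -
  obtain c w where 1: "smooth_on UNIV w"
    "\<forall>x. x \<noteq> 0 \<longrightarrow> u x = (\<Sum>\<eta>\<in>UNIV. \<Sum>i\<le>K. c \<eta> i * sing_term \<eta> (\<mu> - 1) i (\<lambda>x. 1) x) + w x"
    using assms(1) unfolding log_expansion_def by blast
  have shift: "of_real x * sing_term \<eta> (\<mu> - 1) i (\<lambda>x. 1) x = sing_term (\<eta> + 1) \<mu> i (\<lambda>x. 1) x" for \<eta> i x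
  proof -
    have "of_real x * sing_term \<eta> (\<mu> - 1) i (\<lambda>x. 1) x = sing_term \<eta> (\<mu> - 1) i (\<lambda>x. of_real x * 1) x"
      by (simp add: sing_term_def)
    then show ?thesis by (simp only: sing_term_mult_ident diff_add_cancel)
  qed
  have "log_expansion \<mu> K (\<lambda>x. (\<Sum>\<eta>\<in>UNIV. \<Sum>i\<le>K. c \<eta> i * sing_term (\<eta> + 1) \<mu> i (\<lambda>x. 1) x) + of_real x * w x)"
    by (intro log_expansion_add log_expansion_sum log_expansion_term log_expansion_smooth smooth_mult
        smooth_of_real 1(1)) auto
  moreover have "(\<Sum>\<eta>\<in>UNIV. \<Sum>i\<le>K. c \<eta> i * sing_term (\<eta> + 1) \<mu> i (\<lambda>x. 1) x) + of_real x * w x = of_real x * u x"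
    if "x \<noteq> 0" for x
  proof -
    have "u x = (\<Sum>\<eta>\<in>UNIV. \<Sum>i\<le>K. c \<eta> i * sing_term \<eta> (\<mu> - 1) i (\<lambda>x. 1) x) + w x"
      using 1(2) that by blast
    then show ?thesis
      by (simp only: distrib_left sum_distrib_left shift [symmetric] mult.left_commute)
  qed
  ultimately show ?thesis by (rule log_expansion_cong[rotated])
qed

section \<open>Solving the Euler equation\<close>

text \<open>\<open>u\<close> solves \<open>(\<theta> - \<mu>) u = v\<close>.\<close>

definition euler_solution :: "complex \<Rightarrow> (real \<Rightarrow> complex) \<Rightarrow> (real \<Rightarrow> complex) \<Rightarrow> bool" where
  "euler_solution \<mu> v u \<longleftrightarrow>
     (\<forall>x. x \<noteq> 0 \<longrightarrow> (u has_vector_derivative (\<mu> * u x + v x) / of_real x) (at x))"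

lemma euler_solution_add:
  assumes "euler_solution \<mu> v u" "euler_solution \<mu> v' u'"
  shows "euler_solution \<mu> (\<lambda>x. v x + v' x) (\<lambda>x. u x + u' x)"
  unfolding euler_solution_def
proof (intro allI impI)
  fix x :: real assume "x \<noteq> 0"
  then have "((\<lambda>x. u x + u' x) has_vector_derivative
      (\<mu> * u x + v x) / of_real x + (\<mu> * u' x + v' x) / of_real x) (at x)"
    using assms unfolding euler_solution_def by (intro has_vector_derivative_add) auto
  then show "((\<lambda>x. u x + u' x) has_vector_derivative (\<mu> * (u x + u' x) + (v x + v' x)) / of_real x) (at x)"
    by (simp add: add_divide_distrib algebra_simps)
qed

lemma euler_solution_scale:
  assumes "euler_solution \<mu> v u" shows "euler_solution \<mu> (\<lambda>x. c * v x) (\<lambda>x. c * u x)"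
  unfolding euler_solution_def
proof (intro allI impI)
  fix x :: real assume "x \<noteq> 0"
  then have "((\<lambda>x. c * u x) has_vector_derivative c * ((\<mu> * u x + v x) / of_real x)) (at x)"
    using assms unfolding euler_solution_def by (intro has_vector_derivative_mult_right) auto
  then show "((\<lambda>x. c * u x) has_vector_derivative (\<mu> * (c * u x) + c * v x) / of_real x) (at x)"
    by (simp add: algebra_simps)
qed

lemma euler_solution_cong:
  "(\<And>x. x \<noteq> 0 \<Longrightarrow> v x = v' x) \<Longrightarrow> euler_solution \<mu> v u \<Longrightarrow> euler_solution \<mu> v' u"
  unfolding euler_solution_def by simp

lemma euler_solution_mult_ident:
  assumes "euler_solution (\<mu> - 1) v u"
  shows "euler_solution \<mu> (\<lambda>x. of_real x * v x) (\<lambda>x. of_real x * u x)"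
  unfolding euler_solution_def
proof (intro allI impI)
  fix x :: real assume x: "x \<noteq> 0"
  then have "((\<lambda>x. of_real x * u x) has_vector_derivative
      of_real x * (((\<mu> - 1) * u x + v x) / of_real x) + 1 * u x) (at x)"
    using assms unfolding euler_solution_def
    by (intro has_vector_derivative_mult has_vector_derivative_complex_of_real) auto
  moreover have "of_real x * (((\<mu> - 1) * u x + v x) / of_real x) + 1 * u x
      = (\<mu> * (of_real x * u x) + of_real x * v x) / of_real x"
    using x by (simp add: field_simps)
  ultimately show "((\<lambda>x. of_real x * u x) has_vector_derivative
      (\<mu> * (of_real x * u x) + of_real x * v x) / of_real x) (at x)" by (simp only:)
qed

lemma euler_solution_sing_term:
  "euler_solution \<mu> (\<lambda>x. of_nat k * sing_term \<eta> \<mu> (k - 1) (\<lambda>x. 1) x) (sing_term \<eta> \<mu> k (\<lambda>x. 1))"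
  unfolding euler_solution_def
proof (intro allI impI)
  fix x :: real assume "x \<noteq> 0"
  have z: "sing_term \<eta> \<mu> k (\<lambda>_. 0) x = 0" by (simp add: sing_term_def)
  from has_vector_derivative_sing_term[OF \<open>x \<noteq> 0\<close> has_vector_derivative_const, of \<eta> \<mu> k 1]
  show "(sing_term \<eta> \<mu> k (\<lambda>x. 1) has_vector_derivative
    (\<mu> * sing_term \<eta> \<mu> k (\<lambda>x. 1) x + of_nat k * sing_term \<eta> \<mu> (k - 1) (\<lambda>x. 1) x) / of_real x) (at x)"
    by (simp add: z)
qed

text \<open>For \<mu> = 0 the constant is resonant and its solution is a logarithm; this is why a
  smooth right-hand side leads to expansions with \<open>K = 1\<close>.\<close>

lemma euler_solution_const:
  "\<exists>u. log_expansion \<mu> 1 u \<and> euler_solution \<mu> (\<lambda>x. c) u"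
proof (cases "\<mu> = 0")
  case True
  have "euler_solution 0 (\<lambda>x. c * (of_nat 1 * sing_term 0 0 (1 - 1) (\<lambda>x. 1) x))
      (\<lambda>x. c * sing_term 0 0 1 (\<lambda>x. 1) x)"
    by (rule euler_solution_scale[OF euler_solution_sing_term])
  then have "euler_solution 0 (\<lambda>x. c) (\<lambda>x. c * sing_term 0 0 1 (\<lambda>x. 1) x)"
    by (rule euler_solution_cong[rotated]) (simp add: sing_term_def sgn_pow_def powr_def)
  then show ?thesis using True log_expansion_term[of 1 1 0 c 0] by auto
next
  case False
  have "euler_solution \<mu> (\<lambda>x. c) (\<lambda>x. - c / \<mu>)"
    using False by (simp add: euler_solution_def)
  then show ?thesis using log_expansion_smooth[OF smooth_const] by blast
qed

lemma continuous_on_of_real_powr: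
  assumes "Re c > 0" shows "continuous_on {0..} (\<lambda>s. complex_of_real s powr c)"
proof -
  have "continuous_on UNIV (sing_term 0 c 0 (\<lambda>x. 1))"
    using ck_on_sing_term_UNIV[OF smooth_const, of 0 c] assms by simp
  then have "continuous_on {0..} (sing_term 0 c 0 (\<lambda>x. 1))" by (rule continuous_on_subset) auto
  then show ?thesis
    by (rule continuous_on_eq) (simp add: sing_term_def sgn_pow_def)
qed

text \<open>Integrating the derivative of \<open>s powr (- \<mu>) * w (s * x)\<close> from 0 to 1
  gives \<open>w x\<close> on one side and \<open>- \<mu> * u x + x * u' x\<close> on the other. The
  bound on \<mu> makes the weight continuous at \<open>s = 0\<close> and removes the boundary term
  there.\<close>

lemma euler_solution_dilation_average:
  assumes "Re \<mu> + 1 < 0" "smooth_on UNIV w"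
  shows "euler_solution \<mu> w (dilation_average (\<lambda>s. of_real s powr (- \<mu> - 1)) w)"
  unfolding euler_solution_def
proof (intro allI impI)
  fix x :: real assume x: "x \<noteq> 0"
  let ?\<kappa> = "\<lambda>s. complex_of_real s powr (- \<mu> - 1)"
  have \<kappa>: "continuous_on {0..1} ?\<kappa>"
    by (rule continuous_on_subset[OF continuous_on_of_real_powr]) (use assms in auto)
  have s\<kappa>: "continuous_on {0..1} (\<lambda>s. of_real s * ?\<kappa> s)" by (intro continuous_intros \<kappa>)
  have cont: "continuous_on {0..1} (\<lambda>s. complex_of_real s powr (- \<mu>) * w (s * x))"
  proof (intro continuous_on_mult)
    show "continuous_on {0..1} (\<lambda>s. complex_of_real s powr (- \<mu>))"
      by (rule continuous_on_subset[OF continuous_on_of_real_powr]) (use assms in auto)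
    show "continuous_on {0..1} (\<lambda>s. w (s * x))"
      by (rule continuous_on_compose2[OF smooth_continuous[OF assms(2), of UNIV]]) (auto intro!: continuous_intros)
  qed
  have deriv: "((\<lambda>s. complex_of_real s powr (- \<mu>) * w (s * x)) has_vector_derivative
      - \<mu> * (?\<kappa> s * w (s * x)) + of_real x * (of_real s * ?\<kappa> s * vderiv w (s * x))) (at s)"
    if s: "s \<in> {0<..<1}" for s
  proof -
    have s0: "s > 0" using s by simp
    have "s \<noteq> 0" using s0 by simp
    from has_vector_derivative_abs_powr[OF this, of "- \<mu>"]
    have "((\<lambda>s. complex_of_real \<bar>s\<bar> powr (- \<mu>)) has_vector_derivative
        - \<mu> * of_real s powr (- \<mu>) / of_real s) (at s)"
      unfolding abs_of_pos[OF s0] .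
    then have p: "((\<lambda>s. complex_of_real s powr (- \<mu>)) has_vector_derivative
        - \<mu> * of_real s powr (- \<mu>) / of_real s) (at s)"
      by (rule has_vector_derivative_transform_within_open[of _ _ _ "{0<..}"]) (use s0 in auto)
    have q: "((\<lambda>s. w (s * x)) has_vector_derivative of_real x * vderiv w (s * x)) (at s)"
      using has_vector_derivative_compose_scale[OF assms(2), of x s] by (simp add: mult.commute)
    have r: "complex_of_real s powr (- \<mu>) = of_real s * ?\<kappa> s"
      using s0 by (simp add: powr_diff)
    have "complex_of_real s powr (- \<mu>) * (of_real x * vderiv w (s * x))
        + - \<mu> * of_real s powr (- \<mu>) / of_real s * w (s * x)
      = - \<mu> * (?\<kappa> s * w (s * x)) + of_real x * (of_real s * ?\<kappa> s * vderiv w (s * x))"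
      unfolding r using s0 by simp
    with has_vector_derivative_mult[OF p q] show ?thesis by (simp only:)
  qed
  let ?I = "\<lambda>s. - \<mu> * (?\<kappa> s * w (s * x)) + of_real x * (of_real s * ?\<kappa> s * vderiv w (s * x))"
  have "(?I has_integral (complex_of_real 1 powr (- \<mu>) * w (1 * x) - complex_of_real 0 powr (- \<mu>) * w (0 * x))) {0..1}"
    by (rule fundamental_theorem_of_calculus_interior[OF _ cont deriv]) auto
  then have "integral {0..1} ?I = w x" by (intro integral_unique) simp
  moreover have "integral {0..1} ?I = - \<mu> * dilation_average ?\<kappa> w x
      + of_real x * dilation_average (\<lambda>s. of_real s * ?\<kappa> s) (vderiv w) x"
  proof -
    have "integral {0..1} ?I = integral {0..1} (\<lambda>s. - \<mu> * (?\<kappa> s * w (s * x)))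
        + integral {0..1} (\<lambda>s. of_real x * (of_real s * ?\<kappa> s * vderiv w (s * x)))"
      by (intro Henstock_Kurzweil_Integration.integral_add integrable_on_mult_right
          integrable_dilation[OF \<kappa> assms(2)] integrable_dilation[OF s\<kappa> smooth_on_vderiv[OF assms(2)]])
    then show ?thesis by (simp only: dilation_average_def integral_mult_right)
  qed
  ultimately have "dilation_average (\<lambda>s. of_real s * ?\<kappa> s) (vderiv w) x
      = (\<mu> * dilation_average ?\<kappa> w x + w x) / of_real x"
    using x by (simp add: field_simps)
  with has_vector_derivative_dilation_average[OF \<kappa> assms(2), of x]
  show "(dilation_average ?\<kappa> w has_vector_derivative (\<mu> * dilation_average ?\<kappa> w x + w x) / of_real x) (at x)"
    by (simp only:)
qed

text \<open>Splitting off the value at \<open>0\<close> and dividing by \<open>x\<close> lowers \<open>\<mu>\<close> by one, until the integral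
  formula for the solution converges.\<close>

lemma euler_solution_smooth:
  assumes "smooth_on UNIV w"
  shows "\<exists>u. log_expansion \<mu> 1 u \<and> euler_solution \<mu> w u"
proof -
  have "\<exists>u. log_expansion \<mu> 1 u \<and> euler_solution \<mu> w u"
    if "Re \<mu> + 1 < real N" "smooth_on UNIV w" for N
    using that
  proof (induction N arbitrary: \<mu> w)
    case 0
    have "smooth_on UNIV (dilation_average (\<lambda>s. of_real s powr (- \<mu> - 1)) w)"
      by (rule smooth_dilation_average[OF continuous_on_subset[OF continuous_on_of_real_powr]])
        (use 0 in auto)
    then show ?case
      using euler_solution_dilation_average[of \<mu> w] 0 log_expansion_smooth by auto
  next
    case (Suc N)
    obtain G where G: "smooth_on UNIV G" "\<And>x. w x = w 0 + of_real x * G x"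
      using hadamard[OF Suc.prems(2)] by blast
    obtain u where u: "log_expansion (\<mu> - 1) 1 u" "euler_solution (\<mu> - 1) G u"
      using Suc.IH[of "\<mu> - 1" G] G(1) Suc.prems(1) by auto
    obtain u0 where u0: "log_expansion \<mu> 1 u0" "euler_solution \<mu> (\<lambda>x. w 0) u0"
      using euler_solution_const by blast
    have "euler_solution \<mu> w (\<lambda>x. u0 x + of_real x * u x)"
      by (rule euler_solution_cong[OF _ euler_solution_add[OF u0(2) euler_solution_mult_ident[OF u(2)]]])
        (simp add: G(2) [symmetric])
    moreover have "log_expansion \<mu> 1 (\<lambda>x. u0 x + of_real x * u x)"
      by (intro log_expansion_add log_expansion_mult_ident u0 u)
    ultimately show ?case by blast
  qed
  moreover obtain N where "Re \<mu> + 1 < real N" using reals_Archimedean2 by blast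
  ultimately show ?thesis using assms by blast
qed

lemma log_expansion_mono:
  assumes "K \<le> L" "log_expansion \<mu> K u" shows "log_expansion \<mu> L u"
proof -
  obtain c w where 1: "smooth_on UNIV w"
    "\<forall>x. x \<noteq> 0 \<longrightarrow> u x = (\<Sum>\<eta>\<in>UNIV. \<Sum>i\<le>K. c \<eta> i * sing_term \<eta> \<mu> i (\<lambda>x. 1) x) + w x"
    using assms(2) unfolding log_expansion_def by blast
  have "log_expansion \<mu> L (\<lambda>x. (\<Sum>\<eta>\<in>UNIV. \<Sum>i\<le>K. c \<eta> i * sing_term \<eta> \<mu> i (\<lambda>x. 1) x) + w x)"
    by (intro log_expansion_add log_expansion_sum log_expansion_term log_expansion_smooth 1(1))
      (use assms(1) in auto)
  then show ?thesis by (rule log_expansion_cong[rotated]) (use 1(2) in simp)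
qed

text \<open>The operator sends the power \<mu> with \<open>i + 1\<close> logarithms to
  \<open>i + 1\<close> times the same power with \<open>i\<close> logarithms, so each logarithmic
  term is solved at the price of one more logarithm.\<close>

lemma euler_solution_exists:
  assumes "log_expansion \<mu> K v"
  shows "\<exists>u. log_expansion \<mu> (Suc K) u \<and> euler_solution \<mu> v u"
proof -
  obtain c w where 1: "smooth_on UNIV w"
    "\<forall>x. x \<noteq> 0 \<longrightarrow> v x = (\<Sum>\<eta>\<in>UNIV. \<Sum>i\<le>K. c \<eta> i * sing_term \<eta> \<mu> i (\<lambda>x. 1) x) + w x"
    using assms unfolding log_expansion_def by blast
  have sum: "\<exists>u. log_expansion \<mu> (Suc K) u \<and> euler_solution \<mu> (\<lambda>x. \<Sum>i\<in>I. g i x) u"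
    if "finite I" "\<And>i. i \<in> I \<Longrightarrow> \<exists>u. log_expansion \<mu> (Suc K) u \<and> euler_solution \<mu> (g i) u"
    for I :: "'i set" and g
    using that
  proof (induction I rule: finite_induct)
    case empty
    have "euler_solution \<mu> (\<lambda>x. 0) (\<lambda>x. 0)" by (simp add: euler_solution_def)
    then show ?case using log_expansion_smooth[OF smooth_const] by auto
  next
    case (insert i I)
    obtain u where u: "log_expansion \<mu> (Suc K) u" "euler_solution \<mu> (g i) u"
      using insert.prems by blast
    obtain u' where "log_expansion \<mu> (Suc K) u'" "euler_solution \<mu> (\<lambda>x. \<Sum>i\<in>I. g i x) u'"
      using insert.IH insert.prems by blast
    with u have "log_expansion \<mu> (Suc K) (\<lambda>x. u x + u' x)"
      "euler_solution \<mu> (\<lambda>x. g i x + (\<Sum>i\<in>I. g i x)) (\<lambda>x. u x + u' x)"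
      by (auto intro: log_expansion_add euler_solution_add)
    then show ?case using insert.hyps by auto
  qed
  have "\<exists>u. log_expansion \<mu> (Suc K) u \<and> euler_solution \<mu> (\<lambda>x. c \<eta> i * sing_term \<eta> \<mu> i (\<lambda>x. 1) x) u"
    if i: "i \<le> K" for \<eta> i
  proof -
    have "euler_solution \<mu> (\<lambda>x. c \<eta> i / of_nat (Suc i) * (of_nat (Suc i) * sing_term \<eta> \<mu> (Suc i - 1) (\<lambda>x. 1) x))
        (\<lambda>x. c \<eta> i / of_nat (Suc i) * sing_term \<eta> \<mu> (Suc i) (\<lambda>x. 1) x)"
      by (rule euler_solution_scale[OF euler_solution_sing_term])
    then have "euler_solution \<mu> (\<lambda>x. c \<eta> i * sing_term \<eta> \<mu> i (\<lambda>x. 1) x)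
        (\<lambda>x. c \<eta> i / of_nat (Suc i) * sing_term \<eta> \<mu> (Suc i) (\<lambda>x. 1) x)"
      by (simp del: of_nat_Suc)
    moreover have "log_expansion \<mu> (Suc K) (\<lambda>x. c \<eta> i / of_nat (Suc i) * sing_term \<eta> \<mu> (Suc i) (\<lambda>x. 1) x)"
      using i by (intro log_expansion_term) auto
    ultimately show ?thesis by blast
  qed
  then have "\<exists>u. log_expansion \<mu> (Suc K) u \<and>
      euler_solution \<mu> (\<lambda>x. \<Sum>\<eta>\<in>UNIV. \<Sum>i\<le>K. c \<eta> i * sing_term \<eta> \<mu> i (\<lambda>x. 1) x) u"
    by (intro sum) auto
  then obtain u where u: "log_expansion \<mu> (Suc K) u"
    "euler_solution \<mu> (\<lambda>x. \<Sum>\<eta>\<in>UNIV. \<Sum>i\<le>K. c \<eta> i * sing_term \<eta> \<mu> i (\<lambda>x. 1) x) u" by blast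
  obtain u' where u': "log_expansion \<mu> 1 u'" "euler_solution \<mu> w u'"
    using euler_solution_smooth[OF 1(1)] by blast
  have "log_expansion \<mu> (Suc K) (\<lambda>x. u x + u' x)"
    by (intro log_expansion_add u log_expansion_mono[OF _ u'(1)]) simp
  moreover have "euler_solution \<mu> v (\<lambda>x. u x + u' x)"
    by (rule euler_solution_cong[OF _ euler_solution_add[OF u(2) u'(2)]]) (use 1(2) in simp)
  ultimately show ?thesis by blast
qed

text \<open>The punctured line has two components and hence two constants; writing them as an even
  and an odd part matches the two parities.\<close>

lemma zero_derivative_constant:
  fixes z :: "real \<Rightarrow> complex"
  assumes "\<And>x. x \<noteq> 0 \<Longrightarrow> (z has_vector_derivative 0) (at x)"
  obtains a b where "\<And>x. x \<noteq> 0 \<Longrightarrow> z x = a + b * sgn_pow 1 x"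
proof -
  have const: "\<exists>c. \<forall>x\<in>S. z x = c" if "convex S" "0 \<notin> S" for S
  proof (rule has_vector_derivative_zero_constant[OF that(1)])
    show "(z has_vector_derivative 0) (at x within S)" if "x \<in> S" for x
      using assms[of x] that \<open>0 \<notin> S\<close> has_vector_derivative_at_within by blast
  qed blast
  obtain p where p: "\<forall>x\<in>{0<..}. z x = p" using const[of "{0<..}"] by auto
  obtain q where q: "\<forall>x\<in>{..<0}. z x = q" using const[of "{..<0}"] by auto
  have "z x = (p + q) / 2 + (p - q) / 2 * sgn_pow 1 x" if "x \<noteq> 0" for x
  proof (cases "x > 0")
    case True
    then show ?thesis using p by (simp add: sgn_pow_def field_simps)
  next
    case False
    then show ?thesis using q that by (simp add: sgn_pow_def field_simps)
  qed
  then show ?thesis using that by blast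
qed

text \<open>The integrating factor is the power \<open>- \<mu>\<close> of
  \<open>|x|\<close>.\<close>

lemma log_expansion_euler_homogeneous:
  assumes "euler_solution \<mu> (\<lambda>x. 0) u" shows "log_expansion \<mu> K u"
proof -
  let ?z = "\<lambda>x. of_real \<bar>x\<bar> powr (- \<mu>) * u x"
  have "(?z has_vector_derivative 0) (at x)" if x: "x \<noteq> 0" for x
  proof -
    have "(u has_vector_derivative (\<mu> * u x + 0) / of_real x) (at x)"
      using assms x unfolding euler_solution_def by blast
    from has_vector_derivative_mult[OF has_vector_derivative_abs_powr[OF x, of "- \<mu>"] this]
    show ?thesis by simp
  qed
  then obtain a b where ab: "\<And>x. x \<noteq> 0 \<Longrightarrow> ?z x = a + b * sgn_pow 1 x"
    using zero_derivative_constant[of ?z] by blast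
  have u: "u x = a * sing_term 0 \<mu> 0 (\<lambda>x. 1) x + b * sing_term 1 \<mu> 0 (\<lambda>x. 1) x" if x: "x \<noteq> 0" for x
  proof -
    have "u x = of_real \<bar>x\<bar> powr \<mu> * ?z x" using x by (simp add: powr_minus)
    then show ?thesis unfolding ab[OF x] by (simp add: sing_term_def sgn_pow_def algebra_simps)
  qed
  have "log_expansion \<mu> K (\<lambda>x. a * sing_term 0 \<mu> 0 (\<lambda>x. 1) x + b * sing_term 1 \<mu> 0 (\<lambda>x. 1) x)"
    by (intro log_expansion_add log_expansion_term) auto
  from log_expansion_cong[OF _ this] show ?thesis using u by simp
qed

text \<open>The form of an unknown solution is obtained without computing it: it differs from a
  constructed solution by a homogeneous one. The transform of a cutoff monomial is treated in this
  way.\<close>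

lemma log_expansion_euler_solution:
  assumes "log_expansion \<mu> K v" "euler_solution \<mu> v u"
  shows "log_expansion \<mu> (Suc K) u"
proof -
  obtain u' where u': "log_expansion \<mu> (Suc K) u'" "euler_solution \<mu> v u'"
    using euler_solution_exists[OF assms(1)] by blast
  have "euler_solution \<mu> (\<lambda>x. v x + (-1) * v x) (\<lambda>x. u x + (-1) * u' x)"
    by (intro euler_solution_add euler_solution_scale assms(2) u'(2))
  then have "log_expansion \<mu> (Suc K) (\<lambda>x. u x + (-1) * u' x)"
    by (intro log_expansion_euler_homogeneous) simp
  from log_expansion_add[OF this u'(1)] show ?thesis by simp
qed

section \<open>Borel's lemma\<close>

lemma vderiv_pow_compose_scale:
  assumes "smooth_on UNIV F"
  shows "(vderiv ^^ j) (\<lambda>x. F (c * x)) x = of_real c ^ j * (vderiv ^^ j) F (c * x)"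
proof (induction j arbitrary: x)
  case (Suc j)
  have s: "smooth_on UNIV ((vderiv ^^ j) F)"
    by (induction j) (auto intro: smooth_on_vderiv assms)
  have "(vderiv ^^ j) (\<lambda>x. F (c * x)) = (\<lambda>x. of_real c ^ j * (vderiv ^^ j) F (c * x))"
    using Suc by blast
  moreover have "vderiv (\<lambda>x. of_real c ^ j * (vderiv ^^ j) F (c * x)) x = 
      of_real c ^ j * (of_real c * vderiv ((vderiv ^^ j) F) (c * x))"
    unfolding vderiv_def[of "\<lambda>x. of_real c ^ j * (vderiv ^^ j) F (c * x)"]
    by (intro vector_derivative_at has_vector_derivative_mult_right has_vector_derivative_compose_scale s)
  ultimately show ?case by simp
qed simp

lemma vderiv_pow_scale:
  assumes "smooth_on UNIV F"
  shows "(vderiv ^^ j) (\<lambda>x. a * F x) x = a * (vderiv ^^ j) F x"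
proof (induction j arbitrary: x)
  case (Suc j)
  have s: "smooth_on UNIV ((vderiv ^^ j) F)"
    by (induction j) (auto intro: smooth_on_vderiv assms)
  have "(vderiv ^^ j) (\<lambda>x. a * F x) = (\<lambda>x. a * (vderiv ^^ j) F x)"
    using Suc by blast
  moreover have "((\<lambda>x. a * (vderiv ^^ j) F x) has_vector_derivative a * vderiv ((vderiv ^^ j) F) x) (at x)"
    by (intro has_vector_derivative_mult_right smooth_on_has_vderiv[OF s UNIV_I])
  ultimately show ?case
    by (simp add: vderiv_def[of "\<lambda>x. a * (vderiv ^^ j) F x"] vector_derivative_at)
qed simp

text \<open>Termwise differentiation with uniform convergence of each differentiated series. The
  bounds are required only from some index on, which may depend on \<open>j\<close>: in the
  construction below the derivative of order \<open>j\<close> is controlled for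
  \<open>n > j\<close>.\<close>

lemma ck_on_suminf:
  assumes "\<And>n. smooth_on UNIV (b n)"
    and "\<And>j. \<exists>M. summable M \<and> (\<forall>\<^sub>F n in sequentially. \<forall>x. norm ((vderiv ^^ j) (b n) x) \<le> M n)"
  shows "ck_on m UNIV (\<lambda>x. \<Sum>n. b n x)"
  using assms
proof (induction m arbitrary: b)
  case (Suc m)
  have smooth': "smooth_on UNIV (vderiv (b n))" for n
    by (intro smooth_on_vderiv Suc.prems)
  have bound': "\<exists>M. summable M \<and> (\<forall>\<^sub>F n in sequentially. \<forall>x. norm ((vderiv ^^ j) (vderiv (b n)) x) \<le> M n)" for j
    using Suc.prems(2)[of "Suc j"] by (simp add: funpow_Suc_right del: funpow.simps)
  obtain M0 where M0: "summable M0" "\<forall>\<^sub>F n in sequentially. \<forall>x. norm (b n x) \<le> M0 n"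
    using Suc.prems(2)[of 0] by auto
  obtain M1 where M1: "summable M1" "\<forall>\<^sub>F n in sequentially. \<forall>x. norm (vderiv (b n) x) \<le> M1 n"
    using bound'[of 0] by auto
  let ?g = "\<lambda>x. \<Sum>n. vderiv (b n) x"
  have lim: "uniform_limit UNIV (\<lambda>n x. \<Sum>i<n. vderiv (b i) x) ?g sequentially"
    by (rule Weierstrass_m_test_ev[OF _ M1(1)]) (use M1(2) in simp)
  have sums: "(\<lambda>n. b n x) sums (\<Sum>n. b n x)" for x
    by (intro summable_sums summable_comparison_test_ev[OF _ M0(1)] eventually_mono[OF M0(2)]) auto
  have "\<exists>g. \<forall>x\<in>UNIV. (\<lambda>n. b n x) sums (g x) \<and> (g has_derivative (\<lambda>h. h *\<^sub>R ?g x)) (at x within UNIV)"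
  proof (rule has_derivative_series)
    show "(b n has_derivative (\<lambda>h. h *\<^sub>R vderiv (b n) x)) (at x within UNIV)" for n x
      using smooth_on_has_vderiv[OF Suc.prems(1) UNIV_I] by (simp add: has_vector_derivative_def)
    show "(\<lambda>n. b n 0) sums (\<Sum>n. b n 0)" by (rule sums)
    fix e :: real assume "e > 0"
    from uniform_limitD[OF lim this]
    show "\<forall>\<^sub>F n in sequentially. \<forall>x\<in>UNIV. \<forall>h. norm ((\<Sum>i<n. h *\<^sub>R vderiv (b i) x) - h *\<^sub>R ?g x) \<le> e * norm h"
    proof eventually_elim
      case (elim n)
      show ?case
      proof (intro ballI allI)
        fix x h :: real
        have "(\<Sum>i<n. h *\<^sub>R vderiv (b i) x) - h *\<^sub>R ?g x = h *\<^sub>R ((\<Sum>i<n. vderiv (b i) x) - ?g x)"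
          by (simp add: scaleR_sum_right scaleR_diff_right)
        then have "norm ((\<Sum>i<n. h *\<^sub>R vderiv (b i) x) - h *\<^sub>R ?g x) = \<bar>h\<bar> * dist (\<Sum>i<n. vderiv (b i) x) (?g x)"
          by (simp add: dist_norm)
        also have "\<dots> \<le> \<bar>h\<bar> * e" using elim by (intro mult_left_mono) (auto intro: less_imp_le)
        finally show "norm ((\<Sum>i<n. h *\<^sub>R vderiv (b i) x) - h *\<^sub>R ?g x) \<le> e * norm h"
          by (simp add: mult.commute)
      qed
    qed
  qed auto
  then obtain g where g: "\<And>x. (\<lambda>n. b n x) sums (g x)" "\<And>x. (g has_vector_derivative ?g x) (at x)"
    unfolding has_vector_derivative_def by auto
  have "(\<Sum>n. b n x) = g x" for x using sums_unique[OF g(1)] by simp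
  then have "((\<lambda>x. \<Sum>n. b n x) has_vector_derivative ?g x) (at x)" for x
    using g(2) by simp
  then show ?case by (rule ck_on_SucI[OF _ Suc.IH[OF smooth' bound']])
next
  case 0
  obtain M where M: "summable M" "\<forall>\<^sub>F n in sequentially. \<forall>x. norm (b n x) \<le> M n"
    using 0(2)[of 0] by auto
  have "uniform_limit UNIV (\<lambda>n x. \<Sum>i<n. b i x) (\<lambda>x. \<Sum>n. b n x) sequentially"
    by (rule Weierstrass_m_test_ev[OF _ M(1)]) (use M(2) in simp)
  then have "continuous_on UNIV (\<lambda>x. \<Sum>n. b n x)"
    by (rule uniform_limit_theorem[rotated])
      (auto intro!: always_eventually smooth_continuous smooth_sum 0)
  then show ?case by simp
qed

lemma bounded_vderiv_pow:
  assumes "compactly_supported_smooth F"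
  obtains B where "B \<ge> 0" "\<And>x. norm ((vderiv ^^ j) F x) \<le> B"
proof -
  obtain \<rho> where \<rho>: "\<rho> > 0" "\<And>x. \<bar>x\<bar> > \<rho> \<Longrightarrow> F x = 0" and F: "smooth_on UNIV F"
    using assms unfolding compactly_supported_smooth_def by blast
  have s: "smooth_on UNIV ((vderiv ^^ j) F)"
    by (induction j) (auto intro: smooth_on_vderiv F)
  have zero: "(vderiv ^^ j) F x = 0" if "\<bar>x\<bar> > \<rho>" for x
  proof -
    have "(vderiv ^^ j) F x = (vderiv ^^ j) (\<lambda>x. 0 * F x) x"
      by (rule vderiv_pow_cong[of "{x. \<bar>x\<bar> > \<rho>}"])
        (use \<rho> that in \<open>auto intro!: open_Collect_less continuous_intros\<close>)
    then show ?thesis using vderiv_pow_scale[OF F, of j 0 x] by simp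
  qed
  have "compact ((vderiv ^^ j) F ` {-\<rho>..\<rho>})"
    by (intro compact_continuous_image smooth_continuous s) auto
  from compact_imp_bounded[OF this] obtain B where B: "\<forall>y \<in> (vderiv ^^ j) F ` {-\<rho>..\<rho>}. norm y \<le> B"
    unfolding bounded_iff by blast
  have "norm ((vderiv ^^ j) F x) \<le> \<bar>B\<bar>" for x
  proof (cases "\<bar>x\<bar> > \<rho>")
    case False
    then have "x \<in> {-\<rho>..\<rho>}" by auto
    then have "norm ((vderiv ^^ j) F x) \<le> B" using B by blast
    then show ?thesis by linarith
  qed (simp add: zero)
  then show ?thesis using that[of "\<bar>B\<bar>"] by simp
qed

lemma smooth_divide_power:
  assumes F: "smooth_on UNIV F" and e: "e > 0" "\<And>x. \<bar>x\<bar> < e \<Longrightarrow> F x = 0"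
  shows "smooth_on UNIV (\<lambda>x. F x / of_real x ^ N)" "F x = of_real x ^ N * (F x / of_real x ^ N)"
proof -
  show "smooth_on UNIV (\<lambda>x. F x / of_real x ^ N)"
  proof (rule smooth_onI)
    fix n
    show "ck_on n UNIV (\<lambda>x. F x / of_real x ^ N)"
    proof (rule ck_on_open_cover)
      fix x :: real
      show "\<exists>V. x \<in> V \<and> open V \<and> ck_on n V (\<lambda>x. F x / of_real x ^ N)"
      proof (cases "x = 0")
        case True
        have "ck_on n {-e<..<e} (\<lambda>x. F x / of_real x ^ N)"
          by (rule ck_on_cong[OF _ _ ck_on_const[of _ _ 0]]) (use e in auto)
        then show ?thesis using True e by (intro exI[of _ "{-e<..<e}"]) auto
      next
        case False
        have "ck_on n (- {0}) (\<lambda>x. F x / of_real x ^ N)"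
          by (intro ck_on_divide ck_on_power ck_on_of_real smooth_on_imp_ck_on smooth_on_subset[OF _ F]) auto
        then show ?thesis using False by (intro exI[of _ "- {0}"]) auto
      qed
    qed
  qed simp
  show "F x = of_real x ^ N * (F x / of_real x ^ N)"
    using e by (cases "x = 0") auto
qed

text \<open>The scales \<open>c\<close> of the cutoffs serve all the tails of the series, divided by \<open>x\<^sup>N\<close>, at once;
  hence they dominate all derivatives of order \<open>\<le> m\<close> of all \<open>x\<^sup>p \<chi>\<close> with \<open>p \<le> m\<close>.\<close>

lemma borel:
  fixes a :: "nat \<Rightarrow> complex"
  obtains H where "smooth_on UNIV H"
    "\<And>N. \<exists>R. smooth_on UNIV R \<and> (\<forall>x. H x = (\<Sum>n<N. a n * of_real x ^ n) + of_real x ^ N * R x)"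
proof -
  define \<phi> where "\<phi> = (\<lambda>n x. of_real x ^ n * complex_of_real (cutoff x))"
  have \<phi>: "compactly_supported_smooth (\<phi> n)" for n
    unfolding \<phi>_def
    by (intro compactly_supported_smooth_mult compactly_supported_smooth_cutoff smooth_power smooth_of_real)
  have \<phi>s: "smooth_on UNIV (\<phi> n)" for n
    using \<phi> unfolding compactly_supported_smooth_def by blast
  obtain B where B: "\<And>n j. B n j \<ge> 0" "\<And>n j x. norm ((vderiv ^^ j) (\<phi> n) x) \<le> B n j"
  proof -
    have "\<exists>B\<ge>0. \<forall>x. norm ((vderiv ^^ j) (\<phi> n) x) \<le> B" for n j
      by (rule bounded_vderiv_pow[OF \<phi>[of n], of j]) blast
    then have "\<forall>n j. \<exists>B. B \<ge> 0 \<and> (\<forall>x. norm ((vderiv ^^ j) (\<phi> n) x) \<le> B)" by blast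
    then obtain B where "\<forall>n j. B n j \<ge> 0 \<and> (\<forall>x. norm ((vderiv ^^ j) (\<phi> n) x) \<le> B n j)"
      unfolding choice_iff by blast
    then show ?thesis using that[of B] by blast
  qed
  \<comment> \<open>The sum is one bound for all \<open>B n j\<close> with \<open>n\<close> and
    \<open>j\<close> up to \<open>m\<close>.\<close>
  define Bs where "Bs = (\<lambda>m. \<Sum>n\<le>m. \<Sum>j\<le>m. B n j)"
  have Bs: "B n j \<le> Bs m" if "n \<le> m" "j \<le> m" for n j m
  proof -
    have "B n j \<le> (\<Sum>j\<le>m. B n j)" using that B by (intro member_le_sum) auto
    also have "\<dots> \<le> Bs m" unfolding Bs_def using that B by (intro member_le_sum sum_nonneg) auto
    finally show ?thesis .
  qed
  have Bs0: "Bs m \<ge> 0" for m using order.trans[OF B(1) Bs[of 0 m 0]] by simp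
  \<comment> \<open>The factor \<open>2 ^ m\<close> yields a geometric majorant, and the summand 1
    keeps every scale at least 1.\<close>
  define c where "c = (\<lambda>m. 2 ^ m * (1 + norm (a m) * Bs m))"
  have c1: "c m \<ge> 1" for m
  proof -
    have "1 * 1 \<le> (2::real) ^ m * (1 + norm (a m) * Bs m)"
      using Bs0[of m] by (intro mult_mono) auto
    then show ?thesis by (simp add: c_def)
  qed
  have c2: "norm (a m) * Bs m / c m \<le> (1 / 2) ^ m" for m
  proof -
    have "norm (a m) * Bs m \<le> 1 + norm (a m) * Bs m" by simp
    then have "norm (a m) * Bs m / c m \<le> (1 + norm (a m) * Bs m) / c m"
      using c1[of m] by (intro divide_right_mono) auto
    also have "\<dots> = (1 / 2) ^ m"
      using Bs0[of m] by (simp add: c_def power_divide add_pos_nonneg add_nonneg_eq_0_iff)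
    finally show ?thesis .
  qed
  \<comment> \<open>The terms of the tail from index \<open>N\<close> on, divided by
    \<open>x ^ N\<close>; the cutoff retains the scale of the original index
    \<open>n + N\<close>.\<close>
  define b where "b = (\<lambda>N n x. a (n + N) * (of_real x ^ n * complex_of_real (cutoff (c (n + N) * x))))"
  have b_eq: "b N n = (\<lambda>x. (a (n + N) / of_real (c (n + N)) ^ n) * \<phi> n (c (n + N) * x))" for N n
  proof
    fix x
    have "c (n + N) \<noteq> 0" using c1[of "n + N"] by auto
    then show "b N n x = (a (n + N) / of_real (c (n + N)) ^ n) * \<phi> n (c (n + N) * x)"
      by (simp add: b_def \<phi>_def power_mult_distrib)
  qed
  have b_smooth: "smooth_on UNIV (b N n)" for N n
    unfolding b_eq by (intro smooth_mult smooth_const smooth_compose_scale \<phi>s)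
  have b_bound: "norm ((vderiv ^^ j) (b N n) x) \<le> (1 / 2) ^ n" if "n > j" for N n j x
  proof -
    define m where "m = n + N"
    have m: "c m \<ge> 1" "n \<le> m" "j \<le> m" using c1 that by (auto simp: m_def)
    have "(vderiv ^^ j) (b N n) x = (a m / of_real (c m) ^ n) * (of_real (c m) ^ j * (vderiv ^^ j) (\<phi> n) (c m * x))"
      unfolding b_eq m_def[symmetric]
      by (simp only: vderiv_pow_scale[OF smooth_compose_scale[OF \<phi>s]] vderiv_pow_compose_scale[OF \<phi>s])
    then have "norm ((vderiv ^^ j) (b N n) x)
        = norm (a m) * norm ((vderiv ^^ j) (\<phi> n) (c m * x)) * (c m ^ j / c m ^ n)"
      using m(1) by (simp add: norm_mult norm_divide norm_power)
    also have "c m ^ j / c m ^ n \<le> 1 / c m"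
    proof -
      have "c m ^ Suc j \<le> c m ^ n" using m(1) that by (intro power_increasing) auto
      then show ?thesis using m(1) by (simp add: field_simps)
    qed
    then have "norm (a m) * norm ((vderiv ^^ j) (\<phi> n) (c m * x)) * (c m ^ j / c m ^ n)
        \<le> norm (a m) * Bs m * (1 / c m)"
      using m order.trans[OF B(2) Bs[OF m(2,3)]] Bs0[of m] by (intro mult_mono mult_left_mono) auto
    also have "\<dots> \<le> (1 / 2) ^ m" using c2[of m] by simp
    also have "\<dots> \<le> (1 / 2) ^ n" using m(2) by (intro power_decreasing) auto
    finally show ?thesis .
  qed
  have R_bound: "\<exists>M. summable M \<and> (\<forall>\<^sub>F n in sequentially. \<forall>x. norm ((vderiv ^^ j) (b N n) x) \<le> M n)" for j N
  proof (intro exI[of _ "\<lambda>n. (1 / 2) ^ n"] conjI)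
    show "summable (\<lambda>n. (1 / 2 :: real) ^ n)" by (rule summable_geometric) simp
    show "\<forall>\<^sub>F n in sequentially. \<forall>x. norm ((vderiv ^^ j) (b N n) x) \<le> (1 / 2) ^ n"
      using eventually_gt_at_top[of j] by eventually_elim (use b_bound in blast)
  qed
  define R where "R = (\<lambda>N x. \<Sum>n. b N n x)"
  have R_smooth: "smooth_on UNIV (R N)" for N
    unfolding R_def by (intro smooth_onI ck_on_suminf b_smooth R_bound) simp
  have b_summable: "summable (\<lambda>n. b N n x)" for N x
  proof (rule summable_comparison_test_ev)
    show "\<forall>\<^sub>F n in sequentially. norm (b N n x) \<le> (1 / 2) ^ n"
      using eventually_gt_at_top[of 0] by eventually_elim (use b_bound[of 0] in auto)
    show "summable (\<lambda>n. (1 / 2 :: real) ^ n)" by (rule summable_geometric) simp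
  qed
  have "\<exists>S. smooth_on UNIV S \<and> (\<forall>x. R 0 x = (\<Sum>n<N. a n * of_real x ^ n) + of_real x ^ N * S x)" for N
  proof -
    have split: "R 0 x = (\<Sum>n<N. b 0 n x) + of_real x ^ N * R N x" for x
    proof -
      have "R 0 x = (\<Sum>n. b 0 (n + N) x) + (\<Sum>n<N. b 0 n x)"
        unfolding R_def by (rule suminf_split_initial_segment[OF b_summable])
      also have "(\<Sum>n. b 0 (n + N) x) = (\<Sum>n. of_real x ^ N * b N n x)"
        by (simp add: b_def power_add mult_ac)
      also have "\<dots> = of_real x ^ N * R N x"
        unfolding R_def by (rule suminf_mult[OF b_summable])
      finally show ?thesis by simp
    qed
    \<comment> \<open>A term of the series coincides with its monomial near 0, so the difference is
      smoothly divisible by every power of \<open>x\<close>.\<close>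
    have "\<exists>G. smooth_on UNIV G \<and> (\<forall>x. b 0 n x - a n * of_real x ^ n = of_real x ^ N * G x)" for n
    proof -
      have 1: "smooth_on UNIV (\<lambda>x. b 0 n x - a n * of_real x ^ n)"
        by (intro smooth_diff b_smooth smooth_mult smooth_const smooth_power smooth_of_real)
      have 2: "1 / c n > 0" using c1[of n] by simp
      have 3: "b 0 n x - a n * of_real x ^ n = 0" if "\<bar>x\<bar> < 1 / c n" for x
      proof -
        have "\<bar>c n * x\<bar> \<le> 1" using that c1[of n] by (simp add: abs_mult field_simps)
        then show ?thesis by (simp add: b_def cutoff_eq_1)
      qed
      show ?thesis
        by (intro exI[of _ "\<lambda>x. (b 0 n x - a n * of_real x ^ n) / of_real x ^ N"] conjI allI
            smooth_divide_power[OF 1 2 3])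
    qed
    then obtain G where G: "\<And>n. smooth_on UNIV (G n)"
      "\<And>n x. b 0 n x - a n * of_real x ^ n = of_real x ^ N * G n x" by metis
    have "R 0 x = (\<Sum>n<N. a n * of_real x ^ n) + of_real x ^ N * ((\<Sum>n<N. G n x) + R N x)" for x
    proof -
      have "(\<Sum>n<N. b 0 n x) = (\<Sum>n<N. a n * of_real x ^ n + of_real x ^ N * G n x)"
        by (intro sum.cong refl) (simp add: G(2) [symmetric])
      then show ?thesis
        unfolding split by (simp add: sum.distrib sum_distrib_left distrib_left)
    qed
    moreover have "smooth_on UNIV (\<lambda>x. (\<Sum>n<N. G n x) + R N x)"
      by (intro smooth_add smooth_sum G R_smooth)
    ultimately show ?thesis by blast
  qed
  then show ?thesis using that[OF R_smooth[of 0]] by blast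
qed

section \<open>Singularities of the transform at the origin\<close>

lemma smooth_on_T_int:
  assumes "\<And>b. conormal b f" shows "smooth_on UNIV (T_int \<alpha> \<eta> f)"
proof (rule smooth_onI)
  show "ck_on n UNIV (T_int \<alpha> \<eta> f)" for n
    by (rule ck_on_T_int[OF assms[of "2 + real n - Re \<alpha>"]]) simp
qed simp

lemma conormal_0: "conormal a (\<lambda>x. 0)"
  using conormal_sing_sum[OF sing_sum_0] .

lemma conormal_sum:
  "(\<And>i. i \<in> I \<Longrightarrow> conormal a (f i)) \<Longrightarrow> conormal a (\<lambda>x. \<Sum>i\<in>I. f i x)"
  by (induction I rule: infinite_finite_induct) (auto intro: conormal_0 conormal_add)

lemma T_int_sum:
  assumes "a + Re \<alpha> \<ge> 1" "\<And>i. i \<in> I \<Longrightarrow> conormal a (f i)"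
  shows "T_int \<alpha> \<eta> (\<lambda>x. \<Sum>i\<in>I. f i x) y = (\<Sum>i\<in>I. T_int \<alpha> \<eta> (f i) y)"
  using assms(2)
proof (induction I rule: infinite_finite_induct)
  case (insert i I)
  have "T_int \<alpha> \<eta> (\<lambda>x. f i x + (\<Sum>i\<in>I. f i x)) y = T_int \<alpha> \<eta> (f i) y + T_int \<alpha> \<eta> (\<lambda>x. \<Sum>i\<in>I. f i x) y"
    by (rule T_int_add[OF _ _ assms(1)]) (auto intro: insert.prems conormal_sum)
  then show ?case using insert by simp
qed (use T_int_scale[of \<alpha> \<eta> 0] in auto)

text \<open>The power of an Euler operator is resolved into first-order equations, one for each
  power of the logarithm. The right-hand side for \<open>k\<close> consists of the transform for
  \<open>k - 1\<close> and that of an error containing \<open>theta\<close> of the cutoff. The error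
  vanishes near 0, so its transform is smooth.\<close>

lemma log_expansion_T_int_cutoff:
  assumes "a < Re \<beta>" "a + Re \<alpha> \<ge> 2"
  shows "log_expansion (\<alpha> + \<beta>) (Suc k) (T_int \<alpha> \<eta> (sing_term \<eta>' \<beta> k (\<lambda>x. of_real (cutoff x))))"
proof -
  let ?\<chi> = "\<lambda>x. complex_of_real (cutoff x)"
  let ?S = "\<lambda>k. sing_term \<eta>' \<beta> k ?\<chi>"
  let ?E = "\<lambda>k. sing_term \<eta>' \<beta> k (theta ?\<chi>)"
  have con: "conormal a (?S k)" "conormal a (?E k)" for k
    by (intro conormal_sing_term compactly_supported_smooth_theta compactly_supported_smooth_cutoff assms)+
  have "theta ?\<chi> x = 0" if "0 < \<bar>x\<bar>" "\<bar>x\<bar> < 1" for x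
  proof -
    have "theta ?\<chi> x = theta (\<lambda>x. 1) x"
      using theta_pow_cong[OF open_punctured_interval[of 1], of ?\<chi> "\<lambda>x. 1" x 1] that
      by (auto simp: cutoff_eq_1)
    also have "theta (\<lambda>x. 1) x = 0"
      using thetaI[OF has_vector_derivative_const[of 1 "at x"]] by simp
    finally show ?thesis .
  qed
  then have E: "smooth_on UNIV (T_int \<alpha> \<eta> (?E k))" for k
    by (intro smooth_on_T_int conormal_of_vanishing[OF conormal_imp_decaying[OF con(2)], of 1])
      (auto simp: sing_term_def)
  have sol: "euler_solution (\<alpha> + \<beta>) (\<lambda>y. of_nat k * T_int \<alpha> \<eta> (?S (k - 1)) y + T_int \<alpha> \<eta> (?E k) y) (T_int \<alpha> \<eta> (?S k))" for k
    unfolding euler_solution_def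
  proof (intro allI impI)
    fix y :: real assume y: "y \<noteq> 0"
    have c1: "conormal a (\<lambda>x. (\<alpha> + \<beta>) * ?S k x)" and c2: "conormal a (\<lambda>x. of_nat k * ?S (k - 1) x)"
      by (intro conormal_scale con)+
    have a1: "a + Re \<alpha> \<ge> 1" using assms by simp
    have "(\<lambda>x. theta (?S k) x + \<alpha> * ?S k x) = (\<lambda>x. ((\<alpha> + \<beta>) * ?S k x + of_nat k * ?S (k - 1) x) + ?E k x)"
      unfolding theta_sing_term[OF smooth_cutoff] by (simp add: fun_eq_iff algebra_simps)
    then have "T_int \<alpha> \<eta> (\<lambda>x. theta (?S k) x + \<alpha> * ?S k x) y
      = (\<alpha> + \<beta>) * T_int \<alpha> \<eta> (?S k) y + (of_nat k * T_int \<alpha> \<eta> (?S (k - 1)) y + T_int \<alpha> \<eta> (?E k) y)"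
      by (simp only: T_int_add[OF conormal_add[OF c1 c2] con(2) a1] T_int_add[OF c1 c2 a1] T_int_scale) (simp only: add.assoc)
    with has_vector_derivative_U'[OF con(1) assms(2) y, of \<eta> k]
    show "(T_int \<alpha> \<eta> (?S k) has_vector_derivative ((\<alpha> + \<beta>) * T_int \<alpha> \<eta> (?S k) y
        + (of_nat k * T_int \<alpha> \<eta> (?S (k - 1)) y + T_int \<alpha> \<eta> (?E k) y)) / of_real y) (at y)"
      by (simp only:)
  qed
  show ?thesis
  proof (induction k)
    case 0
    \<comment> \<open>The coefficient \<open>of_nat 0\<close> removes the term with the truncated
      index, and the smooth rest counts as an expansion with \<open>K = 0\<close>.\<close>
    have "log_expansion (\<alpha> + \<beta>) 0 (\<lambda>y. of_nat 0 * T_int \<alpha> \<eta> (?S (0 - 1)) y + T_int \<alpha> \<eta> (?E 0) y)"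
      using log_expansion_smooth[OF E[of 0]] by simp
    from log_expansion_euler_solution[OF this sol] show ?case .
  next
    case (Suc k)
    have "log_expansion (\<alpha> + \<beta>) (Suc k) (\<lambda>y. of_nat (Suc k) * T_int \<alpha> \<eta> (?S (Suc k - 1)) y + T_int \<alpha> \<eta> (?E (Suc k)) y)"
      using Suc by (intro log_expansion_add log_expansion_scale log_expansion_smooth[OF E]) simp
    from log_expansion_euler_solution[OF this sol] show ?case .
  qed
qed

text \<open>Pulling out \<open>x ^ n\<close> and reindexing the parities gives the expansions for
  all \<open>n\<close> the same factor with exponent \<mu>. Their coefficients can then be collected
  into one formal power series for each parity and each power of the logarithm.\<close>

lemma log_expansion_shift:
  assumes "log_expansion (\<mu> + of_nat n) K u"
  obtains c w where "smooth_on UNIV w"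
    "\<And>x. x \<noteq> 0 \<Longrightarrow> u x = (\<Sum>\<eta>\<in>UNIV. \<Sum>i\<le>K. c \<eta> i * sing_term \<eta> \<mu> i (\<lambda>x. of_real x ^ n) x) + w x"
proof -
  obtain c w where 1: "smooth_on UNIV w"
    "\<forall>x. x \<noteq> 0 \<longrightarrow> u x = (\<Sum>\<eta>\<in>UNIV. \<Sum>i\<le>K. c \<eta> i * sing_term \<eta> (\<mu> + of_nat n) i (\<lambda>x. 1) x) + w x"
    using assms unfolding log_expansion_def by blast
  have "bij (\<lambda>\<eta> :: bit. \<eta> + of_nat n)"
    by (rule bij_betw_byWitness[where f'="\<lambda>\<eta>. \<eta> - of_nat n"]) auto
  then have reindex: "(\<Sum>\<eta>\<in>UNIV. g (\<eta> + of_nat n)) = (\<Sum>\<eta>\<in>UNIV. g \<eta>)" for g :: "bit \<Rightarrow> complex"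
    by (rule sum.reindex_bij_betw)
  have "sing_term \<eta> \<mu> i (\<lambda>x. of_real x ^ n) x = sing_term (\<eta> + of_nat n) (\<mu> + of_nat n) i (\<lambda>x. 1) x" for \<eta> i x
    using sing_term_mult_power[of \<eta> \<mu> i n "\<lambda>x. 1" x] by simp
  then have "(\<Sum>\<eta>\<in>UNIV. \<Sum>i\<le>K. c (\<eta> + of_nat n) i * sing_term \<eta> \<mu> i (\<lambda>x. of_real x ^ n) x)
      = (\<Sum>\<eta>\<in>UNIV. \<Sum>i\<le>K. c \<eta> i * sing_term \<eta> (\<mu> + of_nat n) i (\<lambda>x. 1) x)" for x
    using reindex[of "\<lambda>\<eta>. \<Sum>i\<le>K. c \<eta> i * sing_term \<eta> (\<mu> + of_nat n) i (\<lambda>x. 1) x"] by simp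
  then show ?thesis using that[of w "\<lambda>\<eta> i. c (\<eta> + of_nat n) i"] 1 by simp
qed

text \<open>The extensions for different \<open>n\<close> have the same value at 0, namely the limit
  of \<open>d\<close>, and are therefore one and the same function.\<close>

lemma smooth_of_ck_on_off_0:
  assumes "\<And>n. \<exists>r. ck_on n UNIV r \<and> (\<forall>x. x \<noteq> 0 \<longrightarrow> d x = r x)"
  obtains r where "smooth_on UNIV r" "\<And>x. x \<noteq> 0 \<Longrightarrow> d x = r x"
proof -
  obtain r where r: "\<And>n. ck_on n UNIV (r n)" "\<And>n x. x \<noteq> 0 \<Longrightarrow> d x = r n x"
    using assms by metis
  have lim: "(d \<longlongrightarrow> r n 0) (at 0)" for n
  proof -
    have "(r n \<longlongrightarrow> r n 0) (at 0)"
      using ck_on_continuous[OF r(1)[of n]] by (simp add: continuous_on_def)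
    then show ?thesis
      by (rule Lim_transform_eventually) (auto simp: eventually_at_filter r(2)[of _ n])
  qed
  have "r n = r 0" for n
  proof
    show "r n x = r 0 x" for x
      using tendsto_unique[OF _ lim[of n] lim[of 0]] r(2)[of x n] r(2)[of x 0] by (cases "x = 0") auto
  qed
  then have "smooth_on UNIV (r 0)" using r(1) by (intro smooth_onI) (metis open_UNIV)+
  then show ?thesis using that[of "r 0"] r(2) by blast
qed

text \<open>Bare monomials do not decay, so each summand, the remainder included, is given compact
  support; only then can the transform be applied term by term.\<close>

lemma taylor_compactly_supported:
  assumes F: "compactly_supported_smooth F"
  obtains t where "\<And>N. \<exists>R. compactly_supported_smooth R \<and>
    (\<forall>x. F x = (\<Sum>n<N. t n * (of_real x ^ n * of_real (cutoff x))) + of_real x ^ N * R x)"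
proof -
  have Fs: "smooth_on UNIV F" using F by (simp add: compactly_supported_smooth_def)
  obtain \<rho> where \<rho>: "\<rho> > 0" "\<And>x. \<bar>x\<bar> > \<rho> \<Longrightarrow> F x = 0"
    using F unfolding compactly_supported_smooth_def by blast
  obtain t where t: "\<And>N. \<exists>R. smooth_on UNIV R \<and> (\<forall>x. F x = (\<Sum>n<N. t n * of_real x ^ n) + of_real x ^ N * R x)"
    using taylor_expansion[OF Fs] by blast
  have "\<exists>R. compactly_supported_smooth R \<and>
    (\<forall>x. F x = (\<Sum>n<N. t n * (of_real x ^ n * of_real (cutoff x))) + of_real x ^ N * R x)" for N
  proof -
    obtain R where R: "smooth_on UNIV R" "\<And>x. F x = (\<Sum>n<N. t n * of_real x ^ n) + of_real x ^ N * R x"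
      using t by blast
    \<comment> \<open>The part of \<open>F\<close> removed by the cutoff vanishes for
      \<open>|x| < 1\<close>, so it is divisible by \<open>x ^ N\<close> and joins the
      remainder.\<close>
    define G where "G = (\<lambda>x. (1 - of_real (cutoff x)) * F x / of_real x ^ N)"
    have "smooth_on UNIV (\<lambda>x. (1 - of_real (cutoff x)) * F x)"
      by (intro smooth_mult smooth_diff smooth_const smooth_cutoff Fs)
    from smooth_divide_power[OF this zero_less_one, of N]
    have G: "smooth_on UNIV G" "(1 - of_real (cutoff x)) * F x = of_real x ^ N * G x" for x
      unfolding G_def by (simp_all add: cutoff_eq_1)
    have "G x = 0" if "\<bar>x\<bar> > \<rho>" for x
      using G(2)[of x] \<rho>(2)[OF that] \<rho>(1) that by auto
    then have zero: "of_real (cutoff x) * R x + G x = 0" if "\<bar>x\<bar> > max \<rho> 2" for x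
      using that cutoff_eq_0[of x] by simp
    have sm: "smooth_on UNIV (\<lambda>x. of_real (cutoff x) * R x + G x)"
      by (intro smooth_add smooth_mult smooth_cutoff R G)
    have "max \<rho> 2 > 0" by simp
    with sm zero have "compactly_supported_smooth (\<lambda>x. of_real (cutoff x) * R x + G x)"
      unfolding compactly_supported_smooth_def by blast
    moreover have "F x = (\<Sum>n<N. t n * (of_real x ^ n * of_real (cutoff x)))
        + of_real x ^ N * (of_real (cutoff x) * R x + G x)" for x
    proof -
      have "F x = of_real (cutoff x) * F x + (1 - of_real (cutoff x)) * F x" by (simp add: algebra_simps)
      also have "\<dots> = of_real (cutoff x) * ((\<Sum>n<N. t n * of_real x ^ n) + of_real x ^ N * R x) + of_real x ^ N * G x"
        by (simp only: G(2) R(2) [symmetric])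
      also have "\<dots> = (\<Sum>n<N. t n * (of_real x ^ n * of_real (cutoff x)))
          + of_real x ^ N * (of_real (cutoff x) * R x + G x)"
        by (simp add: distrib_left sum_distrib_left mult_ac)
      finally show ?thesis .
    qed
    ultimately show ?thesis by blast
  qed
  then show ?thesis by (rule that)
qed

lemma sing_term_add: "sing_term \<eta> \<beta> k (\<lambda>x. F x + G x) x = sing_term \<eta> \<beta> k F x + sing_term \<eta> \<beta> k G x"
  by (simp add: sing_term_def distrib_left)

lemma sing_term_sum: "sing_term \<eta> \<beta> k (\<lambda>x. \<Sum>i\<in>I. c i * F i x) x = (\<Sum>i\<in>I. c i * sing_term \<eta> \<beta> k (F i) x)"
  by (simp add: sing_term_def sum_distrib_left mult_ac)

text \<open>The remainders of the Taylor expansion of \<open>F\<close> contribute functions of increasing regularity,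
  the monomials contribute log expansions, and Borel's lemma resums the latter.\<close>

lemma singular_at_0_T_int_sing_term:
  assumes F: "compactly_supported_smooth F" and a: "a < Re \<beta>" "a + Re \<alpha> \<ge> 2"
  shows "singular_at_0 (-1) (T_int \<alpha> \<eta> (sing_term \<eta>' \<beta> k F))"
proof -
  let ?\<chi> = "\<lambda>x. complex_of_real (cutoff x)"
  define \<mu> where "\<mu> = \<alpha> + \<beta>"
  define u where "u = (\<lambda>n. T_int \<alpha> \<eta> (sing_term (\<eta>' + of_nat n) (\<beta> + of_nat n) k ?\<chi>))"
  obtain t where t: "\<And>N. \<exists>R. compactly_supported_smooth R \<and>
    (\<forall>x. F x = (\<Sum>n<N. t n * (of_real x ^ n * ?\<chi> x)) + of_real x ^ N * R x)"
    using taylor_compactly_supported[OF F] by blast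
  have expansion: "\<exists>c w. smooth_on UNIV w \<and> (\<forall>x. x \<noteq> 0 \<longrightarrow>
    u n x = (\<Sum>\<delta>\<in>UNIV. \<Sum>i\<le>Suc k. c \<delta> i * sing_term \<delta> \<mu> i (\<lambda>x. of_real x ^ n) x) + w x)" for n
  proof -
    have "log_expansion (\<alpha> + (\<beta> + of_nat n)) (Suc k) (u n)"
      unfolding u_def by (rule log_expansion_T_int_cutoff[of a]) (use a in auto)
    then have "log_expansion (\<mu> + of_nat n) (Suc k) (u n)" by (simp add: \<mu>_def add.assoc)
    then show ?thesis by (rule log_expansion_shift) blast
  qed
  obtain c w where w: "\<And>n. smooth_on UNIV (w n)"
    and u: "\<And>n x. x \<noteq> 0 \<Longrightarrow>
      u n x = (\<Sum>\<delta>\<in>UNIV. \<Sum>i\<le>Suc k. c n \<delta> i * sing_term \<delta> \<mu> i (\<lambda>x. of_real x ^ n) x) + w n x"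
  proof -
    have "\<forall>n. \<exists>c w. smooth_on UNIV w \<and> (\<forall>x. x \<noteq> 0 \<longrightarrow>
      u n x = (\<Sum>\<delta>\<in>UNIV. \<Sum>i\<le>Suc k. c \<delta> i * sing_term \<delta> \<mu> i (\<lambda>x. of_real x ^ n) x) + w x)" by (intro allI expansion)
    then obtain c w where "\<forall>n. smooth_on UNIV (w n) \<and> (\<forall>x. x \<noteq> 0 \<longrightarrow>
      u n x = (\<Sum>\<delta>\<in>UNIV. \<Sum>i\<le>Suc k. c n \<delta> i * sing_term \<delta> \<mu> i (\<lambda>x. of_real x ^ n) x) + w n x)"
      unfolding choice_iff by blast
    then show thesis using that[of w c] by blast
  qed
  \<comment> \<open>One smooth coefficient for each parity and each power of the logarithm, with
    prescribed Taylor coefficients. It is chosen before \<open>N\<close>.\<close>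
  define borel_sum where "borel_sum \<delta> i G \<longleftrightarrow> smooth_on UNIV G \<and> (\<forall>N. \<exists>R. smooth_on UNIV R \<and>
      (\<forall>x. G x = (\<Sum>n<N. t n * c n \<delta> i * of_real x ^ n) + of_real x ^ N * R x))" for \<delta> i G
  have "\<exists>G. borel_sum \<delta> i G" for \<delta> i
    unfolding borel_sum_def by (rule borel[of "\<lambda>n. t n * c n \<delta> i"]) blast
  then obtain H where "\<And>\<delta> i. borel_sum \<delta> i (H \<delta> i)" by metis
  then have H: "smooth_on UNIV (H \<delta> i)" "\<exists>R. smooth_on UNIV R \<and>
      (\<forall>x. H \<delta> i x = (\<Sum>n<N. t n * c n \<delta> i * of_real x ^ n) + of_real x ^ N * R x)" for \<delta> i N
    unfolding borel_sum_def by blast+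
  let ?V = "T_int \<alpha> \<eta> (sing_term \<eta>' \<beta> k F)"
  let ?L = "\<lambda>x. \<Sum>\<delta>\<in>UNIV. \<Sum>i\<le>Suc k. sing_term \<delta> \<mu> i (H \<delta> i) x"
  have "\<exists>r. ck_on N UNIV r \<and> (\<forall>x. x \<noteq> 0 \<longrightarrow> ?V x - ?L x = r x)" for N
  proof -
    obtain R where R: "compactly_supported_smooth R"
      "\<And>x. F x = (\<Sum>n<N. t n * (of_real x ^ n * ?\<chi> x)) + of_real x ^ N * R x"
      using t by blast
    obtain Q where Q: "\<And>\<delta> i. smooth_on UNIV (Q \<delta> i)"
      "\<And>\<delta> i x. H \<delta> i x = (\<Sum>n<N. t n * c n \<delta> i * of_real x ^ n) + of_real x ^ N * Q \<delta> i x"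
    proof -
      define quot where "quot \<delta> i R \<longleftrightarrow> smooth_on UNIV R \<and>
        (\<forall>x. H \<delta> i x = (\<Sum>n<N. t n * c n \<delta> i * of_real x ^ n) + of_real x ^ N * R x)" for \<delta> i R
      have "\<forall>\<delta> i. \<exists>R. quot \<delta> i R" unfolding quot_def using H(2) by blast
      then obtain Q where "\<And>\<delta> i. quot \<delta> i (Q \<delta> i)" by metis
      then show ?thesis using that[of Q] unfolding quot_def by blast
    qed
    \<comment> \<open>The factor \<open>x ^ N\<close> has raised the order to \<open>a + N\<close>,
      enough for a transform of class C^N.\<close>
    let ?rem = "sing_term (\<eta>' + of_nat N) (\<beta> + of_nat N) k R"
    have rem: "conormal (a + real N) ?rem" by (intro conormal_sing_term R) (use a in auto)
    then have rem': "conormal a ?rem" by (rule conormal_mono[rotated]) simp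
    have mon: "conormal a (\<lambda>x. t n * sing_term (\<eta>' + of_nat n) (\<beta> + of_nat n) k ?\<chi> x)" for n
      by (intro conormal_scale conormal_sing_term compactly_supported_smooth_cutoff) (use a in auto)
    have "sing_term \<eta>' \<beta> k F x
        = (\<Sum>n<N. t n * sing_term (\<eta>' + of_nat n) (\<beta> + of_nat n) k ?\<chi> x) + ?rem x" for x
    proof -
      have "sing_term \<eta>' \<beta> k F x
        = sing_term \<eta>' \<beta> k (\<lambda>x. (\<Sum>n<N. t n * (of_real x ^ n * ?\<chi> x)) + of_real x ^ N * R x) x"
        by (simp only: R(2) [symmetric])
      then show ?thesis by (simp only: sing_term_add sing_term_sum sing_term_mult_power)
    qed
    then have "sing_term \<eta>' \<beta> k F
        = (\<lambda>x. (\<Sum>n<N. t n * sing_term (\<eta>' + of_nat n) (\<beta> + of_nat n) k ?\<chi> x) + ?rem x)" by blast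
    then have V: "?V x = (\<Sum>n<N. t n * u n x) + T_int \<alpha> \<eta> ?rem x" for x
    proof -
      assume eq: "sing_term \<eta>' \<beta> k F
        = (\<lambda>x. (\<Sum>n<N. t n * sing_term (\<eta>' + of_nat n) (\<beta> + of_nat n) k ?\<chi> x) + ?rem x)"
      have a1: "a + Re \<alpha> \<ge> 1" using a by simp
      show ?thesis
        unfolding eq T_int_add[OF conormal_sum[OF mon] rem' a1] T_int_sum[OF a1 mon] T_int_scale u_def ..
    qed
    have Lterm: "sing_term \<delta> \<mu> i (H \<delta> i) x = (\<Sum>n<N. t n * c n \<delta> i * sing_term \<delta> \<mu> i (\<lambda>x. of_real x ^ n) x)
        + sing_term (\<delta> + of_nat N) (\<mu> + of_nat N) i (Q \<delta> i) x" for \<delta> i x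
    proof -
      have "sing_term \<delta> \<mu> i (H \<delta> i) x
        = sing_term \<delta> \<mu> i (\<lambda>x. (\<Sum>n<N. t n * c n \<delta> i * of_real x ^ n) + of_real x ^ N * Q \<delta> i x) x"
        by (simp only: Q(2) [symmetric])
      then show ?thesis by (simp only: sing_term_add sing_term_sum sing_term_mult_power)
    qed
    \<comment> \<open>What is left once the singular parts of the first \<open>N\<close> monomials
      cancel against the Taylor polynomials of the coefficients: smooth parts, the transform of the
      remainder, and singular terms whose exponent has real part above \<open>N\<close>.\<close>
    define r where "r = (\<lambda>x. (\<Sum>n<N. t n * w n x) + T_int \<alpha> \<eta> ?rem x
      - (\<Sum>\<delta>\<in>UNIV. \<Sum>i\<le>Suc k. sing_term (\<delta> + of_nat N) (\<mu> + of_nat N) i (Q \<delta> i) x))"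
    have "?V x - ?L x = r x" if x: "x \<noteq> 0" for x
    proof -
      have "(\<Sum>\<delta>\<in>UNIV. \<Sum>i\<le>Suc k. \<Sum>n<N. t n * c n \<delta> i * sing_term \<delta> \<mu> i (\<lambda>x. of_real x ^ n) x)
        = (\<Sum>n<N. \<Sum>\<delta>\<in>UNIV. \<Sum>i\<le>Suc k. t n * c n \<delta> i * sing_term \<delta> \<mu> i (\<lambda>x. of_real x ^ n) x)"
        by (subst (2) sum.swap, subst sum.swap) (intro sum.cong refl sum.swap)
      also have "\<dots> = (\<Sum>n<N. t n * (\<Sum>\<delta>\<in>UNIV. \<Sum>i\<le>Suc k. c n \<delta> i * sing_term \<delta> \<mu> i (\<lambda>x. of_real x ^ n) x))"
        by (simp only: sum_distrib_left mult.assoc)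
      also have "\<dots> = (\<Sum>n<N. t n * (u n x - w n x))" using u[OF x] by simp
      also have "\<dots> = (\<Sum>n<N. t n * u n x) - (\<Sum>n<N. t n * w n x)"
        by (simp only: right_diff_distrib sum_subtractf)
      finally have eq: "(\<Sum>\<delta>\<in>UNIV. \<Sum>i\<le>Suc k. \<Sum>n<N. t n * c n \<delta> i * sing_term \<delta> \<mu> i (\<lambda>x. of_real x ^ n) x)
        = (\<Sum>n<N. t n * u n x) - (\<Sum>n<N. t n * w n x)" .
      show ?thesis
        unfolding r_def V Lterm sum.distrib eq by simp
    qed
    moreover have "ck_on N UNIV r"
    proof -
      have "ck_on N UNIV (T_int \<alpha> \<eta> ?rem)" by (rule ck_on_T_int[OF rem]) (use a in auto)
      moreover have "ck_on N UNIV (sing_term \<delta> (\<mu> + of_nat N) i (Q \<delta>' i))" for \<delta> \<delta>' i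
        by (rule ck_on_sing_term_UNIV[OF Q(1)]) (use a in \<open>simp add: \<mu>_def\<close>)
      ultimately show ?thesis
        unfolding r_def
        by (intro ck_on_diff ck_on_add ck_on_sum ck_on_scale smooth_on_imp_ck_on[OF w])
    qed
    ultimately show ?thesis by blast
  qed
  then obtain r where r: "smooth_on UNIV r" "\<And>x. x \<noteq> 0 \<Longrightarrow> ?V x - ?L x = r x"
    by (rule smooth_of_ck_on_off_0) blast
  have smooth1: "smooth_on {-1<..<1} g" if "smooth_on UNIV g" for g
    by (rule smooth_on_subset[OF subset_UNIV that])
  \<comment> \<open>The smooth part is a singular term of exponent 0, and \<open>Re \<mu>\<close>
    exceeds \<open>a + Re \<alpha>\<close>, which is at least 2. So -1 is a strict lower bound for
    all exponents.\<close>
  have "singular_at_0 (-1) (\<lambda>x. ?L x + sing_term 0 0 0 r x)"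
    by (intro singular_at_0_add singular_at_0_sum singular_at_0_sing_term[of 1] smooth1 H r)
      (use a in \<open>auto simp: \<mu>_def\<close>)
  then show ?thesis
  proof (rule singular_at_0_cong[of 1, rotated 2])
    fix x :: real assume "0 < \<bar>x\<bar>"
    then have "sing_term 0 0 0 r x = r x" by (simp add: sing_term_def sgn_pow_def powr_def)
    then show "?L x + sing_term 0 0 0 r x = ?V x" using r(2)[of x] \<open>0 < \<bar>x\<bar>\<close> by (simp add: algebra_simps)
  qed simp
qed

lemma singular_at_0_T_int_sing_sum:
  assumes "sing_sum a p" "a + Re \<alpha> \<ge> 2" shows "singular_at_0 (-1) (T_int \<alpha> \<eta> p)"
  using assms(1)
proof (induction rule: sing_sum.induct)
  case (sing_sum_term F \<beta> \<eta>' k)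
  then show ?case by (rule singular_at_0_T_int_sing_term[OF _ _ assms(2)])
next
  case (sing_sum_add p q)
  have "T_int \<alpha> \<eta> (\<lambda>x. p x + q x) = (\<lambda>x. T_int \<alpha> \<eta> p x + T_int \<alpha> \<eta> q x)"
    using T_int_add[OF conormal_sing_sum[OF sing_sum_add(1)] conormal_sing_sum[OF sing_sum_add(2)]] assms(2)
    by auto
  then show ?case using singular_at_0_add[OF sing_sum_add.IH] by simp
qed

lemma singular_at_0_smooth:
  assumes "smooth_on UNIV F" shows "singular_at_0 (-1) F"
proof -
  have "singular_at_0 (-1) (sing_term 0 0 0 F)"
    by (rule singular_at_0_sing_term[of 1, OF _ smooth_on_subset[OF subset_UNIV assms]]) auto
  then show ?thesis
    by (rule singular_at_0_cong[of 1, rotated 2]) (auto simp: sing_term_def sgn_pow_def powr_def)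
qed

lemma T_int_in_S_sis:
  assumes f: "decaying f" "singular_at_0 a f" and a: "a + Re \<alpha> \<ge> 2"
  shows "(\<lambda>y. if y = 0 then 0 else T_int \<alpha> \<eta> f y) \<in> S_sis"
proof -
  obtain p f0 where p: "sing_sum a p" and f0: "\<And>b. conormal b f0" and eq: "f = (\<lambda>x. p x + f0 x)"
    using decaying_decompose[OF f] by blast
  have split: "T_int \<alpha> \<eta> f y = T_int \<alpha> \<eta> p y + T_int \<alpha> \<eta> f0 y" for y
    unfolding eq by (rule T_int_add[OF conormal_sing_sum[OF p] f0]) (use a in simp)
  have "singular_at_0 (-1) (\<lambda>y. T_int \<alpha> \<eta> p y + T_int \<alpha> \<eta> f0 y)"
    by (intro singular_at_0_add singular_at_0_T_int_sing_sum[OF p a] singular_at_0_smooth smooth_on_T_int f0)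
  then have "singular_at_0 (-1) (\<lambda>y. if y = 0 then 0 else T_int \<alpha> \<eta> f y)"
    by (rule singular_at_0_cong[of 1, rotated 2]) (simp_all add: split)
  moreover have "decaying (\<lambda>y. if y = 0 then 0 else T_int \<alpha> \<eta> f y)"
    by (rule decaying_T_int[OF conormal_of_singular_at_0[OF f] a])
  ultimately show ?thesis unfolding S_sis_iff by blast
qed

section \<open>Distributions\<close>

lemma test_fun_smooth: "\<phi> \<in> test_fun_punctured \<Longrightarrow> smooth_on UNIV \<phi>"
  by (simp add: test_fun_punctured_def)

lemma test_fun_support:
  assumes "\<phi> \<in> test_fun_punctured"
  obtains e \<rho> where "e > 0" "\<rho> > 0" "\<And>x. \<bar>x\<bar> < e \<Longrightarrow> \<phi> x = 0" "\<And>x. \<bar>x\<bar> > \<rho> \<Longrightarrow> \<phi> x = 0"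
proof -
  obtain K where K: "compact K" "0 \<notin> K" "\<And>x. x \<notin> K \<Longrightarrow> \<phi> x = 0"
    using assms unfolding test_fun_punctured_def by blast
  obtain \<rho> where \<rho>: "\<rho> > 0" "\<And>x. x \<in> K \<Longrightarrow> norm x \<le> \<rho>"
    using compact_imp_bounded[OF K(1)] unfolding bounded_pos by blast
  have "open (- K)" using compact_imp_closed[OF K(1)] by (simp add: open_Compl)
  then obtain e where e: "e > 0" "ball 0 e \<subseteq> - K"
    using K(2) unfolding open_contains_ball by blast
  have "\<phi> x = 0" if "\<bar>x\<bar> < e" for x using e(2) that by (intro K(3)) auto
  moreover have "\<phi> x = 0" if "\<bar>x\<bar> > \<rho>" for x using \<rho>(2)[of x] that by (intro K(3)) auto
  ultimately show ?thesis using that e(1) \<rho>(1) by blast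
qed

lemma test_fun_0: "\<phi> \<in> test_fun_punctured \<Longrightarrow> \<phi> 0 = 0"
  by (auto simp: test_fun_punctured_def)

lemma integrable_compact_support:
  fixes g :: "real \<Rightarrow> complex"
  assumes "compact K" "continuous_on K g" "\<And>x. x \<notin> K \<Longrightarrow> g x = 0"
  shows "integrable lborel g"
proof -
  have "g = (\<lambda>x. indicator K x *\<^sub>R g x)" using assms(3) by (auto simp: indicator_def fun_eq_iff)
  then show ?thesis using borel_integrable_compact[OF assms(1,2)] by simp
qed

lemma integrable_test_fun:
  assumes "\<phi> \<in> test_fun_punctured" shows "integrable lborel \<phi>"
proof -
  obtain \<rho> where "\<rho> > 0" "\<And>x. \<bar>x\<bar> > \<rho> \<Longrightarrow> \<phi> x = 0" using test_fun_support[OF assms] by metis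
  then show ?thesis
    by (intro integrable_compact_support[of "{-\<rho>..\<rho>}"] smooth_continuous test_fun_smooth assms) auto
qed

lemma fourier_multiplication_formula:
  assumes u: "integrable lborel u" and \<phi>: "integrable lborel \<phi>"
  shows "(LINT x|lborel. u x * fourier \<phi> x) = (LINT y|lborel. fourier u y * \<phi> y)"
proof -
  note [measurable] = borel_measurable_integrable[OF u] borel_measurable_integrable[OF \<phi>]
  let ?F = "\<lambda>x y. u x * \<phi> y * fourier_kernel x y"
  have int: "integrable (lborel \<Otimes>\<^sub>M lborel) (case_prod ?F)"
  proof (rule lborel_pair.Fubini_integrable)
    show "case_prod ?F \<in> borel_measurable (lborel \<Otimes>\<^sub>M lborel)"
      unfolding fourier_kernel_def by measurable
    have "(\<lambda>x. LINT y|lborel. norm (case_prod ?F (x, y))) = (\<lambda>x. norm (u x) * (LINT y|lborel. norm (\<phi> y)))"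
      by (simp add: norm_mult)
    then show "integrable lborel (\<lambda>x. LINT y|lborel. norm (case_prod ?F (x, y)))"
      using u by simp
    have "integrable lborel (\<lambda>y. u x * (\<phi> y * fourier_kernel y x))" for x
      by (intro integrable_mult_right integrable_mult_fourier_kernel \<phi>)
    then show "AE x in lborel. integrable lborel (\<lambda>y. case_prod ?F (x, y))"
      by (simp add: fourier_kernel_commute mult.assoc)
  qed
  have "(LINT x|lborel. u x * fourier \<phi> x) = (LINT x|lborel. LINT y|lborel. ?F x y)"
  proof (rule Bochner_Integration.integral_cong[OF refl])
    fix x
    have "(LINT y|lborel. ?F x y) = (LINT y|lborel. u x * (\<phi> y * fourier_kernel y x))"
      by (rule Bochner_Integration.integral_cong[OF refl]) (simp only: fourier_kernel_commute[of x] mult.assoc)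
    then show "u x * fourier \<phi> x = (LINT y|lborel. ?F x y)"
      by (simp add: fourier_eq)
  qed
  also have "\<dots> = (LINT y|lborel. LINT x|lborel. ?F x y)"
    by (rule lborel_pair.Fubini_integral[OF int, symmetric])
  also have "\<dots> = (LINT y|lborel. fourier u y * \<phi> y)"
  proof (rule Bochner_Integration.integral_cong[OF refl])
    fix y
    have "(LINT x|lborel. ?F x y) = (LINT x|lborel. u x * fourier_kernel x y * \<phi> y)"
      by (rule Bochner_Integration.integral_cong[OF refl]) (simp only: mult_ac)
    then show "(LINT x|lborel. ?F x y) = fourier u y * \<phi> y"
      by (simp add: fourier_eq)
  qed
  finally show ?thesis .
qed

text \<open>A test function is itself an integrand of the transform, with parameters
  \<open>-1\<close> and \<open>0\<close>, for its inversion; see \<open>T_arg_test_fun\<close>. Its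
  Fourier transform thus inherits smoothness and rapid decay from \<open>T_int\<close>. A compact
  support that avoids 0 is turned by inversion into another one, whence every order
  \<open>a\<close>.\<close>

lemma conormal_test_fun_inverse:
  assumes "\<phi> \<in> test_fun_punctured"
  shows "conormal a (\<lambda>x. \<phi> (1 / x))"
proof -
  obtain e \<rho> where e: "e > 0" "\<rho> > 0" "\<And>x. \<bar>x\<bar> < e \<Longrightarrow> \<phi> x = 0" "\<And>x. \<bar>x\<bar> > \<rho> \<Longrightarrow> \<phi> x = 0"
    using test_fun_support[OF assms] by metis
  let ?f = "\<lambda>x. \<phi> (1 / x)"
  have sp: "?f \<in> smooth_punctured"
  proof (rule smooth_puncturedI)
    show "ck_on n (- {0}) ?f" for n
    proof (rule ck_on_compose[where V=UNIV and g="\<lambda>x. 1 / x"])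
      show "ck_on n (- {0}) (\<lambda>x. complex_of_real (1 / x))"
        using ck_on_divide[of "- {0}" of_real n "\<lambda>x. 1"] by simp
    qed (auto intro: smooth_on_imp_ck_on test_fun_smooth assms)
  qed (simp add: test_fun_0[OF assms])
  have far: "?f x = 0" if "\<bar>x\<bar> > 1 / e" for x
  proof (rule e(3))
    have "x \<noteq> 0" using that e(1) by auto
    then show "\<bar>1 / x\<bar> < e" using that e(1) by (simp add: field_simps)
  qed
  have theta_far: "(theta ^^ n) ?f x = 0" if "\<bar>x\<bar> > 1 / e" for n x
    using that by (induction n arbitrary: x) (auto intro: far theta_eq_0)
  have "decaying ?f"
    unfolding decaying_def
  proof (intro conjI allI sp)
    fix n k
    have "\<forall>\<^sub>F x in at_infinity. of_real (\<bar>x\<bar> ^ k) * (theta ^^ n) ?f x = 0"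
      unfolding eventually_at_infinity using theta_far by (intro exI[of _ "1 / e + 1"]) auto
    then show "((\<lambda>x. of_real (\<bar>x\<bar> ^ k) * (theta ^^ n) ?f x) \<longlongrightarrow> 0) at_infinity"
      by (rule tendsto_eventually)
  qed
  then show ?thesis
  proof (rule conormal_of_vanishing[of _ "1 / \<rho>"])
    fix x :: real assume "0 < \<bar>x\<bar>" "\<bar>x\<bar> < 1 / \<rho>"
    then show "?f x = 0" using e(2) by (intro e(4)) (simp add: field_simps)
  qed (use e in simp)
qed

lemma T_arg_test_fun:
  "\<phi> \<in> test_fun_punctured \<Longrightarrow> T_arg (-1) 0 (\<lambda>x. \<phi> (1 / x)) = \<phi>"
  by (auto simp: T_arg_def sgn_pow_def powr_def test_fun_0 fun_eq_iff)

lemma fourier_test_fun: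
  assumes "\<phi> \<in> test_fun_punctured"
  shows "fourier \<phi> = T_int (-1) 0 (\<lambda>x. \<phi> (1 / x))"
  by (simp add: T_int_def T_arg_test_fun[OF assms])

lemma fourier_test_fun_mult_ident:
  assumes "\<phi> \<in> test_fun_punctured"
  shows "fourier (\<lambda>x. of_real x * \<phi> x) = T_int (-2) 1 (\<lambda>x. \<phi> (1 / x))"
proof -
  have "of_real x * T_arg (-1) 0 (\<lambda>x. \<phi> (1 / x)) x = T_arg (-2) 1 (\<lambda>x. \<phi> (1 / x)) x" for x
    unfolding T_arg_mult_ident by simp
  then show ?thesis by (simp add: T_int_def T_arg_test_fun[OF assms])
qed

lemma T_arg_mult_T_int_bound:
  assumes "conormal a f" "\<And>b. conormal b q"
  shows "\<exists>C. \<forall>x. \<bar>x\<bar> ^ j * norm (T_arg \<alpha> \<eta> f x * T_int \<alpha>' \<eta>' q x) \<le> C"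
proof -
  \<comment> \<open>A natural number above the growth order of \<open>T_arg\<close>; being
    nonnegative, it also gives a bound that remains valid at 0.\<close>
  define k where "k = nat \<lceil>- a - Re \<alpha> - 1\<rceil>"
  have "- a - Re \<alpha> - 1 \<le> real k" unfolding k_def by linarith
  then obtain C where C: "C \<ge> 0" "\<And>x. x \<noteq> 0 \<Longrightarrow> norm (T_arg \<alpha> \<eta> f x) \<le> C * \<bar>x\<bar> powr real k"
    using T_arg_bound[OF assms(1), of \<alpha> "real k" \<eta>] by blast
  obtain D where D: "\<And>x. \<bar>x\<bar> ^ (j + k) * norm (T_int \<alpha>' \<eta>' q x) \<le> D"
    using T_int_rapid_bound[OF assms(2)[of "1 - Re \<alpha>'"]] by force
  have "\<bar>x\<bar> ^ j * norm (T_arg \<alpha> \<eta> f x * T_int \<alpha>' \<eta>' q x) \<le> C * D" for x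
  proof -
    have "norm (T_arg \<alpha> \<eta> f x) \<le> C * \<bar>x\<bar> ^ k"
      using C(1) C(2)[of x] by (cases "x = 0") (auto simp: powr_realpow)
    then have "\<bar>x\<bar> ^ j * (norm (T_arg \<alpha> \<eta> f x) * norm (T_int \<alpha>' \<eta>' q x))
        \<le> \<bar>x\<bar> ^ j * (C * \<bar>x\<bar> ^ k * norm (T_int \<alpha>' \<eta>' q x))"
      by (intro mult_left_mono mult_right_mono) auto
    also have "\<dots> = C * (\<bar>x\<bar> ^ (j + k) * norm (T_int \<alpha>' \<eta>' q x))" by (simp add: power_add)
    also have "\<dots> \<le> C * D" using C(1) D by (rule mult_left_mono[rotated])
    finally show ?thesis by (simp add: norm_mult)
  qed
  then show ?thesis by blast
qed

lemma continuous_T_int: "conormal a f \<Longrightarrow> a + Re \<alpha> \<ge> 2 \<Longrightarrow> continuous_on UNIV (T_int \<alpha> \<eta> f)"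
  by (rule ck_on_continuous[OF ck_on_T_int[where n=0]]) auto

lemma integrable_T_arg_mult_T_int:
  assumes "conormal a f" "\<And>b. conormal b q"
  shows "integrable lborel (\<lambda>x. T_arg \<alpha> \<eta> f x * T_int \<alpha>' \<eta>' q x)"
proof -
  obtain C where C: "\<And>x. \<bar>x\<bar> ^ 0 * norm (T_arg \<alpha> \<eta> f x * T_int \<alpha>' \<eta>' q x) \<le> C"
    using T_arg_mult_T_int_bound[OF assms] by blast
  obtain D where D: "\<And>x. \<bar>x\<bar> ^ 2 * norm (T_arg \<alpha> \<eta> f x * T_int \<alpha>' \<eta>' q x) \<le> D"
    using T_arg_mult_T_int_bound[OF assms] by blast
  have "continuous_on UNIV (\<lambda>x. T_arg \<alpha> \<eta> f x * T_int \<alpha>' \<eta>' q x)"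
    by (intro continuous_on_mult continuous_T_arg[OF assms(1)]
        continuous_T_int[OF assms(2)[of "2 - Re \<alpha>'"]]) simp
  then have "(\<lambda>x. T_arg \<alpha> \<eta> f x * T_int \<alpha>' \<eta>' q x) \<in> borel_measurable borel"
    by (rule borel_measurable_continuous_onI)
  then show ?thesis by (rule integrable_of_decay[of _ C D]) (use C D in simp_all)
qed

text \<open>The multiplication identity transferred to test functions. It holds for every \<alpha>,
  because the rapid decay of the Fourier transform of \<psi> compensates the polynomial growth of
  the integrand both in the integrals and in the boundary terms.\<close>

lemma T_distr_shift:
  assumes f: "conormal a f" and \<psi>: "\<psi> \<in> test_fun_punctured"
  shows "T_distr \<alpha> \<eta> f (\<lambda>y. 2 * of_real pi * \<i> * (of_real y * \<psi> y)) = T_distr (\<alpha> + 1) (\<eta> + 1) (T_shift \<alpha> f) \<psi>"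
proof -
  define q where "q = (\<lambda>x. \<psi> (1 / x))"
  have q: "conormal b q" for b unfolding q_def by (rule conormal_test_fun_inverse[OF \<psi>])
  let ?c = "2 * complex_of_real pi * \<i>"
  have f': "conormal a (T_shift \<alpha> f)" by (rule conormal_T_shift[OF f])
  obtain C where C: "\<And>x. \<bar>x\<bar> ^ 1 * norm (T_arg \<alpha> \<eta> f x * T_int (-1) 0 q x) \<le> C"
    using T_arg_mult_T_int_bound[OF f q] by blast
  let ?A = "\<lambda>x. T_arg \<alpha> \<eta> f x * T_int (-2) 1 q x"
  let ?B = "\<lambda>x. T_arg (\<alpha> + 1) (\<eta> + 1) (T_shift \<alpha> f) x * T_int (-1) 0 q x"
  have iA: "integrable lborel ?A" and iB: "integrable lborel ?B"
    by (intro integrable_T_arg_mult_T_int[OF f q] integrable_T_arg_mult_T_int[OF f' q])+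
  have "(LINT x|lborel. - ?c * ?A x + ?B x) = 0"
  proof (rule integral_derivative_eq_0)
    show "((\<lambda>x. T_arg \<alpha> \<eta> f x * T_int (-1) 0 q x) has_vector_derivative - ?c * ?A x + ?B x) (at x)" for x
    proof -
      have "(T_int (-1) 0 q has_vector_derivative - ?c * T_int (-1 - 1) (0 + 1) q x) (at x)"
        by (rule has_vector_derivative_T_int[OF q[of 3]]) simp
      then have "(T_int (-1) 0 q has_vector_derivative - ?c * T_int (-2) 1 q x) (at x)" by simp
      from has_vector_derivative_mult[OF has_vector_derivative_T_arg[OF f, of \<alpha> \<eta>] this]
      show ?thesis by (simp only: mult.left_commute)
    qed
    show "continuous_on UNIV (\<lambda>x. - ?c * ?A x + ?B x)"
      by (intro continuous_intros continuous_T_arg[OF f] continuous_T_arg[OF f'] continuous_T_int[OF q[of 4]]) auto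
    show "integrable lborel (\<lambda>x. - ?c * ?A x + ?B x)"
      by (intro Bochner_Integration.integrable_add integrable_mult_right iA iB)
    show "((\<lambda>x. T_arg \<alpha> \<eta> f x * T_int (-1) 0 q x) \<longlongrightarrow> 0) at_top"
      "((\<lambda>x. T_arg \<alpha> \<eta> f x * T_int (-1) 0 q x) \<longlongrightarrow> 0) at_bot"
      by (rule tendsto_0_at_top_bot_of_decay[of _ C], use C in simp)+
  qed
  then have "(LINT x|lborel. ?B x) = ?c * (LINT x|lborel. ?A x)"
    using iA iB by (simp add: eq_neg_iff_add_eq_0 add.commute)
  moreover have "T_distr \<alpha> \<eta> f (\<lambda>y. ?c * (of_real y * \<psi> y)) = ?c * (LINT x|lborel. ?A x)"
  proof -
    have "fourier (\<lambda>y. ?c * (of_real y * \<psi> y)) = (\<lambda>x. ?c * T_int (-2) 1 q x)"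
      using fourier_scale[of ?c "\<lambda>y. of_real y * \<psi> y"]
      unfolding fourier_test_fun_mult_ident[OF \<psi>] q_def[symmetric] by blast
    then have "T_distr \<alpha> \<eta> f (\<lambda>y. ?c * (of_real y * \<psi> y)) = (LINT x|lborel. ?c * ?A x)"
      by (simp add: T_distr_def fourier_distr_def distr_of_fun_def mult.left_commute)
    then show ?thesis by simp
  qed
  moreover have "T_distr (\<alpha> + 1) (\<eta> + 1) (T_shift \<alpha> f) \<psi> = (LINT x|lborel. ?B x)"
    unfolding T_distr_def fourier_distr_def distr_of_fun_def fourier_test_fun[OF \<psi>] q_def ..
  ultimately show ?thesis by simp
qed

text \<open>Dividing by \<open>y\<close> is possible because the support avoids 0; here the
  restriction to the punctured line enters.\<close>

lemma test_fun_divide: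
  assumes "\<phi> \<in> test_fun_punctured"
  shows "(\<lambda>y. \<phi> y / (2 * of_real pi * \<i> * of_real y)) \<in> test_fun_punctured"
proof -
  obtain e where e: "e > 0" "\<And>x. \<bar>x\<bar> < e \<Longrightarrow> \<phi> x = 0"
    using test_fun_support[OF assms] by metis
  have "smooth_on UNIV (\<lambda>y. 1 / (2 * of_real pi * \<i>) * (\<phi> y / of_real y ^ 1))"
    by (intro smooth_mult smooth_const smooth_divide_power[OF test_fun_smooth[OF assms] e])
  then have "smooth_on UNIV (\<lambda>y. \<phi> y / (2 * of_real pi * \<i> * of_real y))"
    by simp
  then show ?thesis using assms unfolding test_fun_punctured_def by fastforce
qed

lemma T_distr_eq_T_int:
  assumes "conormal a f" "a + Re \<alpha> \<ge> 1" "\<phi> \<in> test_fun_punctured"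
  shows "T_distr \<alpha> \<eta> f \<phi> = (LINT y|lborel. T_int \<alpha> \<eta> f y * \<phi> y)"
  unfolding T_distr_def fourier_distr_def distr_of_fun_def T_int_def
  by (rule fourier_multiplication_formula[OF integrable_T_arg[OF assms(1,2)] integrable_test_fun[OF assms(3)]])

lemma decaying_T_shift:
  assumes "decaying f" shows "decaying (T_shift \<alpha> f)"
  unfolding T_shift_eq using assms by (intro decaying_add decaying_scale decaying_theta)

lemma singular_at_0_T_shift:
  assumes "singular_at_0 a f" shows "singular_at_0 a (T_shift \<alpha> f)"
  unfolding T_shift_eq using assms by (intro singular_at_0_add singular_at_0_scale singular_at_0_theta)

text \<open>Each differentiation of the integrand raises \<open>\<alpha>\<close> by one, at the price of dividing by
  \<open>2\<pi>iy\<close>; after finitely many steps the integral converges.\<close>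

lemma restricts_to_S_sis:
  assumes "decaying f" "singular_at_0 a f" "a + Re \<alpha> + real m \<ge> 2"
  shows "\<exists>h\<in>S_sis. restricts_to (T_distr \<alpha> \<eta> f) h"
  using assms
proof (induction m arbitrary: \<alpha> \<eta> f)
  case 0
  let ?h = "\<lambda>y. if y = 0 then 0 else T_int \<alpha> \<eta> f y"
  have c: "conormal a f" by (rule conormal_of_singular_at_0[OF 0(1,2)])
  have h: "?h \<in> S_sis" by (rule T_int_in_S_sis[OF 0(1,2)]) (use 0 in simp)
  moreover have "T_distr \<alpha> \<eta> f \<phi> = distr_of_fun ?h \<phi>" if "\<phi> \<in> test_fun_punctured" for \<phi>
  proof -
    have "(\<lambda>y. ?h y * \<phi> y) = (\<lambda>y. T_int \<alpha> \<eta> f y * \<phi> y)"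
      using test_fun_0[OF that] by (auto simp: fun_eq_iff)
    moreover have "T_distr \<alpha> \<eta> f \<phi> = (LINT y|lborel. T_int \<alpha> \<eta> f y * \<phi> y)"
      by (rule T_distr_eq_T_int[OF c _ that]) (use 0 in simp)
    ultimately show ?thesis by (simp only: distr_of_fun_def)
  qed
  ultimately show ?case
    unfolding restricts_to_def by (intro bexI[of _ ?h]) (auto simp: S_sis_def)
next
  case (Suc m)
  have "\<exists>h\<in>S_sis. restricts_to (T_distr (\<alpha> + 1) (\<eta> + 1) (T_shift \<alpha> f)) h"
    by (rule Suc.IH[OF decaying_T_shift[OF Suc.prems(1)] singular_at_0_T_shift[OF Suc.prems(2)]])
      (use Suc.prems in simp)
  then obtain g where g: "g \<in> S_sis" "\<And>\<psi>. \<psi> \<in> test_fun_punctured \<Longrightarrow>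
      T_distr (\<alpha> + 1) (\<eta> + 1) (T_shift \<alpha> f) \<psi> = distr_of_fun g \<psi>"
    unfolding restricts_to_def by blast
  let ?c = "2 * complex_of_real pi * \<i>"
  \<comment> \<open>The density for \<alpha> is the one for \<open>\<alpha> + 1\<close> divided by
    the factor that was moved onto the test function.\<close>
  define h where "h = (\<lambda>y. (1 / ?c) * (g y / of_real y))"
  have "h \<in> S_sis"
  proof -
    obtain b where b: "decaying g" "singular_at_0 b g" using g(1) unfolding S_sis_iff by blast
    have "decaying h" unfolding h_def by (intro decaying_scale decaying_divide b)
    \<comment> \<open>The division lowers the bound on the exponents by one, which is harmless since
      \<open>S_sis\<close> leaves that bound free.\<close>
    moreover have "singular_at_0 (b - 1) h"
      unfolding h_def by (intro singular_at_0_scale singular_at_0_divide b)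
    ultimately show ?thesis unfolding S_sis_iff by blast
  qed
  moreover have "T_distr \<alpha> \<eta> f \<phi> = distr_of_fun h \<phi>" if \<phi>: "\<phi> \<in> test_fun_punctured" for \<phi>
  proof -
    let ?\<psi> = "\<lambda>y. \<phi> y / (?c * of_real y)"
    have c: "?c \<noteq> 0" by simp
    have "(\<lambda>y. ?c * (of_real y * ?\<psi> y)) = \<phi>"
      using test_fun_0[OF \<phi>] by (auto simp: fun_eq_iff)
    then have "T_distr \<alpha> \<eta> f \<phi> = T_distr (\<alpha> + 1) (\<eta> + 1) (T_shift \<alpha> f) ?\<psi>"
      using T_distr_shift[OF conormal_of_singular_at_0[OF Suc.prems(1,2)] test_fun_divide[OF \<phi>]] by simp
    also have "\<dots> = distr_of_fun g ?\<psi>" by (rule g(2)[OF test_fun_divide[OF \<phi>]])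
    also have "\<dots> = distr_of_fun h \<phi>" by (simp add: distr_of_fun_def h_def)
    finally show ?thesis .
  qed
  ultimately show ?case
    unfolding restricts_to_def by (intro bexI[of _ h]) (auto simp: S_sis_def)
qed

text \<open>The fundamental lemma of the calculus of variations: if the two densities differ at a
  point, a bump function near this point separates them.\<close>

lemma restricts_to_unique:
  assumes "restricts_to u h" "restricts_to u g"
  shows "h = g"
proof (rule ccontr)
  assume "h \<noteq> g"
  have sp: "h \<in> smooth_punctured" "g \<in> smooth_punctured" using assms by (auto simp: restricts_to_def)
  define d where "d = (\<lambda>x. h x - g x)"
  obtain x0 where x0: "d x0 \<noteq> 0" using \<open>h \<noteq> g\<close> by (auto simp: d_def fun_eq_iff)
  have nz: "x0 \<noteq> 0" using x0 smooth_punctured_0[OF sp(1)] smooth_punctured_0[OF sp(2)] by (auto simp: d_def)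
  have cont: "continuous_on (- {0}) h" "continuous_on (- {0}) g"
    by (intro ck_on_continuous[of 0] smooth_punctured_ck_on sp)+
  then have "continuous_on (- {0}) (\<lambda>x. Re (cnj (d x0) * d x))"
    unfolding d_def by (intro continuous_intros)
  then have "isCont (\<lambda>x. Re (cnj (d x0) * d x)) x0"
    using nz by (simp add: continuous_on_eq_continuous_at open_Compl)
  moreover have val: "Re (cnj (d x0) * d x0) = (norm (d x0))\<^sup>2"
    by (metis complex_norm_square mult.commute Re_complex_of_real)
  \<comment> \<open>At \<open>x0\<close> the real part equals \<open>2 * m\<close>, so by continuity
    it stays above \<open>m\<close> nearby.\<close>
  define m where "m = (norm (d x0))\<^sup>2 / 2"
  have m: "m > 0" using x0 by (simp add: m_def)
  ultimately obtain r where r: "r > 0"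
    "\<And>x. dist x x0 < r \<Longrightarrow> dist (Re (cnj (d x0) * d x)) (Re (cnj (d x0) * d x0)) < m"
    unfolding continuous_at_eps_delta using m by metis
  \<comment> \<open>Smaller than \<open>r\<close>, so that the lower bound holds, and smaller than
    \<open>|x0|\<close>, so that the support avoids 0.\<close>
  define \<delta> where "\<delta> = min r \<bar>x0\<bar> / 2"
  have \<delta>: "\<delta> > 0" "\<delta> < r" "\<delta> < \<bar>x0\<bar>" using r(1) nz by (auto simp: \<delta>_def min_def)
  have lower: "Re (cnj (d x0) * d x) \<ge> m" if "\<bar>x - x0\<bar> \<le> \<delta>" for x
  proof -
    have "dist x x0 < r" using that \<delta>(2) by (simp add: dist_real_def)
    from r(2)[OF this] have "\<bar>Re (cnj (d x0) * d x) - 2 * m\<bar> < m"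
      unfolding val dist_real_def by (simp add: m_def)
    then show ?thesis by linarith
  qed
  \<comment> \<open>The conjugate of \<open>d x0\<close> turns the real part of the product with
    \<open>d\<close> into the quantity bounded from below. The scaled cutoff is 1 within distance
    \<open>\<delta> / 2\<close> of \<open>x0\<close> and 0 from distance \<delta> on.\<close>
  define \<phi> where "\<phi> = (\<lambda>x. cnj (d x0) * of_real (cutoff (2 / \<delta> * (x - x0))))"
  let ?K = "{x0 - \<delta>..x0 + \<delta>}"
  have K0: "0 \<notin> ?K" using \<delta> by auto
  have zero: "cutoff (2 / \<delta> * (x - x0)) = 0" if "x \<notin> ?K" for x
  proof (rule cutoff_eq_0)
    have "\<bar>x - x0\<bar> \<ge> \<delta>" using that by auto
    then show "\<bar>2 / \<delta> * (x - x0)\<bar> \<ge> 2" using \<delta>(1) by (simp add: abs_mult field_simps)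
  qed
  have \<phi>s: "smooth_on UNIV \<phi>"
  proof (rule smooth_onI)
    fix n
    have "ck_on n UNIV (\<lambda>x. complex_of_real (2 / \<delta>) * (of_real x - of_real x0))"
      by (intro ck_on_scale ck_on_diff ck_on_of_real ck_on_const)
    then have "ck_on n UNIV (\<lambda>x. complex_of_real (2 / \<delta> * (x - x0)))" by simp
    then have "ck_on n UNIV (\<lambda>x. complex_of_real (cutoff (2 / \<delta> * (x - x0))))"
      by (rule ck_on_compose[of "\<lambda>x. 2 / \<delta> * (x - x0)" UNIV UNIV n "\<lambda>x. complex_of_real (cutoff x)", rotated 2])
        (auto intro: smooth_on_imp_ck_on[OF smooth_cutoff])
    then show "ck_on n UNIV \<phi>" unfolding \<phi>_def by (rule ck_on_scale)
  qed simp
  have "\<phi> \<in> test_fun_punctured"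
    unfolding test_fun_punctured_def using \<phi>s K0 zero
    by (intro CollectI conjI exI[of _ ?K]) (auto simp: \<phi>_def)
  then have eq: "(LINT x|lborel. h x * \<phi> x) = (LINT x|lborel. g x * \<phi> x)"
    using assms unfolding restricts_to_def distr_of_fun_def by metis
  have int: "integrable lborel (\<lambda>x. k x * \<phi> x)" if "continuous_on (- {0}) k" for k
  proof (rule integrable_compact_support[of ?K])
    show "continuous_on ?K (\<lambda>x. k x * \<phi> x)"
      by (intro continuous_on_mult smooth_continuous[OF \<phi>s] continuous_on_subset[OF that]) (use K0 in auto)
    show "k x * \<phi> x = 0" if "x \<notin> ?K" for x using zero[OF that] by (simp add: \<phi>_def)
  qed simp
  note int = int[OF cont(1)] int[OF cont(2)]
  have intd: "integrable lborel (\<lambda>x. Re (d x * \<phi> x))"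
    using Bochner_Integration.integrable_diff[OF int] by (intro integrable_Re) (simp add: d_def left_diff_distrib)
  have "(LINT x|lborel. Re (d x * \<phi> x)) = Re (LINT x|lborel. d x * \<phi> x)"
    using Bochner_Integration.integrable_diff[OF int]
    by (intro integral_Re) (simp add: d_def left_diff_distrib)
  also have "(LINT x|lborel. d x * \<phi> x) = (LINT x|lborel. h x * \<phi> x) - (LINT x|lborel. g x * \<phi> x)"
    unfolding Bochner_Integration.integral_diff[OF int, symmetric] by (simp add: d_def left_diff_distrib)
  finally have "(LINT x|lborel. Re (d x * \<phi> x)) = 0" using eq by simp
  \<comment> \<open>On the inner interval, of length \<delta>, the integrand is at least
    \<open>m\<close>, and elsewhere it is nonnegative; its integral can therefore not
    vanish.\<close>
  moreover have "(LINT x|lborel. m * indicator {x0 - \<delta> / 2..x0 + \<delta> / 2} x) \<le> (LINT x|lborel. Re (d x * \<phi> x))"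
  proof (rule integral_mono)
    show "integrable lborel (\<lambda>x. m * indicator {x0 - \<delta> / 2..x0 + \<delta> / 2} x)"
      by (intro integrable_mult_right integrable_real_indicator) (auto simp: emeasure_lborel_Icc_eq)
    show "m * indicator {x0 - \<delta> / 2..x0 + \<delta> / 2} x \<le> Re (d x * \<phi> x)" for x
    proof -
      have re: "Re (d x * \<phi> x) = Re (cnj (d x0) * d x) * cutoff (2 / \<delta> * (x - x0))"
        by (simp add: \<phi>_def algebra_simps)
      show ?thesis
      proof (cases "x \<in> ?K")
        case True
        then have l: "Re (cnj (d x0) * d x) \<ge> m" by (intro lower) auto
        show ?thesis
        proof (cases "x \<in> {x0 - \<delta> / 2..x0 + \<delta> / 2}")
          case True
          then have "\<bar>x - x0\<bar> \<le> \<delta> / 2" unfolding abs_le_iff atLeastAtMost_iff by linarith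
          then have "2 / \<delta> * \<bar>x - x0\<bar> \<le> 1" using \<delta>(1) by (simp add: divide_le_eq)
          moreover have "\<bar>2 / \<delta>\<bar> = 2 / \<delta>" using \<delta>(1) by simp
          ultimately have "\<bar>2 / \<delta> * (x - x0)\<bar> \<le> 1" by (simp only: abs_mult)
          then have "cutoff (2 / \<delta> * (x - x0)) = 1" by (rule cutoff_eq_1)
          then show ?thesis using re l True by simp
        next
          case False
          have "0 \<le> Re (cnj (d x0) * d x) * cutoff (2 / \<delta> * (x - x0))"
            using l m cutoff_nonneg by (intro mult_nonneg_nonneg) auto
          then show ?thesis using re False by simp
        qed
      next
        case False
        then show ?thesis using re zero[OF False] \<delta>(1) by (auto simp: indicator_def)
      qed
    qed
  qed (rule intd)
  moreover have "(LINT x|lborel. m * indicator {x0 - \<delta> / 2..x0 + \<delta> / 2} x) = m * \<delta>"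
    using \<delta>(1) by simp
  ultimately have "m * \<delta> \<le> 0" by (simp only:)
  then show False using mult_pos_pos[OF m \<delta>(1)] by simp
qed

text \<open>As \<open>T\<close> is given by a definite description, the first conjunct certifies
  that it denotes the restriction of the distribution; without it, membership in
  \<open>S_sis\<close> could concern an unspecified value.\<close>

theorem theorem6p6:
  fixes \<alpha> :: complex and \<eta> :: bit
  shows "(\<forall>f\<in>S_sis. restricts_to (T_distr \<alpha> \<eta> f) (T \<alpha> \<eta> f)) \<and> T \<alpha> \<eta> \<in> S_sis \<rightarrow> S_sis"
proof -
  have "restricts_to (T_distr \<alpha> \<eta> f) (T \<alpha> \<eta> f) \<and> T \<alpha> \<eta> f \<in> S_sis" if S: "f \<in> S_sis" for f
  proof -
    obtain a where f: "decaying f" "singular_at_0 a f" using S unfolding S_sis_iff by blast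
    obtain m where "2 - a - Re \<alpha> \<le> real m" using real_arch_simple by blast
    then have "a + Re \<alpha> + real m \<ge> 2" by simp
    from restricts_to_S_sis[OF f this] obtain h where
      h: "h \<in> S_sis" "restricts_to (T_distr \<alpha> \<eta> f) h" by blast
    have "T \<alpha> \<eta> f = h"
      unfolding T_def using h(2) restricts_to_unique by (intro the_equality) auto
    then show ?thesis using h by simp
  qed
  then show ?thesis by blast
qed

end
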